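(* Let $\varphi:\mathbb T^d\to\mathbb T^d$ be a $C^1$ map that preserves Lebesgue measure and generates an exponentially mixing dynamical system. Suppose $K_\epsilon$ is a periodized rescaled standard Gaussian, i.e. $K_\epsilon(x)=\sum_{n\in\mathbb Z^d}\epsilon^{-d}\check K\bigl((\check x+n)/\epsilon\bigr)$ where $\check K$ is the standard Gaussian density on $\mathbb R^d$. Then there exists a constant $C$ such that, for the Markov process $X_{n+1}=\varphi(X_n)+\epsilon\zeta_{n+1}$, $$t_{\mathrm{mix}}\le C|\ln\epsilon|^3$$ for all sufficiently small $\epsilon>0$.
   Context: $\mathbb T^d=\mathbb R^d/\mathbb Z^d$ and $\pi$ is Lebesgue (probability) measure on $\mathbb T^d$; for $x\in\mathbb T^d$, $\check x\in[0,1)^d$ is its representative. For each $\epsilon>0$, $(\epsilon\zeta_n)_{n\ge1}$ are i.i.d. $\mathbb T^d$-valued random variables, independent of $X_0$, whose law has density $K_\epsilon$ with respect to $\pi$. Mixing time: $t_{\mathrm{mix}}(\delta)=\min\{n\in\mathbb N:\ \|\mathrm{dist}(X_n)-\pi\|_{TV}\le\delta\text{ for all initial distributions of }X_0\}$ and $t_{\mathrm{mix}}=t_{\mathrm{mix}}(1/2)$, where total variation is normalized so that $\|\mu-\nu\|_{TV}=\sup_A|\mu(A)-\nu(A)|$ (half the $L^1$ distance of densities). Exponentially mixing: there are constants $D<\infty$, $\gamma>0$ such that for all mean-zero $f,g\in H^1(\mathbb T^d)$ and all $n\in\mathbb N$, $\bigl|\int_{\mathbb T^d}(f\circ\varphi^n)\,g\,d\pi\bigr|\le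 De^{-\gamma n}\|f\|_{H^1}\|g\|_{H^1}$. *)

theory Defs
  imports "HOL-Probability.Probability"
begin

section \<open>The torus\<close>

definition int_shift :: "real ^ 'n \<Rightarrow> real ^ 'n \<Rightarrow> bool"
  where "int_shift x y \<longleftrightarrow> (\<forall>i. x $ i - y $ i \<in> \<int>)"

lemma equivp_int_shift: "equivp (int_shift :: real ^ 'n \<Rightarrow> real ^ 'n \<Rightarrow> bool)"
proof (rule equivpI)
  show "reflp (int_shift :: real ^ 'n \<Rightarrow> real ^ 'n \<Rightarrow> bool)"
    by (rule reflpI) (simp add: int_shift_def)
  show "symp (int_shift :: real ^ 'n \<Rightarrow> real ^ 'n \<Rightarrow> bool)"
  proof (rule sympI)
    fix x y :: "real ^ 'n" assume "int_shift x y"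
    then have "- (x $ i - y $ i) \<in> \<int>" for i
      unfolding int_shift_def by (blast intro: Ints_minus)
    then show "int_shift y x" by (simp add: int_shift_def)
  qed
  show "transp (int_shift :: real ^ 'n \<Rightarrow> real ^ 'n \<Rightarrow> bool)"
  proof (rule transpI)
    fix x y z :: "real ^ 'n" assume "int_shift x y" "int_shift y z"
    then have "(x $ i - y $ i) + (y $ i - z $ i) \<in> \<int>" for i
      unfolding int_shift_def by (blast intro: Ints_add)
    then show "int_shift x z" by (simp add: int_shift_def)
  qed
qed

quotient_type (overloaded) 'n torus = "real ^ 'n" / int_shift
  by (rule equivp_int_shift)

lift_definition to_torus :: "real ^ 'n \<Rightarrow> 'n torus" is "\<lambda>x. x" .

lift_definition torus_rep :: "'n torus \<Rightarrow> real ^ 'n" is "\<lambda>x. \<chi> i. frac (x $ i)"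
proof -
  fix x y :: "real ^ 'n" assume "int_shift x y"
  have "frac (x $ i) = frac (y $ i)" for i
  proof -
    obtain k where "x $ i - y $ i = of_int k"
      using \<open>int_shift x y\<close> unfolding int_shift_def by (meson Ints_cases)
    then have "x $ i = y $ i + of_int k" by simp
    then show ?thesis by (simp add: frac_def)
  qed
  then show "(\<chi> i. frac (x $ i)) = (\<chi> i. frac (y $ i))" by simp
qed

instantiation torus :: (finite) ab_group_add
begin

lift_definition zero_torus :: "'a torus" is "0" .

lift_definition plus_torus :: "'a torus \<Rightarrow> 'a torus \<Rightarrow> 'a torus" is "(+)"
  unfolding int_shift_def by (simp add: add_diff_add Ints_add)

lift_definition uminus_torus :: "'a torus \<Rightarrow> 'a torus" is "uminus"
proof -
  fix x y :: "real ^ 'a" assume "int_shift x y"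
  then have "- (x $ i - y $ i) \<in> \<int>" for i
    unfolding int_shift_def by (blast intro: Ints_minus)
  then show "int_shift (- x) (- y)" by (simp add: int_shift_def)
qed

definition minus_torus :: "'a torus \<Rightarrow> 'a torus \<Rightarrow> 'a torus"
  where "minus_torus x y = x + (- y)"

instance
proof
  fix a b c :: "'a torus"
  show "a + b + c = a + (b + c)"
    by transfer (simp add: int_shift_def)
  show "a + b = b + a"
    by transfer (simp add: int_shift_def)
  show "0 + a = a"
    by transfer (simp add: int_shift_def)
  show "- a + a = 0"
    by transfer (simp add: int_shift_def)
  show "a - b = a + (- b)"
    by (rule minus_torus_def)
qed

end

text \<open>The quotient topology.\<close>

instantiation torus :: (finite) topological_space
begin

definition open_torus :: "'a torus set \<Rightarrow> bool"
  where "open_torus U \<longleftrightarrow> open (to_torus -` U)"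

instance
  by standard (auto simp: open_torus_def vimage_Union)

end

definition torus_measure :: "'n::finite torus measure"
  where "torus_measure =
    distr (restrict_space lborel {x :: real ^ 'n. \<forall>i. 0 \<le> x $ i \<and> x $ i < 1}) borel to_torus"


section \<open>Dynamics\<close>

text \<open>\<open>\<phi>\<close> is \<open>C\<^sup>1\<close> as a map of manifolds; the local inverses of \<open>to_torus\<close> are the charts.\<close>

definition torus_C1 :: "('n::finite torus \<Rightarrow> 'n torus) \<Rightarrow> bool"
  where "torus_C1 \<phi> \<longleftrightarrow>
    (\<forall>x. \<exists>U F. \<exists>F' :: real ^ 'n \<Rightarrow> (real ^ 'n) \<Rightarrow>\<^sub>L (real ^ 'n).
       open U \<and> x \<in> U \<and>
       (\<forall>y\<in>U. \<phi> (to_torus y) = to_torus (F y)) \<and>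
       (\<forall>y\<in>U. (F has_derivative blinfun_apply (F' y)) (at y)) \<and>
       continuous_on U F')"

definition torus_measure_preserving :: "('n::finite torus \<Rightarrow> 'n torus) \<Rightarrow> bool"
  where "torus_measure_preserving \<phi> \<longleftrightarrow>
    \<phi> \<in> measurable torus_measure torus_measure \<and>
    distr torus_measure torus_measure \<phi> = torus_measure"


section \<open>Sobolev space\<close>

definition torus_L2 :: "('n::finite torus \<Rightarrow> real) set"
  where "torus_L2 =
    {f \<in> borel_measurable torus_measure. integrable torus_measure (\<lambda>x. (f x)\<^sup>2)}"

definition torus_partial :: "'n::finite \<Rightarrow> ('n torus \<Rightarrow> real) \<Rightarrow> 'n torus \<Rightarrow> real"
  where "torus_partial i f x = deriv (\<lambda>t. f (x + to_torus (t *\<^sub>R axis i 1))) 0"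

text \<open>A function is \<open>C\<^sup>\<infinity>\<close> iff all its iterated partial derivatives, itself included, are
  (Frechet) differentiable everywhere.\<close>

definition torus_smooth :: "('n::finite torus \<Rightarrow> real) \<Rightarrow> bool"
  where "torus_smooth f \<longleftrightarrow>
    (\<forall>is x. (\<lambda>y. foldr torus_partial is f (to_torus y)) differentiable (at x))"

definition is_weak_partial ::
    "'n::finite \<Rightarrow> ('n torus \<Rightarrow> real) \<Rightarrow> ('n torus \<Rightarrow> real) \<Rightarrow> bool"
  where "is_weak_partial i f g \<longleftrightarrow>
    (\<forall>\<psi>. torus_smooth \<psi> \<longrightarrow>
       (\<integral>x. f x * torus_partial i \<psi> x \<partial>torus_measure) =
       - (\<integral>x. g x * \<psi> x \<partial>torus_measure))"

definition torus_H1 :: "('n::finite torus \<Rightarrow> real) set"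
  where "torus_H1 = {f \<in> torus_L2. \<forall>i. \<exists>g\<in>torus_L2. is_weak_partial i f g}"

text \<open>Weak derivatives are unique up to null sets, so for \<open>f \<in> torus_H1\<close> the norm below does not
  depend on the choice made here.\<close>

definition weak_partial :: "'n::finite \<Rightarrow> ('n torus \<Rightarrow> real) \<Rightarrow> 'n torus \<Rightarrow> real"
  where "weak_partial i f = (SOME g. g \<in> torus_L2 \<and> is_weak_partial i f g)"

definition H1_norm :: "('n::finite torus \<Rightarrow> real) \<Rightarrow> real"
  where "H1_norm f =
    sqrt ((\<integral>x. (f x)\<^sup>2 \<partial>torus_measure) +
          (\<Sum>i\<in>UNIV. \<integral>x. (weak_partial i f x)\<^sup>2 \<partial>torus_measure))"

definition exponentially_mixing :: "('n::finite torus \<Rightarrow> 'n torus) \<Rightarrow> bool"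
  where "exponentially_mixing \<phi> \<longleftrightarrow>
    (\<exists>D \<gamma> :: real. \<gamma> > 0 \<and>
      (\<forall>f\<in>torus_H1. \<forall>g\<in>torus_H1.
         (\<integral>x. f x \<partial>torus_measure) = 0 \<longrightarrow> (\<integral>x. g x \<partial>torus_measure) = 0 \<longrightarrow>
         (\<forall>n::nat. \<bar>\<integral>x. f ((\<phi> ^^ n) x) * g x \<partial>torus_measure\<bar>
            \<le> D * exp (- \<gamma> * real n) * H1_norm f * H1_norm g)))"


section \<open>Noise\<close>

definition std_gaussian :: "real ^ 'n::finite \<Rightarrow> real"
  where "std_gaussian x = (2 * pi) powr (- real CARD('n) / 2) * exp (- (norm x)\<^sup>2 / 2)"

definition periodized_gaussian :: "real \<Rightarrow> 'n::finite torus \<Rightarrow> real"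
  where "periodized_gaussian \<epsilon> x =
    (\<Sum>\<^sub>\<infinity>m\<in>{m :: real ^ 'n. \<forall>i. m $ i \<in> \<int>}.
       (1 / \<epsilon> ^ CARD('n)) * std_gaussian ((1 / \<epsilon>) *\<^sub>R (torus_rep x + m)))"

definition gaussian_noise :: "real \<Rightarrow> 'n::finite torus measure"
  where "gaussian_noise \<epsilon> = density torus_measure (\<lambda>x. ennreal (periodized_gaussian \<epsilon> x))"


section \<open>The Markov process and its mixing time\<close>

text \<open>\<open>x\<close> is the initial state and \<open>\<xi> n\<close> is the increment added in step \<open>n + 1\<close>.\<close>

primrec process ::
    "('n::finite torus \<Rightarrow> 'n torus) \<Rightarrow> 'n torus \<Rightarrow> (nat \<Rightarrow> 'n torus) \<Rightarrow> nat \<Rightarrow> 'n torus"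
  where
    "process \<phi> x \<xi> 0 = x"
  | "process \<phi> x \<xi> (Suc n) = \<phi> (process \<phi> x \<xi> n) + \<xi> n"

text \<open>The law of the \<open>n\<close>-th state when the initial state has law \<open>\<mu>\<close> and the increments are i.i.d.
  with law \<open>\<kappa>\<close> and independent of it, realized on the canonical probability space.\<close>

definition process_law ::
    "('n::finite torus \<Rightarrow> 'n torus) \<Rightarrow> 'n torus measure \<Rightarrow> 'n torus measure \<Rightarrow> nat
      \<Rightarrow> 'n torus measure"
  where "process_law \<phi> \<kappa> \<mu> n =
    distr (\<mu> \<Otimes>\<^sub>M (\<Pi>\<^sub>M k\<in>(UNIV :: nat set). \<kappa>)) borel (\<lambda>(x, \<xi>). process \<phi> x \<xi> n)"

definition tv_dist :: "'a measure \<Rightarrow> 'a measure \<Rightarrow> real"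
  where "tv_dist \<mu> \<nu> = (SUP A\<in>sets \<mu>. \<bar>measure \<mu> A - measure \<nu> A\<bar>)"

text \<open>The value is \<open>\<infinity>\<close> if no \<open>n\<close> has the required property.\<close>

definition mixing_time ::
    "('n::finite torus \<Rightarrow> 'n torus) \<Rightarrow> 'n torus measure \<Rightarrow> real \<Rightarrow> enat"
  where "mixing_time \<phi> \<kappa> \<delta> =
    Inf (enat ` {n. \<forall>\<mu>. prob_space \<mu> \<and> sets \<mu> = sets borel \<longrightarrow>
                        tv_dist (process_law \<phi> \<kappa> \<mu> n) torus_measure \<le> \<delta>})"

end

theory Submission
  imports Defs
begin

text \<open>Let \<open>K\<close> average a function over one step of noise and let \<open>U f = f \<circ> \<phi>\<close>, so that \<open>T = U K\<close> is
the Markov operator of the process. Testing the law of \<open>X\<^sub>n\<close> against an event \<open>A\<close> amounts to integrating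
\<open>T\<^sup>n (1\<^sub>A - \<pi>(A))\<close> against the initial law, so it suffices that \<open>T\<^sup>n h\<close> is uniformly small for mean-zero
\<open>h\<close> bounded by 1. Write \<open>L = \<bar>ln \<epsilon>\<bar>\<close>, and \<open>\<parallel>h\<parallel>\<close> for the norm of \<open>L\<^sup>2(\<pi>)\<close>, whose square is the \<open>energy\<close>.

Energy is lost because the noise and the dynamics cooperate. The operator \<open>K\<close> is the square of a
symmetric contraction, namely averaging over noise of half the variance, and this gives
\<open>\<parallel>K f - f\<parallel>\<^sup>2 \<le> \<parallel>f\<parallel>\<^sup>2 - \<parallel>K f\<parallel>\<^sup>2\<close> (\<open>energy_gauss_avg_defect\<close>). Hence if little energy were lost during \<open>N + 1\<close>
steps, \<open>K T\<^sup>N h\<close> would be close to the purely deterministic evolution \<open>K h \<circ> \<phi>\<^sup>N\<close>. But both \<open>K h\<close> and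
\<open>K T\<^sup>N h\<close> have \<open>H\<^sup>1\<close> norm \<open>O(\<parallel>h\<parallel> / \<epsilon>)\<close> (\<open>gauss_avg_H1\<close>), so exponential mixing makes them decorrelate once
\<open>N\<close> is a suitable multiple of \<open>L\<close>, and two functions that are nearly uncorrelated cannot be nearly
equal unless they are small. Balancing the two statements yields
\<open>\<parallel>T\<^bsup>N+1\<^esup> h\<parallel>\<^sup>2 \<le> (1 - 1 / (N + 2)) \<parallel>h\<parallel>\<^sup>2\<close> (\<open>energy_decay_of_decorrelation\<close>).

Iterating this about \<open>L\<^sup>2\<close> times reduces the energy to \<open>\<epsilon>\<^bsup>d+1\<^esup>\<close> after \<open>O(L\<^sup>3)\<close> steps, and one further step
converts energy into a uniform bound at the price of \<open>\<epsilon>\<^bsup>-d\<^esup>\<close>, a bound for the density of the noise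
(\<open>gauss_avg_sup_bound\<close>).

Two facts make the argument elementary. The wrapped lattice sum that defines the noise is the image of
the Gaussian law on \<open>\<real>\<^sup>d\<close> (\<open>gaussian_noise_eq_distr\<close>), so every property of \<open>K\<close> is a statement about
a Gaussian integral on \<open>\<real>\<^sup>d\<close> and no Fourier series enter. And weak derivatives are unique almost
everywhere (\<open>weak_partial_unique\<close>), so the \<open>H\<^sup>1\<close> norm of \<open>K h\<close> can be computed from the derivative that
falls on the Gaussian.\<close>

section \<open>The torus and its fundamental cell\<close>

definition fundamental_cell :: "(real ^ 'n) set"
  where "fundamental_cell = {x. \<forall>i. 0 \<le> x $ i \<and> x $ i < 1}"

definition integer_lattice :: "(real ^ 'n) set"
  where "integer_lattice = {m. \<forall>i. m $ i \<in> \<int>}"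

lemma to_torus_eq_iff: "to_torus x = to_torus y \<longleftrightarrow> x - y \<in> integer_lattice"
  by (simp add: torus.abs_eq_iff int_shift_def integer_lattice_def to_torus_def)

lemma to_torus_add: "to_torus (x + y) = to_torus x + to_torus y"
  by (simp add: to_torus_def plus_torus.abs_eq)

lemma to_torus_minus: "to_torus (- x) = - to_torus x"
  by (simp add: to_torus_def uminus_torus.abs_eq)

lemma to_torus_diff: "to_torus (x - y) = to_torus x - to_torus y"
  using to_torus_add[of x "-y"] by (simp add: to_torus_minus)

lemma to_torus_0: "to_torus 0 = 0"
  by (simp add: to_torus_def zero_torus_def)

lemma torus_rep_to_torus: "torus_rep (to_torus x) $ i = frac (x $ i)"
  by (simp add: to_torus_def torus_rep.abs_eq)

lemma to_torus_lattice_shift: "m \<in> integer_lattice \<Longrightarrow> to_torus (x + m) = to_torus x"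
  by (simp add: to_torus_eq_iff)

lemma to_torus_rep [simp]: "to_torus (torus_rep p) = p"
proof (induct p rule: torus.abs_induct)
  case (1 x)
  have "to_torus (torus_rep (to_torus x)) = to_torus x"
    by (simp add: to_torus_eq_iff integer_lattice_def torus_rep_to_torus frac_def)
  then show ?case by (simp add: to_torus_def)
qed

lemma torus_rep_in_cell: "torus_rep p \<in> fundamental_cell"
proof -
  have "torus_rep (to_torus (torus_rep p)) \<in> fundamental_cell"
    by (simp add: fundamental_cell_def torus_rep_to_torus frac_lt_1 del: to_torus_rep)
  then show ?thesis by simp
qed

lemma torus_rep_cell: "x \<in> fundamental_cell \<Longrightarrow> torus_rep (to_torus x) = x"
  by (simp add: vec_eq_iff torus_rep_to_torus fundamental_cell_def frac_eq)

lemma to_torus_measurable [measurable]: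
  "(to_torus :: real ^ 'n::finite \<Rightarrow> 'n torus) \<in> borel_measurable borel"
  by (rule borel_measurableI) (simp add: open_torus_def borel_open)

text \<open>The representative is discontinuous, but each superlevel set of a coordinate is open:
\<open>frac y > c\<close> with \<open>c \<ge> 0\<close> holds exactly on a union of open
intervals between an integer plus \<open>c\<close> and the next integer.\<close>

lemma torus_rep_measurable [measurable]:
  "(torus_rep :: 'n::finite torus \<Rightarrow> real ^ 'n) \<in> borel_measurable borel"
proof -
  have "(\<lambda>p::'n torus. torus_rep p $ i) \<in> borel_measurable borel" for i
  proof (subst borel_measurable_iff_greater, rule allI)
    fix c :: real
    consider "c < 0" | "0 \<le> c" by linarith
    then have "{p::'n torus. c < torus_rep p $ i} \<in> sets borel"
    proof cases
      case 1
      then have "{p::'n torus. c < torus_rep p $ i} = UNIV"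
        using torus_rep_in_cell by (auto simp: fundamental_cell_def intro: less_le_trans)
      then show ?thesis by simp
    next
      case 2
      have "to_torus -` {p::'n torus. c < torus_rep p $ i}
          = (\<Union>k::int. {x. of_int k + c < x $ i \<and> x $ i < of_int k + 1})"
      proof (intro equalityI subsetI)
        fix x :: "real ^ 'n" assume "x \<in> to_torus -` {p::'n torus. c < torus_rep p $ i}"
        then have "c < frac (x $ i)" by (simp add: torus_rep_to_torus)
        then have "of_int \<lfloor>x $ i\<rfloor> + c < x $ i \<and> x $ i < of_int \<lfloor>x $ i\<rfloor> + 1"
          unfolding frac_def by linarith
        then show "x \<in> (\<Union>k::int. {x. of_int k + c < x $ i \<and> x $ i < of_int k + 1})" by blast
      next
        fix x :: "real ^ 'n"
        assume "x \<in> (\<Union>k::int. {x. of_int k + c < x $ i \<and> x $ i < of_int k + 1})"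
        then obtain k :: int where *: "of_int k + c < x $ i" "x $ i < of_int k + 1" by blast
        with 2 have "\<lfloor>x $ i\<rfloor> = k" by (intro floor_unique) auto
        with * show "x \<in> to_torus -` {p::'n torus. c < torus_rep p $ i}"
          by (simp add: torus_rep_to_torus frac_def)
      qed
      moreover have "open (\<Union>k::int. {x :: real ^ 'n. of_int k + c < x $ i \<and> x $ i < of_int k + 1})"
        by (intro open_UN ballI open_Collect_conj open_Collect_less continuous_intros)
      ultimately have "open {p::'n torus. c < torus_rep p $ i}"
        unfolding open_torus_def by simp
      then show ?thesis by (rule borel_open)
    qed
    then show "{w \<in> space borel. c < torus_rep (w::'n torus) $ i} \<in> sets borel" by simp
  qed
  then show ?thesis
    by (subst borel_measurable_euclidean_space) (auto simp: Basis_vec_def inner_axis)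
qed

lemma torus_add_measurable [measurable (raw)]:
  fixes f g :: "'a \<Rightarrow> 'n::finite torus"
  assumes [measurable]: "f \<in> borel_measurable M" "g \<in> borel_measurable M"
  shows "(\<lambda>x. f x + g x) \<in> borel_measurable M"
proof -
  have "(\<lambda>x. to_torus (torus_rep (f x) + torus_rep (g x))) \<in> borel_measurable M"
    by measurable
  then show ?thesis by (simp add: to_torus_add)
qed

lemma fundamental_cell_measurable [measurable]: "(fundamental_cell :: (real^'n::finite) set) \<in> sets borel"
  unfolding fundamental_cell_def by measurable

lemma integer_lattice_countable: "countable (integer_lattice :: (real^'n::finite) set)"
  unfolding integer_lattice_def
  by (intro countable_vector) (auto simp: Ints_def)

lemma integer_lattice_uminus: "m \<in> integer_lattice \<Longrightarrow> - m \<in> integer_lattice"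
  by (simp add: integer_lattice_def)

lemma ex1_lattice_shift_in_cell: "\<exists>!m. m \<in> integer_lattice \<and> x - m \<in> fundamental_cell"
proof (intro ex1I conjI)
  show "(\<chi> i. of_int \<lfloor>x $ i\<rfloor>) \<in> integer_lattice" by (simp add: integer_lattice_def)
  show "x - (\<chi> i. of_int \<lfloor>x $ i\<rfloor>) \<in> fundamental_cell" 
    by (simp add: fundamental_cell_def frac_def[symmetric] frac_lt_1)
next
  fix m assume m: "m \<in> integer_lattice \<and> x - m \<in> fundamental_cell"
  have "m $ i = of_int \<lfloor>x $ i\<rfloor>" for i
  proof -
    obtain k where k: "m $ i = of_int k" using m by (auto simp: integer_lattice_def elim!: Ints_cases)
    with m have "0 \<le> x $ i - of_int k" "x $ i - of_int k < 1"
      by (auto simp: fundamental_cell_def dest: spec[of _ i])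
    then have "\<lfloor>x $ i\<rfloor> = k" by (intro floor_unique) auto
    with k show ?thesis by simp
  qed
  then show "m = (\<chi> i. of_int \<lfloor>x $ i\<rfloor>)" by (simp add: vec_eq_iff)
qed

lemma nn_integral_indicator_cell:
  "(\<integral>\<^sup>+m. indicator fundamental_cell (x - m) \<partial>count_space integer_lattice) = 1"
proof -
  obtain m0 where m0: "m0 \<in> integer_lattice" "x - m0 \<in> fundamental_cell"
    and u: "\<And>m. m \<in> integer_lattice \<Longrightarrow> x - m \<in> fundamental_cell \<Longrightarrow> m = m0"
    using ex1_lattice_shift_in_cell[of x] by auto
  have "(\<integral>\<^sup>+m. indicator fundamental_cell (x - m) \<partial>count_space integer_lattice)
      = (\<integral>\<^sup>+m. indicator {m0} m \<partial>count_space integer_lattice)"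
    using m0 by (intro nn_integral_cong) (auto simp: indicator_def dest: u)
  also have "\<dots> = 1" using m0 by simp
  finally show ?thesis .
qed

lemma nn_integral_lborel_shift:
  fixes f :: "'a::euclidean_space \<Rightarrow> ennreal"
  assumes [measurable]: "f \<in> borel_measurable borel"
  shows "(\<integral>\<^sup>+x. f (x + c) \<partial>lborel) = (\<integral>\<^sup>+x. f x \<partial>lborel)"
  by (subst lborel_distr_plus[of c, symmetric]) (simp add: nn_integral_distr add.commute)

text \<open>The integer translates of the fundamental cell tile the space, so an integral over the space is
an integral over the cell of a lattice sum.\<close>

lemma nn_integral_lborel_cells:
  fixes f :: "real ^ 'n::finite \<Rightarrow> ennreal"
  assumes [measurable]: "f \<in> borel_measurable borel"
  shows "(\<integral>\<^sup>+x. f x \<partial>lborel)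
    = (\<integral>\<^sup>+x. (\<integral>\<^sup>+m. f (x + m) \<partial>count_space integer_lattice) * indicator fundamental_cell x \<partial>lborel)"
proof -
  have "(\<integral>\<^sup>+x. f x \<partial>lborel)
      = (\<integral>\<^sup>+x. (\<integral>\<^sup>+m. f x * indicator fundamental_cell (x - m) \<partial>count_space integer_lattice) \<partial>lborel)"
    by (simp add: nn_integral_cmult nn_integral_indicator_cell)
  also have "\<dots> = (\<integral>\<^sup>+m. (\<integral>\<^sup>+x. f x * indicator fundamental_cell (x - m) \<partial>lborel) \<partial>count_space integer_lattice)"
    by (rule nn_integral_count_space_nn_integral[OF integer_lattice_countable]) measurable
  also have "\<dots> = (\<integral>\<^sup>+m. (\<integral>\<^sup>+x. f (x + m) * indicator fundamental_cell x \<partial>lborel) \<partial>count_space integer_lattice)"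
  proof (rule nn_integral_cong)
    fix m :: "real ^ 'n"
    show "(\<integral>\<^sup>+x. f x * indicator fundamental_cell (x - m) \<partial>lborel)
        = (\<integral>\<^sup>+x. f (x + m) * indicator fundamental_cell x \<partial>lborel)"
      by (subst nn_integral_lborel_shift[of _ m, symmetric]) auto
  qed
  also have "\<dots> = (\<integral>\<^sup>+x. (\<integral>\<^sup>+m. f (x + m) * indicator fundamental_cell x \<partial>count_space integer_lattice) \<partial>lborel)"
    by (rule nn_integral_count_space_nn_integral[OF integer_lattice_countable, symmetric]) measurable
  finally show ?thesis
    by (simp add: nn_integral_multc)
qed

lemma sets_torus_measure [simp, measurable_cong]: "sets torus_measure = sets borel"
  by (simp add: torus_measure_def)

lemma space_torus_measure [simp]: "space torus_measure = UNIV"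
  by (simp add: torus_measure_def)

lemma nn_integral_torus_measure:
  fixes f :: "'n::finite torus \<Rightarrow> ennreal"
  assumes [measurable]: "f \<in> borel_measurable borel"
  shows "(\<integral>\<^sup>+p. f p \<partial>torus_measure) = (\<integral>\<^sup>+x. f (to_torus x) * indicator fundamental_cell x \<partial>lborel)"
proof -
  have [measurable]: "to_torus \<in> borel_measurable (restrict_space lborel (fundamental_cell :: (real^'n) set))"
    by (rule measurable_restrict_space1) measurable
  show ?thesis
    unfolding torus_measure_def fundamental_cell_def[symmetric]
    by (subst nn_integral_distr) (auto simp: nn_integral_restrict_space)
qed

lemma lattice_sum_measurable:
  fixes k :: "real ^ 'n::finite \<Rightarrow> ennreal"
  assumes [measurable]: "k \<in> borel_measurable borel"
  shows "(\<lambda>x. \<integral>\<^sup>+m. k (x + m) \<partial>count_space integer_lattice) \<in> borel_measurable borel"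
proof -
  interpret sigma_finite_measure "count_space (integer_lattice :: (real^'n) set)"
    by (rule sigma_finite_measure_count_space_countable[OF integer_lattice_countable])
  have "(\<lambda>(x, m). k (x + m)) \<in> borel_measurable (borel \<Otimes>\<^sub>M count_space (integer_lattice :: (real^'n) set))"
    by (subst measurable_pair_swap_iff, rule measurable_pair_measure_countable1[OF integer_lattice_countable]) simp
  then show ?thesis by (rule borel_measurable_nn_integral)
qed

text \<open>Unfolding: integrating a periodic function against a weight on \<open>\<real>\<^sup>d\<close> is
integrating it over the torus against the periodized weight. It is applied with a translated
cell as weight, which gives translation invariance, and with a Gaussian weight, which identifies
the noise.\<close>

lemma nn_integral_unfold:
  fixes f :: "'n::finite torus \<Rightarrow> ennreal" and k :: "real ^ 'n \<Rightarrow> ennreal"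
  assumes [measurable]: "f \<in> borel_measurable borel" "k \<in> borel_measurable borel"
  shows "(\<integral>\<^sup>+x. f (to_torus x) * k x \<partial>lborel)
    = (\<integral>\<^sup>+p. f p * (\<integral>\<^sup>+m. k (torus_rep p + m) \<partial>count_space integer_lattice) \<partial>torus_measure)"
proof -
  note [measurable] = lattice_sum_measurable[OF assms(2)]
  have "(\<integral>\<^sup>+x. f (to_torus x) * k x \<partial>lborel)
      = (\<integral>\<^sup>+x. (\<integral>\<^sup>+m. f (to_torus (x + m)) * k (x + m) \<partial>count_space integer_lattice) * indicator fundamental_cell x \<partial>lborel)"
    by (rule nn_integral_lborel_cells) measurable
  also have "\<dots> = (\<integral>\<^sup>+x. (\<integral>\<^sup>+m. f (to_torus x) * k (x + m) \<partial>count_space integer_lattice) * indicator fundamental_cell x \<partial>lborel)"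
    by (intro nn_integral_cong arg_cong2[where f="(*)"] refl) (simp add: to_torus_lattice_shift)
  also have "\<dots> = (\<integral>\<^sup>+x. f (to_torus x) * (\<integral>\<^sup>+m. k (torus_rep (to_torus x) + m) \<partial>count_space integer_lattice) * indicator fundamental_cell x \<partial>lborel)"
    by (intro nn_integral_cong) (auto simp: nn_integral_cmult torus_rep_cell indicator_def)
  also have "\<dots> = (\<integral>\<^sup>+p. f p * (\<integral>\<^sup>+m. k (torus_rep p + m) \<partial>count_space integer_lattice) \<partial>torus_measure)"
    by (subst nn_integral_torus_measure) auto
  finally show ?thesis .
qed

text \<open>A translate of the cell meets every class modulo the lattice exactly once, so its periodization
is the constant 1.\<close>

lemma nn_integral_torus_shift:
  fixes f :: "'n::finite torus \<Rightarrow> ennreal"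
  assumes [measurable]: "f \<in> borel_measurable borel"
  shows "(\<integral>\<^sup>+p. f (p + a) \<partial>torus_measure) = (\<integral>\<^sup>+p. f p \<partial>torus_measure)"
proof -
  define c where "c = torus_rep a"
  have c: "to_torus c = a" by (simp add: c_def)
  have "(\<integral>\<^sup>+p. f (p + a) \<partial>torus_measure) = (\<integral>\<^sup>+x. f (to_torus (x + c)) * indicator fundamental_cell x \<partial>lborel)"
    by (subst nn_integral_torus_measure) (auto simp: to_torus_add c)
  also have "\<dots> = (\<integral>\<^sup>+x. f (to_torus x) * indicator fundamental_cell (x - c) \<partial>lborel)"
    by (subst nn_integral_lborel_shift[of _ c, symmetric]) auto
  also have "\<dots> = (\<integral>\<^sup>+p. f p * (\<integral>\<^sup>+m. indicator fundamental_cell (torus_rep p + m - c) \<partial>count_space integer_lattice) \<partial>torus_measure)"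
    by (rule nn_integral_unfold) measurable
  also have "(\<lambda>p::'n torus. \<integral>\<^sup>+m. indicator fundamental_cell (torus_rep p + m - c) \<partial>count_space integer_lattice) = (\<lambda>_. 1)"
  proof
    fix p :: "'n torus"
    have bij: "bij_betw uminus (integer_lattice :: (real^'n) set) integer_lattice"
      by (rule bij_betwI[where g=uminus]) (auto simp: integer_lattice_uminus)
    have "(\<integral>\<^sup>+m. indicator fundamental_cell (torus_rep p + m - c) \<partial>count_space integer_lattice)
       = (\<integral>\<^sup>+m. indicator fundamental_cell (torus_rep p - c - m) \<partial>count_space integer_lattice)"
      by (subst nn_integral_bij_count_space[OF bij, symmetric]) (simp add: algebra_simps)
    then show "(\<integral>\<^sup>+m. indicator fundamental_cell (torus_rep p + m - c) \<partial>count_space integer_lattice) = 1"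
      by (simp add: nn_integral_indicator_cell)
  qed
  finally show ?thesis by simp
qed

lemma emeasure_fundamental_cell: "emeasure lborel (fundamental_cell :: (real^'n::finite) set) = 1"
proof (rule antisym)
  have One: "(One :: real ^ 'n) $ i = 1" for i :: 'n
  proof -
    have "One \<bullet> (axis i 1 :: real ^ 'n) = (\<Sum>b\<in>Basis. 1 *\<^sub>R b) \<bullet> (axis i 1 :: real ^ 'n)"
      by (simp only: scaleR_one)
    also have "\<dots> = 1"
      by (rule inner_sum_left_Basis) (simp add: axis_in_Basis_iff)
    finally show ?thesis unfolding cart_eq_inner_axis .
  qed
  have "emeasure lborel (fundamental_cell :: (real^'n) set) \<le> emeasure lborel (cbox 0 (One :: real^'n))"
    by (rule emeasure_mono) (simp_all add: subset_iff fundamental_cell_def mem_box_cart One less_imp_le del: sum_component)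
  then show "emeasure lborel (fundamental_cell :: (real^'n) set) \<le> 1"
    by (simp add: emeasure_lborel_cbox_eq)
  have "emeasure lborel (box 0 (One :: real^'n)) \<le> emeasure lborel (fundamental_cell :: (real^'n) set)"
    by (rule emeasure_mono) (simp_all add: subset_iff fundamental_cell_def mem_box_cart One less_imp_le del: sum_component)
  then show "1 \<le> emeasure lborel (fundamental_cell :: (real^'n) set)"
    by (simp add: emeasure_lborel_box_eq)
qed

lemma prob_space_torus_measure: "prob_space (torus_measure :: 'n::finite torus measure)"
proof
  have "emeasure (torus_measure :: 'n torus measure) UNIV = (\<integral>\<^sup>+p. 1 \<partial>(torus_measure :: 'n torus measure))"
    by simp
  also have "\<dots> = 1" by (subst nn_integral_torus_measure) (simp_all add: emeasure_fundamental_cell)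
  finally show "emeasure (torus_measure :: 'n torus measure) (space torus_measure) = 1" by simp
qed

section \<open>The standard Gaussian law\<close>

definition gauss :: "(real ^ 'n::finite) measure"
  where "gauss = density lborel (\<lambda>v. ennreal (std_gaussian v))"

lemma std_gaussian_nonneg: "0 \<le> std_gaussian x"
  by (simp add: std_gaussian_def)

lemma std_gaussian_measurable [measurable]: "std_gaussian \<in> borel_measurable borel"
  unfolding std_gaussian_def by measurable

lemma std_gaussian_prod:
  "std_gaussian (x :: real ^ 'n::finite) = (\<Prod>b\<in>Basis. std_normal_density (x \<bullet> b))"
proof -
  have "(\<Prod>b\<in>(Basis :: (real ^ 'n) set). std_normal_density (x \<bullet> b))
      = (1 / sqrt (2 * pi)) ^ CARD('n) * exp (\<Sum>b\<in>(Basis :: (real ^ 'n) set). - (x \<bullet> b)\<^sup>2 / 2)"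
    by (simp only: std_normal_density_def prod.distrib exp_sum finite_Basis prod_constant)
       (simp add: exp_sum[symmetric])
  also have "(\<Sum>b\<in>(Basis :: (real ^ 'n) set). - (x \<bullet> b)\<^sup>2 / 2) = - (norm x)\<^sup>2 / 2"
    by (simp add: sum_divide_distrib[symmetric] sum_negf norm_eq_sqrt_inner
        euclidean_inner[of x x] sum_nonneg power2_eq_square)
  also have "(1 / sqrt (2 * pi)) ^ CARD('n) = (2 * pi) powr (- real CARD('n) / 2)"
    by (simp add: powr_half_sqrt[symmetric] powr_realpow[symmetric] powr_powr powr_minus_divide powr_divide power_one_over)
  finally show ?thesis by (simp add: std_gaussian_def)
qed

lemma nn_integral_std_gaussian: "(\<integral>\<^sup>+x. ennreal (std_gaussian (x :: real ^ 'n::finite)) \<partial>lborel) = 1"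
proof -
  interpret prob_space "density lborel std_normal_density"
    by (rule prob_space_normal_density) simp
  have *: "(\<integral>\<^sup>+x. ennreal (std_normal_density x) \<partial>lborel) = 1"
    using emeasure_space_1 by (simp add: emeasure_density)
  have "(\<integral>\<^sup>+x. ennreal (std_gaussian (x :: real ^ 'n)) \<partial>lborel)
      = (\<integral>\<^sup>+x. (\<Prod>b\<in>(Basis :: (real ^ 'n) set). ennreal (std_normal_density (x \<bullet> b))) \<partial>lborel)"
    by (simp add: std_gaussian_prod prod_ennreal)
  also have "\<dots> = 1"
    by (subst nn_integral_lborel_prod) (simp_all add: *)
  finally show ?thesis .
qed

lemma sets_gauss [simp, measurable_cong]: "sets gauss = sets borel"
  by (simp add: gauss_def)

lemma space_gauss [simp]: "space gauss = UNIV"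
  by (simp add: gauss_def)

lemma prob_space_gauss: "prob_space gauss"
  by (rule prob_spaceI) (simp add: gauss_def emeasure_density nn_integral_std_gaussian)

lemma nn_integral_gauss:
  assumes [measurable]: "f \<in> borel_measurable borel"
  shows "(\<integral>\<^sup>+v. f v \<partial>gauss) = (\<integral>\<^sup>+v. f v * ennreal (std_gaussian v) \<partial>lborel)"
  unfolding gauss_def by (subst nn_integral_density) (auto simp: mult.commute)

lemma nn_integral_lborel_affine:
  fixes f :: "'a::euclidean_space \<Rightarrow> ennreal"
  assumes [measurable]: "f \<in> borel_measurable borel" and "c \<noteq> 0"
  shows "(\<integral>\<^sup>+x. f x \<partial>lborel) = ennreal (\<bar>c\<bar> ^ DIM('a)) * (\<integral>\<^sup>+x. f (t + c *\<^sub>R x) \<partial>lborel)"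
  by (subst lborel_affine[OF \<open>c \<noteq> 0\<close>, of t])
     (simp add: nn_integral_density nn_integral_distr nn_integral_cmult)

lemma nn_integral_gauss_uminus:
  fixes f :: "real ^ 'n::finite \<Rightarrow> ennreal"
  assumes [measurable]: "f \<in> borel_measurable borel"
  shows "(\<integral>\<^sup>+v. f (- v) \<partial>gauss) = (\<integral>\<^sup>+v. f v \<partial>gauss)"
proof -
  have "(\<integral>\<^sup>+v. f v * ennreal (std_gaussian v) \<partial>lborel) = (\<integral>\<^sup>+v. f (- v) * ennreal (std_gaussian v) \<partial>lborel)"
    by (subst nn_integral_lborel_affine[of _ "-1" 0]) (auto simp: std_gaussian_def)
  then show ?thesis by (simp add: nn_integral_gauss)
qed

text \<open>The rotation of the plane spanned by \<open>u\<close> and \<open>v\<close> that underlies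
stability of the Gaussian: after the substitution \<open>w = \<surd>2 u - v\<close> in a product
of two Gaussians, the variable \<open>u\<close> splits off.\<close>

lemma std_gaussian_rotate:
  "std_gaussian v * std_gaussian (sqrt 2 *\<^sub>R u - v) = std_gaussian u * std_gaussian (sqrt 2 *\<^sub>R v - u)"
proof -
  have "(norm v)\<^sup>2 + (norm (sqrt 2 *\<^sub>R u - v))\<^sup>2 = (norm u)\<^sup>2 + (norm (sqrt 2 *\<^sub>R v - u))\<^sup>2"
    by (simp add: power2_norm_eq_inner inner_diff algebra_simps inner_commute)
  then have "exp (- (norm v)\<^sup>2 / 2) * exp (- (norm (sqrt 2 *\<^sub>R u - v))\<^sup>2 / 2)
      = exp (- (norm u)\<^sup>2 / 2) * exp (- (norm (sqrt 2 *\<^sub>R v - u))\<^sup>2 / 2)"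
    unfolding exp_add[symmetric] by (simp add: field_simps)
  then show ?thesis by (simp add: std_gaussian_def)
qed

text \<open>Normalized sums of two independent standard Gaussian vectors are standard Gaussian. This is what
makes averaging over noise a semigroup in the variance.\<close>

lemma nn_integral_gauss_average:
  fixes f :: "real ^ 'n::finite \<Rightarrow> ennreal"
  assumes [measurable]: "f \<in> borel_measurable borel"
  shows "(\<integral>\<^sup>+v. \<integral>\<^sup>+w. f ((v + w) /\<^sub>R sqrt 2) \<partial>gauss \<partial>gauss) = (\<integral>\<^sup>+v. f v \<partial>gauss)"
proof -
  let ?g = "\<lambda>v. ennreal (std_gaussian (v :: real ^ 'n))"
  let ?c = "ennreal (sqrt 2 ^ CARD('n))"
  have "(\<integral>\<^sup>+v. \<integral>\<^sup>+w. f ((v + w) /\<^sub>R sqrt 2) \<partial>gauss \<partial>gauss)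
      = (\<integral>\<^sup>+v. (\<integral>\<^sup>+w. f ((v + w) /\<^sub>R sqrt 2) * ?g w \<partial>lborel) * ?g v \<partial>lborel)"
    by (simp add: nn_integral_gauss)
  also have "\<dots> = (\<integral>\<^sup>+v. (\<integral>\<^sup>+u. f u * (?c * (?g u * ?g (sqrt 2 *\<^sub>R v - u))) \<partial>lborel) \<partial>lborel)"
  proof (rule nn_integral_cong)
    fix v :: "real ^ 'n"
    have "(\<integral>\<^sup>+w. f ((v + w) /\<^sub>R sqrt 2) * ?g w \<partial>lborel) * ?g v
        = ?c * (\<integral>\<^sup>+u. f u * ?g (sqrt 2 *\<^sub>R u - v) \<partial>lborel) * ?g v"
      by (subst nn_integral_lborel_affine[of _ "sqrt 2" "-v"]) simp_all
    also have "\<dots> = (\<integral>\<^sup>+u. f u * (?c * (?g v * ?g (sqrt 2 *\<^sub>R u - v))) \<partial>lborel)"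
      by (simp add: nn_integral_cmult[symmetric] nn_integral_multc[symmetric] mult_ac)
    also have "\<dots> = (\<integral>\<^sup>+u. f u * (?c * (?g u * ?g (sqrt 2 *\<^sub>R v - u))) \<partial>lborel)"
      by (simp add: ennreal_mult'[symmetric] std_gaussian_nonneg std_gaussian_rotate)
    finally show "(\<integral>\<^sup>+w. f ((v + w) /\<^sub>R sqrt 2) * ?g w \<partial>lborel) * ?g v
        = (\<integral>\<^sup>+u. f u * (?c * (?g u * ?g (sqrt 2 *\<^sub>R v - u))) \<partial>lborel)" .
  qed
  also have "\<dots> = (\<integral>\<^sup>+u. (\<integral>\<^sup>+v. f u * (?c * (?g u * ?g (sqrt 2 *\<^sub>R v - u))) \<partial>lborel) \<partial>lborel)"
    by (rule lborel_pair.Fubini') measurable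
  also have "\<dots> = (\<integral>\<^sup>+u. f u * ?g u * (?c * (\<integral>\<^sup>+v. ?g (- u + sqrt 2 *\<^sub>R v) \<partial>lborel)) \<partial>lborel)"
    by (simp add: nn_integral_cmult mult_ac)
  also have "\<dots> = (\<integral>\<^sup>+u. f u * ?g u \<partial>lborel)"
  proof -
    have "?c * (\<integral>\<^sup>+v. ?g (- u + sqrt 2 *\<^sub>R v) \<partial>lborel) = 1" for u
      using nn_integral_lborel_affine[of ?g "sqrt 2" "- u"] by (simp add: nn_integral_std_gaussian)
    then show ?thesis by (simp only: mult_1_right)
  qed
  finally show ?thesis by (simp add: nn_integral_gauss)
qed

text \<open>Rescaling reduces the integral to the total mass of the standard Gaussian.\<close>

lemma nn_integral_exp_norm_finite:
  assumes "0 < a"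
  shows "(\<integral>\<^sup>+v. ennreal (exp (- a * (norm (v :: real ^ 'n::finite))\<^sup>2)) \<partial>lborel) < \<infinity>"
proof -
  define s where "s = 1 / sqrt (2 * a)"
  have s: "s > 0" "s\<^sup>2 = 1 / (2 * a)" using assms by (auto simp: s_def power_divide)
  have "ennreal (exp (- a * (norm (s *\<^sub>R v :: real ^ 'n))\<^sup>2)) = ennreal ((2 * pi) powr (real CARD('n) / 2)) * ennreal (std_gaussian v)" for v :: "real ^ 'n"
  proof -
    have "(2 * pi) powr (real CARD('n) / 2) * (2 * pi) powr (- real CARD('n) / 2) = 1"
      by (simp add: powr_add[symmetric])
    then show ?thesis
      using assms s by (simp add: std_gaussian_def ennreal_mult'[symmetric] power_mult_distrib mult.assoc[symmetric])
  qed
  then have "(\<integral>\<^sup>+v. ennreal (exp (- a * (norm (v :: real ^ 'n))\<^sup>2)) \<partial>lborel)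
      = ennreal (s ^ CARD('n)) * (\<integral>\<^sup>+v. ennreal ((2 * pi) powr (real CARD('n) / 2)) * ennreal (std_gaussian (v :: real ^ 'n)) \<partial>lborel)"
    using s by (subst nn_integral_lborel_affine[of _ s 0]) auto
  also have "\<dots> < \<infinity>" by (simp add: nn_integral_cmult nn_integral_std_gaussian ennreal_mult_less_top)
  finally show ?thesis .
qed

text \<open>The estimate \<open>t \<le> exp t\<close> with \<open>t = \<parallel>v\<parallel>\<^sup>2 /
4\<close> absorbs the square into half of the Gaussian exponent.\<close>

lemma integrable_gauss_square: "integrable gauss (\<lambda>v :: real ^ 'n::finite. (v $ i)\<^sup>2)"
proof (rule integrableI_bounded)
  show "(\<lambda>v :: real ^ 'n. (v $ i)\<^sup>2) \<in> borel_measurable gauss" by measurable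
  have "(\<integral>\<^sup>+v. ennreal (norm ((v $ i)\<^sup>2)) \<partial>gauss) = (\<integral>\<^sup>+v. ennreal ((v $ i)\<^sup>2) * ennreal (std_gaussian (v :: real ^ 'n)) \<partial>lborel)"
    by (simp add: nn_integral_gauss)
  also have "\<dots> \<le> (\<integral>\<^sup>+v. ennreal (4 * (2 * pi) powr (- real CARD('n) / 2)) * ennreal (exp (- (1/4) * (norm (v :: real ^ 'n))\<^sup>2)) \<partial>lborel)"
  proof (rule nn_integral_mono)
    fix v :: "real ^ 'n"
    let ?t = "(norm v)\<^sup>2 / 4"
    have "(v $ i)\<^sup>2 \<le> (norm v)\<^sup>2"
      using component_le_norm_cart[of v i] by (metis abs_norm_cancel power2_le_iff_abs_le norm_ge_zero power2_abs)
    also have "\<dots> \<le> 4 * exp ?t" using exp_ge_add_one_self[of ?t] by linarith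
    finally have "(v $ i)\<^sup>2 * exp (- (norm v)\<^sup>2 / 2) \<le> 4 * exp ?t * exp (- (norm v)\<^sup>2 / 2)"
      by (rule mult_right_mono) simp
    also have "\<dots> = 4 * exp (- (1/4) * (norm v)\<^sup>2)" by (simp add: exp_add[symmetric])
    finally have "(2 * pi) powr (- real CARD('n) / 2) * ((v $ i)\<^sup>2 * exp (- (norm v)\<^sup>2 / 2)) \<le> (2 * pi) powr (- real CARD('n) / 2) * (4 * exp (- (1/4) * (norm v)\<^sup>2))"
      by (rule mult_left_mono) simp
    then show "ennreal ((v $ i)\<^sup>2) * ennreal (std_gaussian v) \<le> ennreal (4 * (2 * pi) powr (- real CARD('n) / 2)) * ennreal (exp (- (1/4) * (norm v)\<^sup>2))"
      by (simp add: ennreal_mult'[symmetric] std_gaussian_def mult_ac)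
  qed
  also have "\<dots> < \<infinity>"
    using nn_integral_exp_norm_finite[of "1/4", where 'n='n] by (subst nn_integral_cmult) (auto simp: ennreal_mult_less_top)
  finally show "(\<integral>\<^sup>+v. ennreal (norm (((v :: real ^ 'n) $ i)\<^sup>2)) \<partial>gauss) < \<infinity>" .
qed

section \<open>The noise as a wrapped Gaussian vector\<close>

text \<open>A Harnack-type comparison bounds each term of the lattice sum by a multiple of the cell average
of a wider Gaussian; the sum of these averages is an integral over the whole space. The bound is
uniform in \<open>\<epsilon> \<le> 1\<close> since shrinking \<open>\<epsilon>\<close> only
decreases the terms.\<close>

lemma nn_integral_gaussian_lattice_bound:
  obtains C :: real where "C > 0"
    "\<And>\<epsilon> x. 0 < \<epsilon> \<Longrightarrow> \<epsilon> \<le> 1 \<Longrightarrow> x \<in> fundamental_cell \<Longrightarrow>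
      (\<integral>\<^sup>+m. ennreal (std_gaussian ((1/\<epsilon>) *\<^sub>R (x + m :: real ^ 'n::finite))) \<partial>count_space integer_lattice) \<le> ennreal C"
proof -
  let ?d = "real CARD('n)"
  let ?k = "exp (?d / 2)"
  define I where "I = (\<integral>\<^sup>+v. ennreal (exp (- (1/4) * (norm (v :: real ^ 'n))\<^sup>2)) \<partial>lborel)"
  have I: "I < \<infinity>" unfolding I_def by (rule nn_integral_exp_norm_finite) simp
  define C where "C = (2 * pi) powr (- ?d / 2) * (?k * enn2real I) + 1"
  have bound: "(\<integral>\<^sup>+m. ennreal (std_gaussian ((1/\<epsilon>) *\<^sub>R (x + m :: real ^ 'n))) \<partial>count_space integer_lattice) \<le> ennreal C"
    if e: "0 < \<epsilon>" "\<epsilon> \<le> 1" and x: "x \<in> fundamental_cell" for \<epsilon> x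
  proof -
    \<comment> \<open>Since \<open>\<parallel>y - x\<parallel>\<^sup>2 \<le> d\<close> in the cell, \<open>\<parallel>y + m\<parallel>\<^sup>2 \<le> 2 \<parallel>x + m\<parallel>\<^sup>2 + 2 d\<close>; this is the origin of the factor \<open>exp (d / 2)\<close>.\<close>
    have pt: "exp (- (norm ((1/\<epsilon>) *\<^sub>R (x + m)))\<^sup>2 / 2) \<le> ?k * exp (- (1/4) * (norm (y + m))\<^sup>2)"
      if y: "y \<in> fundamental_cell" for y m :: "real ^ 'n"
    proof -
      have "(norm (x + m))\<^sup>2 \<le> (norm ((1/\<epsilon>) *\<^sub>R (x + m)))\<^sup>2"
      proof (rule power_mono)
        have "1 * norm (x + m) \<le> 1/\<epsilon> * norm (x + m)"
          using e by (intro mult_right_mono) auto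
        then show "norm (x + m) \<le> norm ((1/\<epsilon>) *\<^sub>R (x + m))" using e by simp
      qed simp
      moreover have "(norm (y - x))\<^sup>2 \<le> ?d"
      proof -
        have "(norm (y - x))\<^sup>2 = (\<Sum>i\<in>UNIV. ((y - x) $ i)\<^sup>2)"
          by (simp add: norm_vec_def L2_set_def sum_nonneg)
        also have "\<dots> \<le> (\<Sum>i\<in>(UNIV :: 'n set). 1)"
        proof (rule sum_mono)
          fix i :: 'n
          have "\<bar>(y - x) $ i\<bar> \<le> 1"
            using x y by (auto simp: fundamental_cell_def abs_le_iff dest!: spec[of _ i])
          then show "((y - x) $ i)\<^sup>2 \<le> 1" by (simp add: abs_square_le_1)
        qed
        finally show ?thesis by simp
      qed
      moreover have "(norm (y + m))\<^sup>2 \<le> 2 * (norm (x + m))\<^sup>2 + 2 * (norm (y - x))\<^sup>2"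
      proof -
        have "norm (y + m) \<le> norm (x + m) + norm (y - x)"
          using norm_triangle_ineq[of "x + m" "y - x"] by (simp add: algebra_simps)
        then have "(norm (y + m))\<^sup>2 \<le> (norm (x + m) + norm (y - x))\<^sup>2" by (rule power_mono) simp
        also have "\<dots> \<le> 2 * (norm (x + m))\<^sup>2 + 2 * (norm (y - x))\<^sup>2"
          using sum_squares_ge_zero[of "norm (x + m) - norm (y - x)" 0] by (simp add: power2_eq_square algebra_simps)
        finally show ?thesis .
      qed
      ultimately have "- (norm ((1/\<epsilon>) *\<^sub>R (x + m)))\<^sup>2 / 2 \<le> ?d / 2 + - (1/4) * (norm (y + m))\<^sup>2"
        by linarith
      then show ?thesis by (simp add: exp_add[symmetric])
    qed
    have "(\<integral>\<^sup>+m. ennreal (exp (- (norm ((1/\<epsilon>) *\<^sub>R (x + m)))\<^sup>2 / 2)) \<partial>count_space (integer_lattice :: (real ^ 'n) set))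
        = (\<integral>\<^sup>+y. (\<integral>\<^sup>+m. ennreal (exp (- (norm ((1/\<epsilon>) *\<^sub>R (x + m)))\<^sup>2 / 2)) \<partial>count_space (integer_lattice :: (real ^ 'n) set)) * indicator fundamental_cell (y :: real ^ 'n) \<partial>lborel)"
      by (simp add: nn_integral_cmult emeasure_fundamental_cell)
    also have "\<dots> \<le> (\<integral>\<^sup>+y. (\<integral>\<^sup>+m. ennreal (?k * exp (- (1/4) * (norm (y + m))\<^sup>2)) \<partial>count_space (integer_lattice :: (real ^ 'n) set)) * indicator fundamental_cell y \<partial>lborel)"
    proof (rule nn_integral_mono)
      fix y :: "real ^ 'n"
      show "(\<integral>\<^sup>+m. ennreal (exp (- (norm ((1/\<epsilon>) *\<^sub>R (x + m)))\<^sup>2 / 2)) \<partial>count_space (integer_lattice :: (real ^ 'n) set)) * indicator fundamental_cell y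
        \<le> (\<integral>\<^sup>+m. ennreal (?k * exp (- (1/4) * (norm (y + m))\<^sup>2)) \<partial>count_space (integer_lattice :: (real ^ 'n) set)) * indicator fundamental_cell y"
      proof (cases "y \<in> fundamental_cell")
        case True
        show ?thesis
          by (intro mult_right_mono nn_integral_mono ennreal_leI pt[OF True]) simp
      qed simp
    qed
    also have "\<dots> = (\<integral>\<^sup>+v. ennreal (?k * exp (- (1/4) * (norm (v :: real ^ 'n))\<^sup>2)) \<partial>lborel)"
      by (rule nn_integral_lborel_cells[symmetric]) measurable
    also have "\<dots> = ennreal ?k * I"
      unfolding I_def by (simp add: ennreal_mult' nn_integral_cmult)
    also have "\<dots> = ennreal (?k * enn2real I)"
      using I by (simp add: ennreal_mult' less_top[symmetric])
    finally have *: "(\<integral>\<^sup>+m. ennreal (exp (- (norm ((1/\<epsilon>) *\<^sub>R (x + m)))\<^sup>2 / 2)) \<partial>count_space (integer_lattice :: (real ^ 'n) set)) \<le> ennreal (?k * enn2real I)" .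
    have "(\<integral>\<^sup>+m. ennreal (std_gaussian ((1/\<epsilon>) *\<^sub>R (x + m :: real ^ 'n))) \<partial>count_space integer_lattice)
        = ennreal ((2 * pi) powr (- ?d / 2)) * (\<integral>\<^sup>+m. ennreal (exp (- (norm ((1/\<epsilon>) *\<^sub>R (x + m)))\<^sup>2 / 2)) \<partial>count_space (integer_lattice :: (real ^ 'n) set))"
      unfolding std_gaussian_def by (subst nn_integral_cmult[symmetric]) (auto simp: ennreal_mult'[symmetric])
    also have "\<dots> \<le> ennreal ((2 * pi) powr (- ?d / 2)) * ennreal (?k * enn2real I)"
      by (intro mult_left_mono *) simp
    also have "\<dots> \<le> ennreal C" by (simp add: C_def ennreal_mult'[symmetric] ennreal_leI)
    finally show ?thesis .
  qed
  have "C > 0" by (simp add: C_def add_nonneg_pos)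
  from that[OF this bound] show thesis .
qed

text \<open>Translates the unconditional sum of the definition, which would default to 0 on divergence, into
an integral over the lattice.\<close>

lemma ennreal_periodized_gaussian:
  assumes "0 < \<epsilon>" "\<epsilon> \<le> 1"
  shows "ennreal (periodized_gaussian \<epsilon> (p :: 'n::finite torus))
    = (\<integral>\<^sup>+m. ennreal (1 / \<epsilon> ^ CARD('n)) * ennreal (std_gaussian ((1/\<epsilon>) *\<^sub>R (torus_rep p + m))) \<partial>count_space integer_lattice)"
proof -
  let ?f = "\<lambda>m. (1 / \<epsilon> ^ CARD('n)) * std_gaussian ((1/\<epsilon>) *\<^sub>R (torus_rep p + m))"
  obtain C where C: "(\<integral>\<^sup>+m. ennreal (std_gaussian ((1/\<epsilon>) *\<^sub>R (torus_rep p + m))) \<partial>count_space integer_lattice) \<le> ennreal C"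
    using nn_integral_gaussian_lattice_bound assms torus_rep_in_cell by metis
  have eq: "(\<integral>\<^sup>+m. ennreal (?f m) \<partial>count_space integer_lattice)
      = (\<integral>\<^sup>+m. ennreal (1 / \<epsilon> ^ CARD('n)) * ennreal (std_gaussian ((1/\<epsilon>) *\<^sub>R (torus_rep p + m))) \<partial>count_space integer_lattice)"
    using assms by (intro nn_integral_cong) (simp add: ennreal_mult'[symmetric])
  also have "\<dots> = ennreal (1 / \<epsilon> ^ CARD('n)) * (\<integral>\<^sup>+m. ennreal (std_gaussian ((1/\<epsilon>) *\<^sub>R (torus_rep p + m))) \<partial>count_space integer_lattice)"
    by (rule nn_integral_cmult) simp
  also have "\<dots> < \<infinity>" using le_less_trans[OF C ennreal_less_top] by (simp add: ennreal_mult_less_top)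
  finally have "integrable (count_space integer_lattice) ?f"
    by (intro integrableI_nonneg) (use assms in \<open>auto simp: std_gaussian_nonneg\<close>)
  then have abs: "Infinite_Set_Sum.abs_summable_on ?f integer_lattice"
    by (simp add: Infinite_Set_Sum.abs_summable_on_def)
  have "(\<integral>\<^sup>+m. ennreal (?f m) \<partial>count_space integer_lattice) = ennreal (infsetsum ?f integer_lattice)"
    by (rule nn_integral_conv_infsetsum[OF abs]) (use assms in \<open>auto simp: std_gaussian_nonneg\<close>)
  also have "infsetsum ?f integer_lattice = infsum ?f integer_lattice"
    using abs by (rule infsetsum_infsum)
  also have "\<dots> = periodized_gaussian \<epsilon> p"
    by (simp add: periodized_gaussian_def integer_lattice_def)
  finally show ?thesis using eq by simp
qed


lemma ennreal_periodized_gaussian_measurable: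
  assumes "0 < \<epsilon>" "\<epsilon> \<le> 1"
  shows "(\<lambda>p :: 'n::finite torus. ennreal (periodized_gaussian \<epsilon> p)) \<in> borel_measurable borel"
proof -
  have "(\<lambda>x. \<integral>\<^sup>+m. ennreal (1 / \<epsilon> ^ CARD('n)) * ennreal (std_gaussian ((1/\<epsilon>) *\<^sub>R (x + m))) \<partial>count_space integer_lattice)
    \<in> borel_measurable (borel :: (real ^ 'n) measure)"
    by (rule lattice_sum_measurable) measurable
  then show ?thesis
    unfolding ennreal_periodized_gaussian[OF assms] by (rule measurable_compose[OF torus_rep_measurable])
qed

lemma gaussian_noise_eq_distr:
  assumes "0 < \<epsilon>" "\<epsilon> \<le> 1"
  shows "gaussian_noise \<epsilon> = distr gauss borel (\<lambda>v :: real ^ 'n::finite. to_torus (\<epsilon> *\<^sub>R v))"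
proof (rule measure_eqI)
  show "sets (gaussian_noise \<epsilon>) = sets (distr gauss borel (\<lambda>v :: real ^ 'n. to_torus (\<epsilon> *\<^sub>R v)))"
    by (simp add: gaussian_noise_def)
  note [measurable] = ennreal_periodized_gaussian_measurable[OF assms]
  fix A :: "'n torus set" assume "A \<in> sets (gaussian_noise \<epsilon>)"
  then have [measurable]: "A \<in> sets borel" by (simp add: gaussian_noise_def)
  let ?k = "\<lambda>x :: real ^ 'n. ennreal (1 / \<epsilon> ^ CARD('n)) * ennreal (std_gaussian ((1/\<epsilon>) *\<^sub>R x))"
  have "emeasure (gaussian_noise \<epsilon>) A
      = (\<integral>\<^sup>+p. indicator A p * ennreal (periodized_gaussian \<epsilon> p) \<partial>torus_measure)"
    unfolding gaussian_noise_def by (subst emeasure_density) (auto simp: mult.commute)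
  also have "\<dots> = (\<integral>\<^sup>+x. indicator A (to_torus x) * ?k x \<partial>lborel)"
    unfolding ennreal_periodized_gaussian[OF assms] by (rule nn_integral_unfold[symmetric]) measurable
  also have "\<dots> = ennreal (\<epsilon> ^ CARD('n)) * (\<integral>\<^sup>+v. indicator A (to_torus (\<epsilon> *\<^sub>R v)) * ?k (\<epsilon> *\<^sub>R v) \<partial>lborel)"
    using assms by (subst nn_integral_lborel_affine[of _ \<epsilon> 0]) auto
  also have "\<dots> = (\<integral>\<^sup>+v. indicator A (to_torus (\<epsilon> *\<^sub>R v)) * ennreal (std_gaussian v) \<partial>lborel)"
  proof (subst nn_integral_cmult[symmetric])
    have "ennreal (\<epsilon> ^ CARD('n)) * ennreal (1 / \<epsilon> ^ CARD('n)) = 1"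
      using assms by (simp add: ennreal_mult'[symmetric])
    then have "ennreal (\<epsilon> ^ CARD('n)) * (a * (ennreal (1 / \<epsilon> ^ CARD('n)) * b)) = a * b" for a b
      by (metis mult.assoc mult.left_commute mult_1)
    then have "ennreal (\<epsilon> ^ CARD('n)) * (indicator A (to_torus (\<epsilon> *\<^sub>R v)) * ?k (\<epsilon> *\<^sub>R v))
      = indicator A (to_torus (\<epsilon> *\<^sub>R v)) * ennreal (std_gaussian v)" for v :: "real ^ 'n"
      using assms by simp
    then show "(\<integral>\<^sup>+v. ennreal (\<epsilon> ^ CARD('n)) * (indicator A (to_torus (\<epsilon> *\<^sub>R v)) * ?k (\<epsilon> *\<^sub>R v)) \<partial>lborel)
      = (\<integral>\<^sup>+v. indicator A (to_torus (\<epsilon> *\<^sub>R v)) * ennreal (std_gaussian v) \<partial>lborel)"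
      by simp
  qed measurable
  also have "\<dots> = (\<integral>\<^sup>+v. indicator A (to_torus (\<epsilon> *\<^sub>R v)) \<partial>gauss)"
    by (rule nn_integral_gauss[symmetric]) measurable
  also have "\<dots> = (\<integral>\<^sup>+p. indicator A p \<partial>distr gauss borel (\<lambda>v :: real ^ 'n. to_torus (\<epsilon> *\<^sub>R v)))"
    by (subst nn_integral_distr) auto
  also have "\<dots> = emeasure (distr gauss borel (\<lambda>v :: real ^ 'n. to_torus (\<epsilon> *\<^sub>R v))) A"
    by simp
  finally show "emeasure (gaussian_noise \<epsilon>) A
    = emeasure (distr gauss borel (\<lambda>v :: real ^ 'n. to_torus (\<epsilon> *\<^sub>R v))) A" .
qed

text \<open>The density of the noise is at most \<open>C / \<epsilon>\<^sup>d\<close>.\<close>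

lemma nn_integral_gauss_torus_le:
  obtains C :: real where "C > 0"
    "\<And>\<epsilon> (f :: 'n::finite torus \<Rightarrow> ennreal) x. 0 < \<epsilon> \<Longrightarrow> \<epsilon> \<le> 1 \<Longrightarrow> f \<in> borel_measurable borel \<Longrightarrow>
      (\<integral>\<^sup>+v. f (x + to_torus (\<epsilon> *\<^sub>R v)) \<partial>gauss) \<le> ennreal (C / \<epsilon> ^ CARD('n)) * (\<integral>\<^sup>+p. f p \<partial>torus_measure)"
proof -
  obtain C where C: "C > 0" "\<And>\<epsilon> x. 0 < \<epsilon> \<Longrightarrow> \<epsilon> \<le> 1 \<Longrightarrow> x \<in> fundamental_cell \<Longrightarrow>
      (\<integral>\<^sup>+m. ennreal (std_gaussian ((1/\<epsilon>) *\<^sub>R (x + m :: real ^ 'n))) \<partial>count_space integer_lattice) \<le> ennreal C"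
    using nn_integral_gaussian_lattice_bound[where 'n='n] by metis
  show thesis
  proof (rule that[OF C(1)])
    fix \<epsilon> :: real and f :: "'n torus \<Rightarrow> ennreal" and x
    assume e: "0 < \<epsilon>" "\<epsilon> \<le> 1" and f [measurable]: "f \<in> borel_measurable borel"
    note [measurable] = ennreal_periodized_gaussian_measurable[OF e]
    have K: "ennreal (periodized_gaussian \<epsilon> (p :: 'n torus)) \<le> ennreal (C / \<epsilon> ^ CARD('n))" for p
    proof -
      have "ennreal (periodized_gaussian \<epsilon> p) = ennreal (1 / \<epsilon> ^ CARD('n)) *
        (\<integral>\<^sup>+m. ennreal (std_gaussian ((1/\<epsilon>) *\<^sub>R (torus_rep p + m))) \<partial>count_space integer_lattice)"
        unfolding ennreal_periodized_gaussian[OF e] by (rule nn_integral_cmult) simp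
      also have "\<dots> \<le> ennreal (1 / \<epsilon> ^ CARD('n)) * ennreal C"
        by (intro mult_left_mono C e torus_rep_in_cell) simp
      also have "\<dots> = ennreal (C / \<epsilon> ^ CARD('n))" using e C(1) by (simp add: ennreal_mult'[symmetric])
      finally show ?thesis .
    qed
    have "(\<integral>\<^sup>+v. f (x + to_torus (\<epsilon> *\<^sub>R v)) \<partial>gauss)
        = (\<integral>\<^sup>+p. f (x + p) \<partial>distr gauss borel (\<lambda>v. to_torus (\<epsilon> *\<^sub>R v)))"
      by (subst nn_integral_distr) auto
    also have "\<dots> = (\<integral>\<^sup>+p. f (x + p) \<partial>gaussian_noise \<epsilon>)"
      by (simp only: gaussian_noise_eq_distr[OF e])
    also have "\<dots> = (\<integral>\<^sup>+p. ennreal (periodized_gaussian \<epsilon> p) * f (x + p) \<partial>torus_measure)"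
      unfolding gaussian_noise_def by (rule nn_integral_density) measurable
    also have "\<dots> \<le> (\<integral>\<^sup>+p. ennreal (C / \<epsilon> ^ CARD('n)) * f (x + p) \<partial>torus_measure)"
      by (intro nn_integral_mono mult_right_mono K) simp
    also have "\<dots> = ennreal (C / \<epsilon> ^ CARD('n)) * (\<integral>\<^sup>+p. f (p + x) \<partial>torus_measure)"
      by (simp add: nn_integral_cmult add.commute)
    finally show "(\<integral>\<^sup>+v. f (x + to_torus (\<epsilon> *\<^sub>R v)) \<partial>gauss)
        \<le> ennreal (C / \<epsilon> ^ CARD('n)) * (\<integral>\<^sup>+p. f p \<partial>torus_measure)"
      by (simp add: nn_integral_torus_shift)
  qed
qed

section \<open>Invariance of the two laws\<close>

interpretation torus_measure: prob_space "torus_measure :: 'n::finite torus measure"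
  by (rule prob_space_torus_measure)

interpretation gauss: prob_space "gauss :: (real ^ 'n::finite) measure"
  by (rule prob_space_gauss)

interpretation torus_gauss: pair_prob_space "torus_measure :: 'n::finite torus measure" "gauss :: (real ^ 'n) measure"
  by standard

interpretation gauss_gauss: pair_prob_space "gauss :: (real ^ 'n::finite) measure" "gauss :: (real ^ 'n) measure"
  by standard

lemma torus_diff_measurable [measurable (raw)]:
  fixes f g :: "'a \<Rightarrow> 'n::finite torus"
  assumes [measurable]: "f \<in> borel_measurable M" "g \<in> borel_measurable M"
  shows "(\<lambda>x. f x - g x) \<in> borel_measurable M"
proof -
  have "(\<lambda>x. to_torus (torus_rep (f x) - torus_rep (g x))) \<in> borel_measurable M"
    by measurable
  then show ?thesis by (simp add: to_torus_diff)
qed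

lemma distr_torus_shift: "distr torus_measure borel (\<lambda>p. p + a) = (torus_measure :: 'n::finite torus measure)"
proof (rule measure_eqI)
  fix A :: "'n torus set" assume "A \<in> sets (distr torus_measure borel (\<lambda>p. p + a))"
  then have [measurable]: "A \<in> sets borel" by simp
  have "emeasure (distr torus_measure borel (\<lambda>p. p + a)) A = (\<integral>\<^sup>+p. indicator A p \<partial>distr torus_measure borel (\<lambda>p. p + a))"
    by simp
  also have "\<dots> = (\<integral>\<^sup>+p. indicator A (p + a) \<partial>torus_measure)"
    by (subst nn_integral_distr) auto
  also have "\<dots> = emeasure torus_measure A" by (subst nn_integral_torus_shift) auto
  finally show "emeasure (distr torus_measure borel (\<lambda>p. p + a)) A = emeasure torus_measure A" .
qed simp

lemma integral_torus_shift:
  fixes f :: "'n::finite torus \<Rightarrow> real"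
  assumes [measurable]: "f \<in> borel_measurable borel"
  shows "(\<integral>p. f (p + a) \<partial>torus_measure) = (\<integral>p. f p \<partial>torus_measure)"
  by (subst distr_torus_shift[of a, symmetric]) (simp add: integral_distr)

lemma distr_gauss_uminus: "distr gauss borel uminus = (gauss :: (real ^ 'n::finite) measure)"
proof (rule measure_eqI)
  fix A :: "(real ^ 'n) set" assume "A \<in> sets (distr gauss borel uminus)"
  then have [measurable]: "A \<in> sets borel" by simp
  have "emeasure (distr gauss borel uminus) A = (\<integral>\<^sup>+p. indicator A p \<partial>distr gauss borel uminus)"
    by simp
  also have "\<dots> = (\<integral>\<^sup>+p. indicator A (- p) \<partial>gauss)"
    by (subst nn_integral_distr) auto
  also have "\<dots> = emeasure gauss A" by (subst nn_integral_gauss_uminus) auto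
  finally show "emeasure (distr gauss borel uminus) A = emeasure gauss A" .
qed simp

lemma distr_gauss_average:
  "distr (gauss \<Otimes>\<^sub>M gauss) borel (\<lambda>(v, w). (v + w) /\<^sub>R sqrt 2) = (gauss :: (real ^ 'n::finite) measure)"
proof (rule measure_eqI)
  let ?h = "\<lambda>(v, w). (v + w :: real ^ 'n) /\<^sub>R sqrt 2"
  have [measurable]: "?h \<in> borel_measurable (gauss \<Otimes>\<^sub>M gauss)" by measurable
  fix A :: "(real ^ 'n) set" assume "A \<in> sets (distr (gauss \<Otimes>\<^sub>M gauss) borel ?h)"
  then have [measurable]: "A \<in> sets borel" by simp
  have "emeasure (distr (gauss \<Otimes>\<^sub>M gauss) borel ?h) A = (\<integral>\<^sup>+p. indicator A p \<partial>distr (gauss \<Otimes>\<^sub>M gauss) borel ?h)"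
    by simp
  also have "\<dots> = (\<integral>\<^sup>+p. indicator A (?h p) \<partial>(gauss \<Otimes>\<^sub>M gauss))"
    by (subst nn_integral_distr) auto
  also have "\<dots> = (\<integral>\<^sup>+v. \<integral>\<^sup>+w. indicator A ((v + w) /\<^sub>R sqrt 2) \<partial>gauss \<partial>gauss)"
    by (subst gauss.nn_integral_fst[symmetric]) auto
  also have "\<dots> = emeasure gauss A" by (subst nn_integral_gauss_average) auto
  finally show "emeasure (distr (gauss \<Otimes>\<^sub>M gauss) borel ?h) A = emeasure gauss A" .
qed simp

section \<open>Bounded Borel functions\<close>

text \<open>All functions on which the Markov operator has to act are bounded and Borel. Working with them
instead of classes in \<open>L\<^sup>2\<close> keeps the operator defined at every point, as
needed for arbitrary initial laws.\<close>

definition bounded_borel :: "('a::topological_space \<Rightarrow> real) set"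
  where "bounded_borel = {f \<in> borel_measurable borel. bounded (range f)}"

lemma bounded_borelI:
  assumes "f \<in> borel_measurable borel" "\<And>x. \<bar>f x\<bar> \<le> B"
  shows "f \<in> bounded_borel"
  using assms by (auto simp: bounded_borel_def bounded_iff)

lemma bounded_borelD:
  assumes "f \<in> bounded_borel"
  shows "f \<in> borel_measurable borel"
  using assms by (auto simp: bounded_borel_def)

lemma bounded_borelE:
  assumes "f \<in> bounded_borel"
  obtains B where "0 \<le> B" "\<And>x. \<bar>f x\<bar> \<le> B"
  using assms by (auto simp: bounded_borel_def bounded_iff) (metis abs_ge_zero order.trans)

lemma bounded_borel_add:
  assumes "f \<in> bounded_borel" "g \<in> bounded_borel" shows "(\<lambda>x. f x + g x) \<in> bounded_borel"
  using assms by (auto simp: bounded_borel_def intro: bounded_plus_comp)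

lemma bounded_borel_diff:
  assumes "f \<in> bounded_borel" "g \<in> bounded_borel" shows "(\<lambda>x. f x - g x) \<in> bounded_borel"
  using assms by (auto simp: bounded_borel_def intro: bounded_minus_comp)

lemma bounded_borel_mult:
  assumes "f \<in> bounded_borel" "g \<in> bounded_borel" shows "(\<lambda>x. f x * g x) \<in> bounded_borel"
proof -
  obtain A B where "\<And>x. \<bar>f x\<bar> \<le> A" "0 \<le> A" "\<And>x. \<bar>g x\<bar> \<le> B"
    using assms by (auto elim!: bounded_borelE)
  then have "\<bar>f x * g x\<bar> \<le> A * B" for x by (auto simp: abs_mult intro: mult_mono)
  moreover have [measurable]: "f \<in> borel_measurable borel" "g \<in> borel_measurable borel"
    using assms by (auto dest: bounded_borelD)
  ultimately show ?thesis by (intro bounded_borelI) auto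
qed

lemma bounded_borel_power2:
  assumes "f \<in> bounded_borel" shows "(\<lambda>x. (f x)\<^sup>2) \<in> bounded_borel"
  unfolding power2_eq_square using assms by (intro bounded_borel_mult)

lemma bounded_borel_compose:
  assumes "f \<in> bounded_borel" "T \<in> measurable borel borel" shows "(\<lambda>x. f (T x)) \<in> bounded_borel"
proof -
  have [measurable]: "f \<in> borel_measurable borel" "T \<in> measurable borel borel"
    using assms by (auto dest: bounded_borelD)
  obtain B where "\<And>x. \<bar>f x\<bar> \<le> B" using assms(1) by (auto elim!: bounded_borelE)
  then show ?thesis by (intro bounded_borelI[of _ B]) auto
qed

lemma (in finite_measure) integrable_bounded_borel:
  assumes "f \<in> bounded_borel" "T \<in> measurable M borel"
  shows "integrable M (\<lambda>x. f (T x))"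
proof -
  obtain B where B: "\<And>x. \<bar>f x\<bar> \<le> B" using assms(1) by (auto elim!: bounded_borelE)
  have [measurable]: "f \<in> borel_measurable borel" "T \<in> measurable M borel"
    using assms by (auto dest: bounded_borelD)
  show ?thesis using B by (intro integrable_const_bound[of _ B]) auto
qed

lemma integrable_torus_bounded_borel:
  "f \<in> bounded_borel \<Longrightarrow> integrable torus_measure (f :: 'n::finite torus \<Rightarrow> real)"
  by (rule torus_measure.integrable_bounded_borel[of f "\<lambda>x. x", simplified]) auto

section \<open>Gaussian averaging as an operator on functions\<close>

definition gauss_avg :: "real \<Rightarrow> ('n::finite torus \<Rightarrow> real) \<Rightarrow> 'n torus \<Rightarrow> real"
  where "gauss_avg \<epsilon> f x = (\<integral>v. f (x + to_torus (\<epsilon> *\<^sub>R v)) \<partial>gauss)"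

definition energy :: "('n::finite torus \<Rightarrow> real) \<Rightarrow> real"
  where "energy f = (\<integral>x. (f x)\<^sup>2 \<partial>torus_measure)"

lemma energy_nonneg: "0 \<le> energy f"
  by (simp add: energy_def)

lemma gauss_avg_bounded_borel:
  fixes f :: "'n::finite torus \<Rightarrow> real"
  assumes f: "f \<in> bounded_borel"
  shows "gauss_avg \<epsilon> f \<in> bounded_borel"
proof -
  have [measurable]: "f \<in> borel_measurable borel" using f by (rule bounded_borelD)
  obtain B where B: "\<And>x. \<bar>f x\<bar> \<le> B" using f by (auto elim!: bounded_borelE)
  show ?thesis
  proof (rule bounded_borelI)
    have "(\<lambda>x. \<integral>v. f (x + to_torus (\<epsilon> *\<^sub>R v)) \<partial>gauss) \<in> borel_measurable borel"
      by (rule gauss.borel_measurable_lebesgue_integral) measurable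
    then show "gauss_avg \<epsilon> f \<in> borel_measurable borel" by (simp add: gauss_avg_def[abs_def])
    fix x
    have int: "integrable gauss (\<lambda>v. f (x + to_torus (\<epsilon> *\<^sub>R v)))"
      by (intro gauss.integrable_bounded_borel[OF f]) measurable
    show "\<bar>gauss_avg \<epsilon> f x\<bar> \<le> B"
    proof -
      have "\<bar>gauss_avg \<epsilon> f x\<bar> \<le> (\<integral>v. \<bar>f (x + to_torus (\<epsilon> *\<^sub>R v))\<bar> \<partial>gauss)"
        unfolding gauss_avg_def by (rule integral_abs_bound)
      also have "\<dots> \<le> B" using int B by (intro gauss.integral_le_const) auto
      finally show ?thesis .
    qed
  qed
qed

text \<open>Averaging with a weight: \<open>w = 1\<close> is the averaging operator itself, and \<open>w v =
v $ i\<close> is, up to the factor \<open>\<epsilon>\<close>, its \<open>i\<close>-th partial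
derivative, because the derivative of the Gaussian is a multiple of the Gaussian.\<close>

definition gauss_moment :: "((real ^ 'n) \<Rightarrow> real) \<Rightarrow> real \<Rightarrow> ('n::finite torus \<Rightarrow> real) \<Rightarrow> 'n torus \<Rightarrow> real"
  where "gauss_moment w \<epsilon> f x = (\<integral>v. w v * f (x + to_torus (\<epsilon> *\<^sub>R v)) \<partial>gauss)"

lemma integrable_gauss_of_square:
  assumes "w \<in> borel_measurable borel" and "integrable gauss (\<lambda>v. (w v)\<^sup>2)"
  shows "integrable gauss (w :: real ^ 'n::finite \<Rightarrow> real)"
  by (rule gauss.square_integrable_imp_integrable) (use assms in simp_all)

lemma integrable_gauss_moment:
  fixes f :: "'n::finite torus \<Rightarrow> real"
  assumes w: "integrable gauss w" and f: "f \<in> bounded_borel"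
  shows "integrable gauss (\<lambda>v. w v * f (x + to_torus (\<epsilon> *\<^sub>R v)))"
proof -
  have [measurable]: "f \<in> borel_measurable borel" "w \<in> borel_measurable borel"
    using bounded_borelD[OF f] borel_measurable_integrable[OF w] by simp_all
  obtain B where "\<And>x. \<bar>f x\<bar> \<le> B" "0 \<le> B" using f by (auto elim!: bounded_borelE)
  then show ?thesis
    by (intro Bochner_Integration.integrable_bound[OF integrable_mult_left[OF w, of B]])
       (auto simp: abs_mult intro!: mult_left_mono)
qed

lemma integral_gauss_moment_swap:
  fixes f g :: "'n::finite torus \<Rightarrow> real"
  assumes w: "integrable gauss w" and f: "f \<in> bounded_borel" and g: "g \<in> bounded_borel"
  shows "(\<integral>x. gauss_moment w \<epsilon> f x * g x \<partial>torus_measure)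
    = (\<integral>v. w v * (\<integral>x. f (x + to_torus (\<epsilon> *\<^sub>R v)) * g x \<partial>torus_measure) \<partial>gauss)"
proof -
  have [measurable]: "f \<in> borel_measurable borel" "g \<in> borel_measurable borel" "w \<in> borel_measurable borel"
    using f g borel_measurable_integrable[OF w] by (auto dest: bounded_borelD)
  have int: "integrable (torus_measure \<Otimes>\<^sub>M gauss) (\<lambda>(x, v). w v * (f (x + to_torus (\<epsilon> *\<^sub>R v)) * g x))"
  proof -
    obtain A B where AB: "\<And>x. \<bar>f x\<bar> \<le> A" "0 \<le> A" "\<And>x. \<bar>g x\<bar> \<le> B"
      using f g by (auto elim!: bounded_borelE)
    then have fg: "\<bar>f y * g x\<bar> \<le> A * B" for x y by (auto simp: abs_mult intro: mult_mono)
    have "integrable (torus_measure \<Otimes>\<^sub>M gauss) (\<lambda>p :: 'n torus \<times> (real ^ 'n). w (snd p))"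
      using w by (intro torus_gauss.Fubini_integrable) auto
    then have "integrable (torus_measure \<Otimes>\<^sub>M gauss) (\<lambda>p :: 'n torus \<times> (real ^ 'n). w (snd p) * (A * B))"
      by (rule integrable_mult_left)
    then show ?thesis
    proof (rule Bochner_Integration.integrable_bound)
      have "\<bar>w v * (f y * g x)\<bar> \<le> \<bar>w v * (A * B)\<bar>" for v x y
        unfolding abs_mult[of "w v"] by (intro mult_left_mono order.trans[OF fg abs_ge_self]) simp
      then show "AE p in torus_measure \<Otimes>\<^sub>M gauss. norm (case p of (x, v) \<Rightarrow> w v * (f (x + to_torus (\<epsilon> *\<^sub>R v)) * g x))
          \<le> norm (w (snd p) * (A * B))"
        by (intro AE_I2) (simp add: split_beta')
    qed measurable
  qed
  have "(\<integral>x. gauss_moment w \<epsilon> f x * g x \<partial>torus_measure)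
      = (\<integral>x. \<integral>v. w v * (f (x + to_torus (\<epsilon> *\<^sub>R v)) * g x) \<partial>gauss \<partial>torus_measure)"
    by (simp add: gauss_moment_def mult.assoc flip: integral_mult_left_zero)
  also have "\<dots> = (\<integral>v. \<integral>x. w v * (f (x + to_torus (\<epsilon> *\<^sub>R v)) * g x) \<partial>torus_measure \<partial>gauss)"
    using torus_gauss.Fubini_integral[OF int] by simp
  finally show ?thesis by simp
qed

text \<open>Translation invariance of the torus moves the noise from one factor to the other with the
opposite sign, and the Gaussian law is symmetric. Even weights give symmetric operators and odd
weights antisymmetric ones.\<close>

lemma gauss_moment_adjoint:
  fixes f g :: "'n::finite torus \<Rightarrow> real"
  assumes w: "integrable gauss w" and f: "f \<in> bounded_borel" and g: "g \<in> bounded_borel"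
  shows "(\<integral>x. gauss_moment w \<epsilon> f x * g x \<partial>torus_measure)
    = (\<integral>x. f x * gauss_moment (\<lambda>v. w (- v)) \<epsilon> g x \<partial>torus_measure)"
proof -
  have [measurable]: "f \<in> borel_measurable borel" "g \<in> borel_measurable borel" "w \<in> borel_measurable borel"
    using f g borel_measurable_integrable[OF w] by (auto dest: bounded_borelD)
  have w': "integrable gauss (\<lambda>v. w (- v))"
  proof -
    have "integrable (distr gauss borel uminus) w" using w by (simp only: distr_gauss_uminus)
    then show ?thesis by (simp add: integrable_distr_eq)
  qed
  have "(\<integral>x. gauss_moment w \<epsilon> f x * g x \<partial>torus_measure)
      = (\<integral>v. w v * (\<integral>x. f (x + to_torus (\<epsilon> *\<^sub>R v)) * g x \<partial>torus_measure) \<partial>distr gauss borel uminus)"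
    using integral_gauss_moment_swap[OF w f g] by (simp add: distr_gauss_uminus)
  also have "\<dots> = (\<integral>v. w (- v) * (\<integral>x. f (x - to_torus (\<epsilon> *\<^sub>R v)) * g x \<partial>torus_measure) \<partial>gauss)"
  proof (subst integral_distr)
    have "(\<lambda>v. \<integral>x. f (x + to_torus (\<epsilon> *\<^sub>R v)) * g x \<partial>torus_measure) \<in> borel_measurable borel"
      by (rule torus_measure.borel_measurable_lebesgue_integral) measurable
    then show "(\<lambda>v. w v * (\<integral>x. f (x + to_torus (\<epsilon> *\<^sub>R v)) * g x \<partial>torus_measure)) \<in> borel_measurable borel"
      by simp
  qed (auto simp: to_torus_minus)
  also have "\<dots> = (\<integral>v. w (- v) * (\<integral>x. g (x + to_torus (\<epsilon> *\<^sub>R v)) * f x \<partial>torus_measure) \<partial>gauss)"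
  proof (rule Bochner_Integration.integral_cong[OF refl])
    fix v :: "real ^ 'n"
    show "w (- v) * (\<integral>x. f (x - to_torus (\<epsilon> *\<^sub>R v)) * g x \<partial>torus_measure) = w (- v) * (\<integral>x. g (x + to_torus (\<epsilon> *\<^sub>R v)) * f x \<partial>torus_measure)"
      by (subst integral_torus_shift[symmetric, of _ "to_torus (\<epsilon> *\<^sub>R v)"]) (simp_all add: mult.commute)
  qed
  also have "\<dots> = (\<integral>x. gauss_moment (\<lambda>v. w (- v)) \<epsilon> g x * f x \<partial>torus_measure)"
    by (rule integral_gauss_moment_swap[OF w' g f, symmetric])
  finally show ?thesis by (simp add: mult.commute)
qed

lemma gauss_avg_symmetric:
  fixes f g :: "'n::finite torus \<Rightarrow> real"
  assumes "f \<in> bounded_borel" and "g \<in> bounded_borel"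
  shows "(\<integral>x. gauss_avg \<epsilon> f x * g x \<partial>torus_measure) = (\<integral>x. f x * gauss_avg \<epsilon> g x \<partial>torus_measure)"
proof -
  have "gauss_avg \<epsilon> h = gauss_moment (\<lambda>_. 1) \<epsilon> h" for h :: "'n torus \<Rightarrow> real"
    by (simp add: gauss_avg_def gauss_moment_def fun_eq_iff)
  then show ?thesis using gauss_moment_adjoint[of "\<lambda>_. 1"] assms by simp
qed

lemma integral_gauss_avg:
  fixes f :: "'n::finite torus \<Rightarrow> real"
  assumes f: "f \<in> bounded_borel"
  shows "(\<integral>x. gauss_avg \<epsilon> f x \<partial>torus_measure) = (\<integral>x. f x \<partial>torus_measure)"
proof -
  have one: "(\<lambda>_. 1) \<in> bounded_borel" by (intro bounded_borelI[of _ 1]) auto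
  have "gauss_avg \<epsilon> (\<lambda>_. 1) = (\<lambda>_ :: 'n torus. 1)"
    using gauss.prob_space by (simp add: gauss_avg_def fun_eq_iff)
  with gauss_avg_symmetric[OF f one, of \<epsilon>] show ?thesis by simp
qed

lemma gauss_avg_semigroup:
  fixes f :: "'n::finite torus \<Rightarrow> real"
  assumes f: "f \<in> bounded_borel"
  shows "gauss_avg (\<epsilon> / sqrt 2) (gauss_avg (\<epsilon> / sqrt 2) f) = gauss_avg \<epsilon> f"
proof
  fix x
  have [measurable]: "f \<in> borel_measurable borel" using f by (rule bounded_borelD)
  have "integrable (gauss \<Otimes>\<^sub>M gauss) (\<lambda>p. f (x + to_torus (\<epsilon> *\<^sub>R ((\<lambda>(v, w). (v + w) /\<^sub>R sqrt 2) p))))"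
    by (intro gauss_gauss.integrable_bounded_borel[OF f]) measurable
  then have int: "integrable (gauss \<Otimes>\<^sub>M gauss) (\<lambda>(v, w). f (x + to_torus (\<epsilon> *\<^sub>R ((v + w) /\<^sub>R sqrt 2))))"
    by (simp add: split_beta')
  have "gauss_avg \<epsilon> f x = (\<integral>v. f (x + to_torus (\<epsilon> *\<^sub>R v)) \<partial>distr (gauss \<Otimes>\<^sub>M gauss) borel (\<lambda>(v, w). (v + w) /\<^sub>R sqrt 2))"
    by (simp add: gauss_avg_def distr_gauss_average)
  also have "\<dots> = (\<integral>p. (case p of (v, w) \<Rightarrow> f (x + to_torus (\<epsilon> *\<^sub>R ((v + w) /\<^sub>R sqrt 2)))) \<partial>(gauss \<Otimes>\<^sub>M gauss))"
    by (subst integral_distr) (auto simp: split_beta')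
  also have "\<dots> = (\<integral>v. \<integral>w. f (x + to_torus (\<epsilon> *\<^sub>R ((v + w) /\<^sub>R sqrt 2))) \<partial>gauss \<partial>gauss)"
    using gauss_gauss.integral_fst'[OF int] by simp
  also have "\<dots> = (\<integral>v. \<integral>w. f (x + to_torus ((\<epsilon> / sqrt 2) *\<^sub>R v) + to_torus ((\<epsilon> / sqrt 2) *\<^sub>R w)) \<partial>gauss \<partial>gauss)"
    by (simp add: to_torus_add scaleR_add_right add.assoc divide_inverse)
  finally show "gauss_avg (\<epsilon> / sqrt 2) (gauss_avg (\<epsilon> / sqrt 2) f) x = gauss_avg \<epsilon> f x"
    by (simp add: gauss_avg_def)
qed

lemma (in prob_space) square_integral_le:
  fixes X :: "'a \<Rightarrow> real"
  assumes "integrable M X" "integrable M (\<lambda>x. (X x)\<^sup>2)"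
  shows "(\<integral>x. X x \<partial>M)\<^sup>2 \<le> (\<integral>x. (X x)\<^sup>2 \<partial>M)"
proof -
  have "0 \<le> variance X" by (rule variance_positive)
  then show ?thesis using variance_eq[OF assms] by simp
qed

lemma gauss_avg_square_le:
  fixes f :: "'n::finite torus \<Rightarrow> real"
  assumes f: "f \<in> bounded_borel"
  shows "(gauss_avg \<epsilon> f x)\<^sup>2 \<le> gauss_avg \<epsilon> (\<lambda>y. (f y)\<^sup>2) x"
  unfolding gauss_avg_def
  by (intro gauss.square_integral_le gauss.integrable_bounded_borel[OF f]
      gauss.integrable_bounded_borel[OF bounded_borel_power2[OF f]]) measurable

lemma energy_gauss_avg_le:
  fixes f :: "'n::finite torus \<Rightarrow> real"
  assumes f: "f \<in> bounded_borel"
  shows "energy (gauss_avg \<epsilon> f) \<le> energy f"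
proof -
  have "energy (gauss_avg \<epsilon> f) \<le> (\<integral>x. gauss_avg \<epsilon> (\<lambda>y. (f y)\<^sup>2) x \<partial>torus_measure)"
    unfolding energy_def
    by (intro integral_mono integrable_torus_bounded_borel gauss_avg_square_le bounded_borel_power2
        gauss_avg_bounded_borel f)
  also have "\<dots> = energy f"
    unfolding energy_def by (intro integral_gauss_avg bounded_borel_power2 f)
  finally show ?thesis .
qed

text \<open>Averaging is \<open>S \<circ> S\<close> with \<open>S\<close> a symmetric contraction, so
\<open>\<parallel>K f\<parallel>\<^sup>2 \<le> \<parallel>S f\<parallel>\<^sup>2 = \<langle>K f,
f\<rangle>\<close>; expanding the square on the left gives the claim.\<close>

lemma energy_gauss_avg_defect:
  fixes f :: "'n::finite torus \<Rightarrow> real"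
  assumes f: "f \<in> bounded_borel"
  shows "energy (\<lambda>x. gauss_avg \<epsilon> f x - f x) \<le> energy f - energy (gauss_avg \<epsilon> f)"
proof -
  define h where "h = gauss_avg (\<epsilon> / sqrt 2) f"
  have h: "h \<in> bounded_borel" unfolding h_def by (rule gauss_avg_bounded_borel[OF f])
  have Kf: "gauss_avg \<epsilon> f = gauss_avg (\<epsilon> / sqrt 2) h"
    unfolding h_def by (rule gauss_avg_semigroup[OF f, symmetric])
  have bb: "gauss_avg \<epsilon> f \<in> bounded_borel" by (rule gauss_avg_bounded_borel[OF f])
  have "energy (gauss_avg \<epsilon> f) \<le> energy h" unfolding Kf by (rule energy_gauss_avg_le[OF h])
  also have "energy h = (\<integral>x. gauss_avg (\<epsilon> / sqrt 2) h x * f x \<partial>torus_measure)"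
    using gauss_avg_symmetric[OF h f, of "\<epsilon> / sqrt 2"] by (simp add: energy_def h_def power2_eq_square)
  finally have le: "energy (gauss_avg \<epsilon> f) \<le> (\<integral>x. gauss_avg \<epsilon> f x * f x \<partial>torus_measure)"
    by (simp only: Kf)
  note int = integrable_torus_bounded_borel[OF bounded_borel_power2[OF bb]]
    integrable_torus_bounded_borel[OF bounded_borel_power2[OF f]]
    integrable_torus_bounded_borel[OF bounded_borel_mult[OF bb f]]
  have "energy (\<lambda>x. gauss_avg \<epsilon> f x - f x)
      = (\<integral>x. (gauss_avg \<epsilon> f x)\<^sup>2 + (f x)\<^sup>2 - 2 * (gauss_avg \<epsilon> f x * f x) \<partial>torus_measure)"
    unfolding energy_def by (intro Bochner_Integration.integral_cong refl) (simp add: power2_diff)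
  also have "\<dots> = energy (gauss_avg \<epsilon> f) + energy f - 2 * (\<integral>x. gauss_avg \<epsilon> f x * f x \<partial>torus_measure)"
    using int by (simp add: energy_def)
  finally show ?thesis using le by linarith
qed

text \<open>The Cauchy--Schwarz inequality, with one added to the second moment of the weight so that the
optimal multiplier has a nonzero denominator.\<close>

lemma gauss_moment_square_le:
  fixes f :: "'n::finite torus \<Rightarrow> real"
  assumes wm: "w \<in> borel_measurable borel" and w: "integrable gauss (\<lambda>v. (w v)\<^sup>2)" and f: "f \<in> bounded_borel"
  shows "(gauss_moment w \<epsilon> f x)\<^sup>2 \<le> ((\<integral>v. (w v)\<^sup>2 \<partial>gauss) + 1) * gauss_avg \<epsilon> (\<lambda>y. (f y)\<^sup>2) x"
proof -
  define a b c where "a = (\<integral>v. (w v)\<^sup>2 \<partial>gauss)" and "b = gauss_avg \<epsilon> (\<lambda>y. (f y)\<^sup>2) x" and "c = gauss_moment w \<epsilon> f x"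
  \<comment> \<open>The multiplier minimizing the second moment of \<open>t w - f\<close>, up to the added one.\<close>
  define t where "t = c / (a + 1)"
  have a: "0 \<le> a" by (simp add: a_def)
  have int1: "integrable gauss (\<lambda>v. w v * f (x + to_torus (\<epsilon> *\<^sub>R v)))"
    by (rule integrable_gauss_moment[OF integrable_gauss_of_square[OF wm w] f])
  have int2: "integrable gauss (\<lambda>v. (f (x + to_torus (\<epsilon> *\<^sub>R v)))\<^sup>2)"
    by (rule gauss.integrable_bounded_borel[OF bounded_borel_power2[OF f]]) measurable
  have "0 \<le> (\<integral>v. (t * w v - f (x + to_torus (\<epsilon> *\<^sub>R v)))\<^sup>2 \<partial>gauss)" by simp
  also have "\<dots> = (\<integral>v. t\<^sup>2 * (w v)\<^sup>2 + (f (x + to_torus (\<epsilon> *\<^sub>R v)))\<^sup>2 - 2 * t * (w v * f (x + to_torus (\<epsilon> *\<^sub>R v))) \<partial>gauss)"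
    by (intro Bochner_Integration.integral_cong refl) (simp add: power2_diff power_mult_distrib)
  also have "\<dots> = t\<^sup>2 * a + b - 2 * t * c"
    using int1 int2 w by (simp add: a_def b_def c_def gauss_avg_def gauss_moment_def)
  also have "\<dots> \<le> t\<^sup>2 * (a + 1) + b - 2 * t * c" by (simp add: distrib_left)
  also have "\<dots> = b - c\<^sup>2 / (a + 1)"
  proof -
    have "t * (a + 1) = c" using a by (simp add: t_def)
    then have "t\<^sup>2 * (a + 1) = t * c" by (simp add: power2_eq_square mult.assoc)
    moreover have "t * c = c\<^sup>2 / (a + 1)" by (simp add: t_def power2_eq_square)
    ultimately show ?thesis by simp
  qed
  finally show ?thesis using a unfolding a_def[symmetric] b_def[symmetric] c_def[symmetric]
    by (simp add: field_simps)
qed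

lemma gauss_moment_measurable:
  fixes f :: "'n::finite torus \<Rightarrow> real"
  assumes [measurable]: "w \<in> borel_measurable borel" "f \<in> borel_measurable borel"
  shows "gauss_moment w \<epsilon> f \<in> borel_measurable borel"
  unfolding gauss_moment_def[abs_def] by (rule gauss.borel_measurable_lebesgue_integral) measurable

lemma gauss_moment_bounded_borel:
  fixes f :: "'n::finite torus \<Rightarrow> real"
  assumes wm: "w \<in> borel_measurable borel" and w: "integrable gauss (\<lambda>v. (w v)\<^sup>2)" and f: "f \<in> bounded_borel"
  shows "gauss_moment w \<epsilon> f \<in> bounded_borel"
proof -
  obtain B where B: "\<And>x. \<bar>gauss_avg \<epsilon> (\<lambda>y. (f y)\<^sup>2) x\<bar> \<le> B"
    using gauss_avg_bounded_borel[OF bounded_borel_power2[OF f]] by (auto elim!: bounded_borelE)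
  let ?A = "(\<integral>v. (w v)\<^sup>2 \<partial>gauss) + 1"
  have A: "0 \<le> ?A" by (simp add: add_nonneg_nonneg)
  have "\<bar>gauss_moment w \<epsilon> f x\<bar> \<le> sqrt (?A * B)" for x
  proof -
    have "(gauss_moment w \<epsilon> f x)\<^sup>2 \<le> ?A * gauss_avg \<epsilon> (\<lambda>y. (f y)\<^sup>2) x" by (rule gauss_moment_square_le[OF wm w f])
    also have "\<dots> \<le> ?A * B" using B[of x] A by (intro mult_left_mono) auto
    finally show ?thesis by (intro real_le_rsqrt) simp
  qed
  then show ?thesis by (intro bounded_borelI gauss_moment_measurable wm bounded_borelD[OF f])
qed

lemma energy_gauss_moment_le:
  fixes f :: "'n::finite torus \<Rightarrow> real"
  assumes wm: "w \<in> borel_measurable borel" and w: "integrable gauss (\<lambda>v. (w v)\<^sup>2)" and f: "f \<in> bounded_borel"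
  shows "energy (gauss_moment w \<epsilon> f) \<le> ((\<integral>v. (w v)\<^sup>2 \<partial>gauss) + 1) * energy f"
proof -
  have "energy (gauss_moment w \<epsilon> f) \<le> (\<integral>x. ((\<integral>v. (w v)\<^sup>2 \<partial>gauss) + 1) * gauss_avg \<epsilon> (\<lambda>y. (f y)\<^sup>2) x \<partial>torus_measure)"
    unfolding energy_def
    by (intro integral_mono integrable_mult_right integrable_torus_bounded_borel bounded_borel_power2
        gauss_avg_bounded_borel gauss_moment_bounded_borel gauss_moment_square_le wm w f)
  also have "\<dots> = ((\<integral>v. (w v)\<^sup>2 \<partial>gauss) + 1) * energy f"
    by (simp add: energy_def integral_gauss_avg bounded_borel_power2 f)
  finally show ?thesis .
qed

text \<open>The regularization that turns an energy bound into a bound at every point.\<close>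

lemma gauss_avg_sup_bound:
  obtains C :: real where "C > 0"
    "\<And>\<epsilon> (f :: 'n::finite torus \<Rightarrow> real) x. 0 < \<epsilon> \<Longrightarrow> \<epsilon> \<le> 1 \<Longrightarrow> f \<in> bounded_borel \<Longrightarrow>
      (gauss_avg \<epsilon> f x)\<^sup>2 \<le> C / \<epsilon> ^ CARD('n) * energy f"
proof -
  obtain C where C: "C > 0" "\<And>\<epsilon> (f :: 'n torus \<Rightarrow> ennreal) x. 0 < \<epsilon> \<Longrightarrow> \<epsilon> \<le> 1 \<Longrightarrow> f \<in> borel_measurable borel \<Longrightarrow>
      (\<integral>\<^sup>+v. f (x + to_torus (\<epsilon> *\<^sub>R v)) \<partial>gauss) \<le> ennreal (C / \<epsilon> ^ CARD('n)) * (\<integral>\<^sup>+p. f p \<partial>torus_measure)"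
    using nn_integral_gauss_torus_le[where 'n='n] by metis
  show thesis
  proof (rule that[OF C(1)])
    fix \<epsilon> :: real and f :: "'n torus \<Rightarrow> real" and x
    assume e: "0 < \<epsilon>" "\<epsilon> \<le> 1" and f: "f \<in> bounded_borel"
    note f2 = bounded_borel_power2[OF f]
    have [measurable]: "(\<lambda>x. (f x)\<^sup>2) \<in> borel_measurable borel" by (rule bounded_borelD[OF f2])
    have "ennreal (gauss_avg \<epsilon> (\<lambda>y. (f y)\<^sup>2) x) = (\<integral>\<^sup>+v. ennreal ((f (x + to_torus (\<epsilon> *\<^sub>R v)))\<^sup>2) \<partial>gauss)"
      unfolding gauss_avg_def
      by (intro nn_integral_eq_integral[symmetric] gauss.integrable_bounded_borel[OF f2]) auto
    also have "\<dots> \<le> ennreal (C / \<epsilon> ^ CARD('n)) * (\<integral>\<^sup>+p. ennreal ((f p)\<^sup>2) \<partial>torus_measure)"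
      by (rule C(2)[OF e]) measurable
    also have "(\<integral>\<^sup>+p. ennreal ((f p)\<^sup>2) \<partial>torus_measure) = ennreal (energy f)"
      unfolding energy_def by (intro nn_integral_eq_integral integrable_torus_bounded_borel f2) auto
    finally have "ennreal (gauss_avg \<epsilon> (\<lambda>y. (f y)\<^sup>2) x) \<le> ennreal (C / \<epsilon> ^ CARD('n) * energy f)"
      using e C(1) by (simp add: ennreal_mult'[symmetric])
    moreover have "0 \<le> C / \<epsilon> ^ CARD('n) * energy f" using e C(1) by (simp add: energy_nonneg)
    ultimately have "gauss_avg \<epsilon> (\<lambda>y. (f y)\<^sup>2) x \<le> C / \<epsilon> ^ CARD('n) * energy f"
      by (simp add: ennreal_le_iff)
    with gauss_avg_square_le[OF f, of \<epsilon> x] show "(gauss_avg \<epsilon> f x)\<^sup>2 \<le> C / \<epsilon> ^ CARD('n) * energy f"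
      by linarith
  qed
qed

section \<open>Integration by parts against the Gaussian\<close>

text \<open>The increment of \<open>F\<close> along \<open>e\<close> integrates to 0 by translation
invariance. It is also the integral of the derivative over the segment, and exchanging the two
integrals leaves the integral of the derivative alone.\<close>

lemma integral_directional_derivative_zero:
  fixes F F' :: "'a::euclidean_space \<Rightarrow> real"
  assumes deriv: "\<And>v s. ((\<lambda>s. F (v + s *\<^sub>R e)) has_real_derivative F' (v + s *\<^sub>R e)) (at s)"
    and cont: "continuous_on UNIV F'"
    and int: "integrable lborel F" "integrable lborel F'"
  shows "(\<integral>v. F' v \<partial>lborel) = 0"
proof -
  have [measurable]: "F' \<in> borel_measurable borel" by (rule borel_measurable_continuous_onI[OF cont])
  have shift_int: "integrable lborel (\<lambda>v. G (v + c))" and shift: "(\<integral>v. G (v + c) \<partial>lborel) = (\<integral>v. G v \<partial>lborel)"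
    if "integrable lborel G" for G :: "'a \<Rightarrow> real" and c
  proof -
    have m: "G \<in> borel_measurable borel" using borel_measurable_integrable[OF that] by simp
    have eq: "lborel = distr lborel borel ((+) c)" by (rule lborel_distr_plus[symmetric])
    show "(\<integral>v. G (v + c) \<partial>lborel) = (\<integral>v. G v \<partial>lborel)"
      by (subst (2) eq) (use m in \<open>simp add: integral_distr add.commute\<close>)
    have "integrable (distr lborel borel ((+) c)) G" using that by (simp only: lborel_distr_plus)
    then show "integrable lborel (\<lambda>v. G (v + c))"
      using m by (simp add: integrable_distr_eq add.commute)
  qed
  let ?g = "\<lambda>(s, v). indicator {0..1} s * F' (v + s *\<^sub>R e)"
  have g: "integrable (lborel \<Otimes>\<^sub>M lborel) ?g"
  proof (rule lborel_pair.Fubini_integrable)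
    have "(\<lambda>s :: real. \<integral>v. norm (?g (s, v)) \<partial>lborel) = (\<lambda>s. indicator {0..1} s * (\<integral>v. \<bar>F' v\<bar> \<partial>lborel))"
      using shift[of "\<lambda>v. \<bar>F' v\<bar>"] int by (simp add: abs_mult)
    then show "integrable lborel (\<lambda>s :: real. \<integral>v. norm (?g (s, v)) \<partial>lborel)"
      by (simp add: integrable_mult_left_iff)
    show "AE s in lborel. integrable lborel (\<lambda>v. ?g (s, v))"
      using shift_int[OF int(2)] by simp
  qed measurable
  have "(\<integral>v. F (v + e) - F v \<partial>lborel) = (\<integral>v. \<integral>s. ?g (s, v) \<partial>lborel \<partial>lborel)"
  proof (rule Bochner_Integration.integral_cong[OF refl])
    fix v
    have "(\<integral>s. F' (v + s *\<^sub>R e) * indicator {0..1} s \<partial>lborel) = F (v + 1 *\<^sub>R e) - F (v + 0 *\<^sub>R e)"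
    proof (rule integral_FTC_Icc_real)
      show "((\<lambda>s. F (v + s *\<^sub>R e)) has_real_derivative F' (v + s *\<^sub>R e)) (at s)" for s by (rule deriv)
      have "continuous_on UNIV (\<lambda>s :: real. F' (v + s *\<^sub>R e))"
        by (intro continuous_on_compose2[OF cont] continuous_intros) auto
      then show "isCont (\<lambda>s. F' (v + s *\<^sub>R e)) s" for s
        by (simp add: continuous_on_eq_continuous_at)
    qed simp
    then show "F (v + e) - F v = (\<integral>s. ?g (s, v) \<partial>lborel)" by (simp add: mult.commute)
  qed
  also have "\<dots> = (\<integral>s. \<integral>v. ?g (s, v) \<partial>lborel \<partial>lborel)"
    using lborel_pair.Fubini_integral[OF g] by simp
  also have "\<dots> = (\<integral>s. indicator {0..1 :: real} s * (\<integral>v. F' v \<partial>lborel) \<partial>lborel)"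
    using shift[OF int(2)] by simp
  also have "\<dots> = (\<integral>v. F' v \<partial>lborel)" by simp
  finally show ?thesis using shift[OF int(1), of e] shift_int[OF int(1)] int(1) by simp
qed

section \<open>Smooth functions on the torus\<close>

lemma torus_smooth_differentiable:
  assumes "torus_smooth \<psi>"
  shows "(\<lambda>y. \<psi> (to_torus y)) differentiable (at x)"
    and "(\<lambda>y. torus_partial i \<psi> (to_torus y)) differentiable (at x)"
proof -
  have *: "(\<lambda>y. foldr torus_partial is \<psi> (to_torus y)) differentiable (at x)" for "is"
    using assms by (simp add: torus_smooth_def)
  show "(\<lambda>y. \<psi> (to_torus y)) differentiable (at x)" using *[of "[]"] by simp
  show "(\<lambda>y. torus_partial i \<psi> (to_torus y)) differentiable (at x)" using *[of "[i]"] by simp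
qed

lemma continuous_torus_bounded_borel:
  fixes f :: "'n::finite torus \<Rightarrow> real"
  assumes "continuous_on UNIV (\<lambda>y. f (to_torus y))"
  shows "f \<in> bounded_borel"
proof -
  have "f ` UNIV \<subseteq> (\<lambda>y. f (to_torus y)) ` cbox 0 1"
  proof
    fix r assume "r \<in> f ` UNIV"
    then obtain p where "r = f p" by auto
    moreover have "torus_rep p \<in> cbox 0 1"
      using torus_rep_in_cell[of p] by (simp add: fundamental_cell_def mem_box_cart less_imp_le)
    ultimately show "r \<in> (\<lambda>y. f (to_torus y)) ` cbox 0 1" by (intro image_eqI[of _ _ "torus_rep p"]) auto
  qed
  moreover have "compact ((\<lambda>y. f (to_torus y)) ` cbox 0 1)"
    by (intro compact_continuous_image continuous_on_subset[OF assms]) auto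
  ultimately have "bounded (range f)" using compact_imp_bounded bounded_subset by metis
  moreover have "(\<lambda>p. (\<lambda>y. f (to_torus y)) (torus_rep p)) \<in> borel_measurable borel"
    by (intro measurable_compose[OF torus_rep_measurable] borel_measurable_continuous_onI assms)
  ultimately show ?thesis by (simp add: bounded_borel_def)
qed

lemma torus_smooth_continuous:
  assumes "torus_smooth \<psi>"
  shows "continuous_on UNIV (\<lambda>y. \<psi> (to_torus y))"
    and "continuous_on UNIV (\<lambda>y. torus_partial i \<psi> (to_torus y))"
  using torus_smooth_differentiable[OF assms]
  by (auto simp: continuous_on_eq_continuous_at intro: differentiable_imp_continuous_within)

text \<open>Periodicity and continuity over a compact cell bound a smooth function and its partial
derivatives.\<close>

lemma torus_smooth_bounded_borel:
  assumes "torus_smooth \<psi>"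
  shows "\<psi> \<in> bounded_borel" "torus_partial i \<psi> \<in> bounded_borel"
  using torus_smooth_continuous[OF assms] by (auto intro: continuous_torus_bounded_borel)

lemma torus_smooth_has_partial:
  assumes "torus_smooth \<psi>"
  shows "((\<lambda>s. \<psi> (p + to_torus (s *\<^sub>R axis i 1))) has_real_derivative torus_partial i \<psi> (p + to_torus (s *\<^sub>R axis i 1))) (at s)"
proof -
  have at0: "((\<lambda>t. \<psi> (q + to_torus (t *\<^sub>R axis i 1))) has_real_derivative torus_partial i \<psi> q) (at 0)" for q
  proof -
    define y where "y = torus_rep q"
    have q: "q = to_torus y" by (simp add: y_def)
    have "(\<lambda>t. y + t *\<^sub>R axis i 1) differentiable (at (0::real))" by simp
    moreover have "(\<lambda>y. \<psi> (to_torus y)) differentiable (at (y + 0 *\<^sub>R axis i 1))"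
      by (rule torus_smooth_differentiable[OF assms])
    ultimately have "((\<lambda>y. \<psi> (to_torus y)) \<circ> (\<lambda>t. y + t *\<^sub>R axis i 1)) differentiable (at 0)"
      by (rule differentiable_chain_at)
    then have "(\<lambda>t. \<psi> (q + to_torus (t *\<^sub>R axis i 1))) differentiable (at 0)"
      by (simp add: comp_def q to_torus_add)
    then show ?thesis by (simp add: torus_partial_def DERIV_deriv_iff_real_differentiable)
  qed
  have "((\<lambda>t. \<psi> (p + to_torus ((t + s) *\<^sub>R axis i 1))) has_real_derivative torus_partial i \<psi> (p + to_torus (s *\<^sub>R axis i 1))) (at 0)"
    using at0[of "p + to_torus (s *\<^sub>R axis i 1)"] by (simp add: scaleR_add_left to_torus_add add_ac)
  then show ?thesis using DERIV_shift[of "\<lambda>s. \<psi> (p + to_torus (s *\<^sub>R axis i 1))" _ 0 s] by simp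
qed

lemma integrable_gauss_iff:
  fixes h :: "real ^ 'n::finite \<Rightarrow> real"
  assumes [measurable]: "h \<in> borel_measurable borel"
  shows "integrable gauss h \<longleftrightarrow> integrable lborel (\<lambda>v. std_gaussian v * h v)"
  unfolding gauss_def by (subst integrable_density) (auto simp: std_gaussian_nonneg)

lemma integral_gauss:
  fixes h :: "real ^ 'n::finite \<Rightarrow> real"
  assumes [measurable]: "h \<in> borel_measurable borel"
  shows "(\<integral>v. h v \<partial>gauss) = (\<integral>v. std_gaussian v * h v \<partial>lborel)"
  unfolding gauss_def by (subst integral_density) (auto simp: std_gaussian_nonneg)

lemma std_gaussian_has_partial:
  "((\<lambda>s. std_gaussian (v + s *\<^sub>R axis i 1)) has_real_derivative
    - ((v + s *\<^sub>R axis i 1) $ i) * std_gaussian (v + s *\<^sub>R axis i 1)) (at s)"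
proof -
  have eq: "(norm (v + s *\<^sub>R axis i 1))\<^sup>2 = (norm v)\<^sup>2 + 2 * s * (v $ i) + s\<^sup>2" for s
    by (simp only: power2_norm_eq_inner inner_add_left inner_add_right inner_scaleR_left inner_scaleR_right inner_axis_axis)
      (simp add: inner_axis inner_axis' power2_eq_square distrib_left)
  show ?thesis
    unfolding std_gaussian_def eq by (auto intro!: derivative_eq_intros simp: axis_def)
qed

text \<open>Integrating by parts over \<open>\<real>\<^sup>d\<close> trades the factor \<open>v $ i\<close>,
which comes from differentiating the Gaussian, for a derivative of the test function.\<close>

lemma gauss_moment_smooth:
  fixes \<psi> :: "'n::finite torus \<Rightarrow> real"
  assumes psi: "torus_smooth \<psi>"
  shows "gauss_moment (\<lambda>v. v $ i) \<epsilon> \<psi> x = \<epsilon> * gauss_avg \<epsilon> (torus_partial i \<psi>) x"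
proof -
  let ?P = "\<lambda>v. \<psi> (x + to_torus (\<epsilon> *\<^sub>R v))" and ?D = "\<lambda>v. torus_partial i \<psi> (x + to_torus (\<epsilon> *\<^sub>R v))"
  let ?F' = "\<lambda>v. std_gaussian v * (\<epsilon> * ?D v - v $ i * ?P v)"
  note bb = torus_smooth_bounded_borel[OF psi]
  have [measurable]: "\<psi> \<in> borel_measurable borel" "torus_partial i \<psi> \<in> borel_measurable borel"
    using bb by (auto intro: bounded_borelD)
  have int_P: "integrable gauss ?P" by (rule gauss.integrable_bounded_borel[OF bb(1)]) measurable
  have int_D: "integrable gauss ?D" by (rule gauss.integrable_bounded_borel[OF bb(2)]) measurable
  have int_vP: "integrable gauss (\<lambda>v. v $ i * ?P v)"
    by (rule integrable_gauss_moment[OF integrable_gauss_of_square[OF _ integrable_gauss_square] bb(1)]) measurable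
  have x: "x + to_torus y = to_torus (torus_rep x + y)" for y by (simp add: to_torus_add)
  have "(\<integral>v. ?F' v \<partial>lborel) = 0"
  proof (rule integral_directional_derivative_zero[of "\<lambda>v. std_gaussian v * ?P v" "axis i 1"])
    fix v :: "real ^ 'n" and s :: real
    have "?P (v + s *\<^sub>R axis i 1) = \<psi> ((x + to_torus (\<epsilon> *\<^sub>R v)) + to_torus ((\<epsilon> * s) *\<^sub>R axis i 1))" for s
      by (simp add: scaleR_add_right to_torus_add add_ac)
    moreover have "?D (v + s *\<^sub>R axis i 1) = torus_partial i \<psi> ((x + to_torus (\<epsilon> *\<^sub>R v)) + to_torus ((\<epsilon> * s) *\<^sub>R axis i 1))" for s
      by (simp add: scaleR_add_right to_torus_add add_ac)
    moreover have "((\<lambda>s. \<psi> ((x + to_torus (\<epsilon> *\<^sub>R v)) + to_torus ((\<epsilon> * s) *\<^sub>R axis i 1))) has_real_derivative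
        torus_partial i \<psi> ((x + to_torus (\<epsilon> *\<^sub>R v)) + to_torus ((\<epsilon> * s) *\<^sub>R axis i 1)) * \<epsilon>) (at s)"
    proof (rule DERIV_chain2[of "\<lambda>s. \<psi> ((x + to_torus (\<epsilon> *\<^sub>R v)) + to_torus (s *\<^sub>R axis i 1))"])
      show "((*) \<epsilon> has_real_derivative \<epsilon>) (at s)" by (auto intro!: derivative_eq_intros)
    qed (rule torus_smooth_has_partial[OF psi])
    ultimately have "((\<lambda>s. ?P (v + s *\<^sub>R axis i 1)) has_real_derivative ?D (v + s *\<^sub>R axis i 1) * \<epsilon>) (at s)"
      by (simp only:)
    from DERIV_mult[OF std_gaussian_has_partial this]
    show "((\<lambda>s. std_gaussian (v + s *\<^sub>R axis i 1) * ?P (v + s *\<^sub>R axis i 1)) has_real_derivative ?F' (v + s *\<^sub>R axis i 1)) (at s)"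
      by (rule DERIV_cong) (simp add: algebra_simps)
  next
    have "continuous_on UNIV (\<lambda>v. \<psi> (to_torus (torus_rep x + \<epsilon> *\<^sub>R v)))"
      by (rule continuous_on_compose2[OF torus_smooth_continuous(1)[OF psi]]) (auto intro!: continuous_intros)
    moreover have "continuous_on UNIV (\<lambda>v. torus_partial i \<psi> (to_torus (torus_rep x + \<epsilon> *\<^sub>R v)))"
      by (rule continuous_on_compose2[OF torus_smooth_continuous(2)[OF psi]]) (auto intro!: continuous_intros)
    ultimately show "continuous_on UNIV ?F'"
      unfolding x std_gaussian_def by (intro continuous_intros) auto
  next
    show "integrable lborel (\<lambda>v. std_gaussian v * ?P v)"
      using int_P by (subst integrable_gauss_iff[symmetric]) auto
    have "integrable gauss (\<lambda>v. \<epsilon> * ?D v - v $ i * ?P v)"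
      by (intro Bochner_Integration.integrable_diff integrable_mult_right int_D int_vP)
    then show "integrable lborel ?F'" by (subst integrable_gauss_iff[symmetric]) auto
  qed
  then have "(\<integral>v. \<epsilon> * ?D v - v $ i * ?P v \<partial>gauss) = 0" by (subst integral_gauss) auto
  then show ?thesis using int_D int_vP by (simp add: gauss_moment_def gauss_avg_def)
qed

section \<open>Uniqueness of weak derivatives\<close>

text \<open>A supply of smooth functions that is closed under the operations needed to approximate
indicators. Closure under \<open>exp\<close> makes the approximations bounded between 0 and 1.\<close>

inductive_set exp_trig :: "('n::finite torus \<Rightarrow> real) set" where
  const: "(\<lambda>_. c) \<in> exp_trig"
| cos: "(\<lambda>x. cos (2 * pi * (torus_rep x $ i))) \<in> exp_trig"
| sin: "(\<lambda>x. sin (2 * pi * (torus_rep x $ i))) \<in> exp_trig"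
| add: "f \<in> exp_trig \<Longrightarrow> g \<in> exp_trig \<Longrightarrow> (\<lambda>x. f x + g x) \<in> exp_trig"
| mult: "f \<in> exp_trig \<Longrightarrow> g \<in> exp_trig \<Longrightarrow> (\<lambda>x. f x * g x) \<in> exp_trig"
| exp: "f \<in> exp_trig \<Longrightarrow> (\<lambda>x. exp (f x)) \<in> exp_trig"

lemma exp_trig_uminus: "f \<in> exp_trig \<Longrightarrow> (\<lambda>x. - f x) \<in> exp_trig"
  using exp_trig.mult[OF exp_trig.const[of "-1"]] by simp

lemma exp_trig_diff: "f \<in> exp_trig \<Longrightarrow> g \<in> exp_trig \<Longrightarrow> (\<lambda>x. f x - g x) \<in> exp_trig"
  using exp_trig.add[OF _ exp_trig_uminus] by fastforce

lemma exp_trig_sum: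
  "finite F \<Longrightarrow> (\<And>u. u \<in> F \<Longrightarrow> f u \<in> exp_trig) \<Longrightarrow> (\<lambda>x. \<Sum>u\<in>F. f u x) \<in> exp_trig"
  by (induction F rule: finite_induct) (auto intro: exp_trig.const exp_trig.add)

lemma cos_frac: "cos (2 * pi * frac y) = cos (2 * pi * y)"
  by (simp add: frac_def right_diff_distrib cos_diff)

lemma sin_frac: "sin (2 * pi * frac y) = sin (2 * pi * y)"
  by (simp add: frac_def right_diff_distrib sin_diff)

lemma torus_rep_component_measurable [measurable]:
  "(\<lambda>x. torus_rep x $ i) \<in> borel_measurable (borel :: 'n::finite torus measure)"
  using measurable_compose[OF torus_rep_measurable borel_measurable_nth] .

lemma exp_trig_bounded_borel: "f \<in> exp_trig \<Longrightarrow> f \<in> bounded_borel"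
proof (induction rule: exp_trig.induct)
  case (const c) then show ?case by (intro bounded_borelI[of _ "\<bar>c\<bar>"]) auto
next
  case (cos i) then show ?case by (intro bounded_borelI[of _ 1]) auto
next
  case (sin i) then show ?case by (intro bounded_borelI[of _ 1]) auto
next
  case (add f g) then show ?case by (intro bounded_borel_add)
next
  case (mult f g) then show ?case by (intro bounded_borel_mult)
next
  case (exp f)
  then have [measurable]: "f \<in> borel_measurable borel" by (auto dest: bounded_borelD)
  obtain B where "\<And>x. \<bar>f x\<bar> \<le> B" using exp by (auto elim!: bounded_borelE)
  then have "\<bar>exp (f x)\<bar> \<le> exp B" for x by (simp add: abs_le_iff)
  then show ?case by (intro bounded_borelI[of _ "exp B"]) auto
qed

lemma exp_trig_differentiable:
  "f \<in> exp_trig \<Longrightarrow> (\<lambda>y. f (to_torus y)) differentiable (at y)"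
proof (induction rule: exp_trig.induct)
  case (cos i)
  have "((\<lambda>y. cos (2 * pi * (y $ i))) has_derivative (\<lambda>h. - (2 * pi * (h $ i)) * sin (2 * pi * (y $ i)))) (at y)"
    by (auto intro!: derivative_eq_intros bounded_linear.has_derivative[OF bounded_linear_vec_nth])
  then show ?case by (auto simp: torus_rep_to_torus cos_frac differentiable_def)
next
  case (sin i)
  have "((\<lambda>y. sin (2 * pi * (y $ i))) has_derivative (\<lambda>h. (2 * pi * (h $ i)) * cos (2 * pi * (y $ i)))) (at y)"
    by (auto intro!: derivative_eq_intros bounded_linear.has_derivative[OF bounded_linear_vec_nth])
  then show ?case by (auto simp: torus_rep_to_torus sin_frac differentiable_def)
next
  case (exp f)
  then show ?case by (auto simp: differentiable_def intro: has_derivative_exp)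
qed auto

text \<open>Closure under partial derivatives is what yields smoothness of all orders.\<close>

lemma exp_trig_has_partial:
  assumes "f \<in> exp_trig"
  shows "\<exists>g\<in>exp_trig. \<forall>x. ((\<lambda>t. f (x + to_torus (t *\<^sub>R axis i 1))) has_real_derivative g x) (at 0)"
  using assms
proof (induction rule: exp_trig.induct)
  case (const c) then show ?case by (intro bexI[OF _ exp_trig.const[of 0]]) auto
next
  case (cos j)
  let ?d = "if j = i then 1 else 0 :: real"
  have rep: "cos (2 * pi * (torus_rep (x + to_torus (t *\<^sub>R axis i 1)) $ j)) = cos (2 * pi * (torus_rep x $ j + t * ?d))" for x t
  proof -
    have "x + to_torus (t *\<^sub>R axis i 1) = to_torus (torus_rep x + t *\<^sub>R axis i 1)" by (simp add: to_torus_add)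
    then show ?thesis by (simp only: torus_rep_to_torus cos_frac) (simp add: axis_def)
  qed
  have "((\<lambda>t. cos (2 * pi * (torus_rep x $ j + t * ?d))) has_real_derivative
      (- (2 * pi * ?d)) * sin (2 * pi * (torus_rep x $ j))) (at 0)" for x
    by (auto intro!: derivative_eq_intros)
  then show ?case
    by (intro bexI[OF _ exp_trig.mult[OF exp_trig.const[of "- (2 * pi * ?d)"] exp_trig.sin[of j]]] allI)
       (simp only: rep)
next
  case (sin j)
  let ?d = "if j = i then 1 else 0 :: real"
  have rep: "sin (2 * pi * (torus_rep (x + to_torus (t *\<^sub>R axis i 1)) $ j)) = sin (2 * pi * (torus_rep x $ j + t * ?d))" for x t
  proof -
    have "x + to_torus (t *\<^sub>R axis i 1) = to_torus (torus_rep x + t *\<^sub>R axis i 1)" by (simp add: to_torus_add)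
    then show ?thesis by (simp only: torus_rep_to_torus sin_frac) (simp add: axis_def)
  qed
  have "((\<lambda>t. sin (2 * pi * (torus_rep x $ j + t * ?d))) has_real_derivative
      (2 * pi * ?d) * cos (2 * pi * (torus_rep x $ j))) (at 0)" for x
    by (auto intro!: derivative_eq_intros)
  then show ?case
    by (intro bexI[OF _ exp_trig.mult[OF exp_trig.const[of "2 * pi * ?d"] exp_trig.cos[of j]]] allI)
       (simp only: rep)
next
  case (add f1 f2)
  then obtain g1 g2 where g: "g1 \<in> exp_trig" "g2 \<in> exp_trig"
    "\<And>x. ((\<lambda>t. f1 (x + to_torus (t *\<^sub>R axis i 1))) has_real_derivative g1 x) (at 0)"
    "\<And>x. ((\<lambda>t. f2 (x + to_torus (t *\<^sub>R axis i 1))) has_real_derivative g2 x) (at 0)" by blast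
  then show ?case
    by (intro bexI[OF _ exp_trig.add[OF g(1,2)]] allI DERIV_add)
next
  case (mult f1 f2)
  then obtain g1 g2 where g: "g1 \<in> exp_trig" "g2 \<in> exp_trig"
    "\<And>x. ((\<lambda>t. f1 (x + to_torus (t *\<^sub>R axis i 1))) has_real_derivative g1 x) (at 0)"
    "\<And>x. ((\<lambda>t. f2 (x + to_torus (t *\<^sub>R axis i 1))) has_real_derivative g2 x) (at 0)" by blast
  have "((\<lambda>t. f1 (x + to_torus (t *\<^sub>R axis i 1)) * f2 (x + to_torus (t *\<^sub>R axis i 1))) has_real_derivative g1 x * f2 x + g2 x * f1 x) (at 0)" for x
    using DERIV_mult[OF g(3,4)] by (simp add: to_torus_0)
  then show ?case
    by (intro bexI[OF _ exp_trig.add[OF exp_trig.mult[OF g(1) mult(2)] exp_trig.mult[OF g(2) mult(1)]]] allI)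
next
  case (exp f)
  then obtain g where g: "g \<in> exp_trig"
    "\<And>x. ((\<lambda>t. f (x + to_torus (t *\<^sub>R axis i 1))) has_real_derivative g x) (at 0)" by blast
  have "((\<lambda>t. exp (f (x + to_torus (t *\<^sub>R axis i 1)))) has_real_derivative exp (f x) * g x) (at 0)" for x
    using DERIV_chain2[OF DERIV_exp g(2)] by (simp add: to_torus_0)
  then show ?case
    by (intro bexI[OF _ exp_trig.mult[OF exp_trig.exp[OF exp(1)] g(1)]] allI)
qed

lemma exp_trig_torus_partial: "f \<in> exp_trig \<Longrightarrow> torus_partial i f \<in> exp_trig"
proof -
  assume "f \<in> exp_trig"
  then obtain g where g: "g \<in> exp_trig"
    "\<And>x. ((\<lambda>t. f (x + to_torus (t *\<^sub>R axis i 1))) has_real_derivative g x) (at 0)"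
    using exp_trig_has_partial by blast
  then have "torus_partial i f = g" by (auto simp: torus_partial_def fun_eq_iff DERIV_imp_deriv)
  with g show ?thesis by simp
qed

lemma exp_trig_smooth: "f \<in> exp_trig \<Longrightarrow> torus_smooth f"
proof -
  assume "f \<in> exp_trig"
  then have "foldr torus_partial is f \<in> exp_trig" for "is"
    by (induction "is") (auto intro: exp_trig_torus_partial)
  then show ?thesis by (auto simp: torus_smooth_def intro: exp_trig_differentiable)
qed

text \<open>A generator of the Borel sets that is stable under intersections and whose indicators are limits
of functions in \<open>exp_trig\<close>.\<close>

definition exp_trig_negative_sets :: "'n::finite torus set set"
  where "exp_trig_negative_sets = {{x. \<forall>u\<in>F. u x < 0} | F. finite F \<and> F \<subseteq> exp_trig}"

lemma torus_rep_zero_iff: "torus_rep x $ i = 0 \<longleftrightarrow> \<not> (cos (2 * pi * (torus_rep x $ i)) - 1 < 0)"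
proof
  let ?y = "torus_rep x $ i"
  have y: "0 \<le> ?y" "?y < 1" using torus_rep_in_cell[of x] by (auto simp: fundamental_cell_def)
  assume "\<not> (cos (2 * pi * ?y) - 1 < 0)"
  then have "cos (2 * pi * ?y) = 1" using cos_le_one[of "2 * pi * ?y"] by linarith
  then obtain k :: int where "2 * pi * ?y = of_int k * (2 * pi)" by (auto simp: cos_one_2pi_int mult_ac)
  then have "?y = of_int k" by simp
  with y show "?y = 0" by simp
qed simp

text \<open>The arc from 0 to \<open>a\<close> consists of the angles at distance less than \<open>\<pi>
a\<close> from its midpoint, that is, of those whose cosine relative to the midpoint exceeds
\<open>cos (\<pi> a)\<close>.\<close>

lemma torus_rep_less_iff:
  assumes a: "0 < a" "a < 1"
  shows "0 < torus_rep x $ i \<and> torus_rep x $ i < a \<longleftrightarrow>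
    cos (pi * a) - (cos (2 * pi * (torus_rep x $ i)) * cos (pi * a) + sin (2 * pi * (torus_rep x $ i)) * sin (pi * a)) < 0"
proof -
  let ?y = "torus_rep x $ i"
  have y: "0 \<le> ?y" "?y < 1" using torus_rep_in_cell[of x] by (auto simp: fundamental_cell_def)
  define z where "z = 2 * pi * ?y - pi * a"
  have pa: "0 < pi * a" "pi * a < pi" using a by auto
  have z: "- (pi * a) \<le> z" "z < 2 * pi - pi * a" using y by (auto simp: z_def)
  have "cos (pi * a) - (cos (2 * pi * ?y) * cos (pi * a) + sin (2 * pi * ?y) * sin (pi * a)) < 0
      \<longleftrightarrow> cos (pi * a) < cos z"
    by (simp add: z_def cos_diff)
  also have "\<dots> \<longleftrightarrow> \<bar>z\<bar> < pi * a"
  proof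
    assume "\<bar>z\<bar> < pi * a"
    then have "cos (pi * a) < cos \<bar>z\<bar>" using pa by (intro cos_monotone_0_pi) auto
    then show "cos (pi * a) < cos z" by simp
  next
    assume *: "cos (pi * a) < cos z"
    show "\<bar>z\<bar> < pi * a"
    proof (rule ccontr)
      assume "\<not> \<bar>z\<bar> < pi * a"
      then consider "z = - (pi * a)" | "pi * a \<le> z" "z \<le> pi" | "pi < z" using z by linarith
      then show False
      proof cases
        case 1 then show False using * by simp
      next
        case 2 then have "cos z \<le> cos (pi * a)" using pa by (intro cos_monotone_0_pi_le) auto
        then show False using * by simp
      next
        case 3
        have "cos (2 * pi - z) \<le> cos (pi * a)" using 3 z pa by (intro cos_monotone_0_pi_le) auto
        then show False using * by (simp add: cos_diff)
      qed
    qed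
  qed
  also have "\<dots> \<longleftrightarrow> 0 < ?y \<and> ?y < a" 
  proof -
    have "\<bar>z\<bar> < pi * a \<longleftrightarrow> 0 < pi * (2 * ?y) \<and> pi * (2 * ?y) < pi * (2 * a)"
      by (auto simp: z_def abs_less_iff)
    then show ?thesis by (simp add: zero_less_mult_iff)
  qed
  finally show ?thesis by simp
qed

text \<open>It is enough that the coordinates of the representative are measurable for the generated
\<open>\<sigma>\<close>-algebra. Initial arcs are open arcs together with the point 0, whose
complement is again a set where a trigonometric function is negative.\<close>

lemma sets_borel_torus_exp_trig:
  "sets (borel :: 'n::finite torus measure) \<subseteq> sigma_sets UNIV exp_trig_negative_sets"
proof
  let ?M = "sigma UNIV (exp_trig_negative_sets :: 'n torus set set)"
  have M: "sets ?M = sigma_sets UNIV exp_trig_negative_sets" "space ?M = UNIV" by simp_all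
  have single: "{x. u x < 0} \<in> sets ?M" if "u \<in> exp_trig" for u :: "'n torus \<Rightarrow> real"
  proof -
    have "{x. u x < 0} \<in> exp_trig_negative_sets"
      unfolding exp_trig_negative_sets_def using that by (intro CollectI exI[of _ "{u}"]) auto
    then show ?thesis by (simp add: sigma_sets.Basic)
  qed
  have "(\<lambda>x. torus_rep x $ i) \<in> borel_measurable ?M" for i :: 'n
  proof (subst borel_measurable_iff_less, rule allI)
    fix a :: real
    have range: "0 \<le> torus_rep x $ i" "torus_rep x $ i < 1" for x :: "'n torus"
      using torus_rep_in_cell[of x] by (auto simp: fundamental_cell_def)
    have zero: "{x. torus_rep x $ i = 0} \<in> sets ?M"
    proof -
      have "space ?M - {x. cos (2 * pi * (torus_rep x $ i)) - 1 < 0} \<in> sets ?M"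
        by (intro sets.compl_sets single exp_trig_diff exp_trig.const exp_trig.cos)
      moreover have "space ?M - {x. cos (2 * pi * (torus_rep x $ i)) - 1 < 0} = {x. torus_rep x $ i = 0}"
        using torus_rep_zero_iff by auto
      ultimately show ?thesis by simp
    qed
    consider "a \<le> 0" | "0 < a" "a < 1" | "1 \<le> a" by linarith
    then have "{x. torus_rep x $ i < a} \<in> sets ?M"
    proof cases
      case 1 then have "{x. torus_rep x $ i < a} = {}" using range by (auto simp: not_less intro: order.trans)
      then show ?thesis by (simp only: sets.empty_sets)
    next
      case 2
      have "{x. torus_rep x $ i < a} = {x. torus_rep x $ i = 0} \<union> {x. cos (pi * a) - (cos (2 * pi * (torus_rep x $ i)) * cos (pi * a)
          + sin (2 * pi * (torus_rep x $ i)) * sin (pi * a)) < 0}"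
        unfolding torus_rep_less_iff[OF 2, symmetric] using range 2 by (auto simp: less_le)
      then show ?thesis
        by (simp only:) (intro sets.Un zero single exp_trig_diff exp_trig.intros)
    next
      case 3 then have "{x. torus_rep x $ i < a} = space ?M" using range by (auto intro: less_le_trans)
      then show ?thesis by (simp only: sets.top)
    qed
    then show "{w \<in> space ?M. torus_rep w $ i < a} \<in> sets ?M" by (simp only: M UNIV_I simp_thms)
  qed
  then have "torus_rep \<in> borel_measurable ?M"
    by (subst borel_measurable_euclidean_space) (auto simp: Basis_vec_def inner_axis)
  then have m: "torus_rep -` B \<inter> space ?M \<in> sets ?M" if "B \<in> sets borel" for B
    using that by (rule measurable_sets)
  fix A :: "'n torus set" assume "A \<in> sets borel"
  then have "to_torus -` A \<in> sets borel" using measurable_sets[OF to_torus_measurable] by simp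
  from m[OF this] have "torus_rep -` (to_torus -` A) \<in> sets ?M" by (simp only: M Int_UNIV_right)
  moreover have "torus_rep -` (to_torus -` A) = A" by auto
  ultimately show "A \<in> sigma_sets UNIV exp_trig_negative_sets" by (simp only: M)
qed

text \<open>The functions \<open>exp (- (\<Sum>u\<in>F. exp (n\<^sup>2 u + n)))\<close> lie in
\<open>exp_trig\<close>, take values between 0 and 1, and converge everywhere to the indicator.\<close>

lemma integral_negative_set_zero:
  fixes h :: "'n::finite torus \<Rightarrow> real"
  assumes h: "integrable torus_measure h"
    and orth: "\<And>\<psi>. \<psi> \<in> exp_trig \<Longrightarrow> (\<integral>x. h x * \<psi> x \<partial>torus_measure) = 0"
    and F: "finite F" "F \<subseteq> exp_trig"
  shows "(\<integral>x. indicator {x. \<forall>u\<in>F. u x < 0} x * h x \<partial>torus_measure) = 0"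
proof -
  \<comment> \<open>The summand \<open>n\<close> forces the limit 0 also where some \<open>u\<close> vanishes.\<close>
  define \<psi> where "\<psi> n x = exp (- (\<Sum>u\<in>F. exp ((real n)\<^sup>2 * u x + real n)))" for n x
  have psi: "\<psi> n \<in> exp_trig" for n
    unfolding \<psi>_def[abs_def] using F
    by (intro exp_trig.exp exp_trig_uminus exp_trig_sum exp_trig.add exp_trig.mult exp_trig.const) auto
  have psi_range: "0 \<le> \<psi> n x" "\<psi> n x \<le> 1" for n x
    by (auto simp: \<psi>_def intro!: sum_nonneg)
  have exp_lim: "(\<lambda>n. exp (- real n)) \<longlonglongrightarrow> 0"
    by (rule filterlim_compose[OF exp_at_bot])
       (simp add: filterlim_uminus_at_bot filterlim_real_sequentially)
  have lim: "(\<lambda>n. \<psi> n x) \<longlonglongrightarrow> indicator {x. \<forall>u\<in>F. u x < 0} x" for x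
  proof (cases "\<forall>u\<in>F. u x < 0")
    case True
    have "(\<lambda>n. exp ((real n)\<^sup>2 * c + real n)) \<longlonglongrightarrow> 0" if "c < 0" for c :: real
    proof (rule tendsto_sandwich[of "\<lambda>_. 0" _ _ "\<lambda>n. exp (- real n)"])
      show "\<forall>\<^sub>F n in sequentially. exp ((real n)\<^sup>2 * c + real n) \<le> exp (- real n)"
      proof (rule eventually_sequentiallyI)
        fix n assume "nat \<lceil>- 2 / c\<rceil> \<le> n"
        then have "- 2 / c \<le> real n" by linarith
        then have "real n * c \<le> - 2" using that by (simp add: field_simps)
        then have "real n * (real n * c) \<le> real n * (- 2)" by (intro mult_left_mono) auto
        then show "exp ((real n)\<^sup>2 * c + real n) \<le> exp (- real n)"
          by (simp add: power2_eq_square mult.assoc)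
      qed
    qed (use exp_lim in auto)
    then have "(\<lambda>n. exp (- (\<Sum>u\<in>F. exp ((real n)\<^sup>2 * u x + real n)))) \<longlonglongrightarrow> exp (- (\<Sum>u\<in>F. 0))"
      using True by (intro tendsto_intros) auto
    with True show ?thesis by (simp add: \<psi>_def)
  next
    case False
    then obtain u where u: "u \<in> F" "0 \<le> u x" by force
    have "\<psi> n x \<le> exp (- real n)" for n
    proof -
      have "real n \<le> exp (real n)" using exp_ge_add_one_self[of "real n"] by linarith
      also have "\<dots> \<le> exp ((real n)\<^sup>2 * u x + real n)" using u by simp
      also have "\<dots> \<le> (\<Sum>u\<in>F. exp ((real n)\<^sup>2 * u x + real n))"
        using F u by (intro member_le_sum) auto
      finally show ?thesis by (simp add: \<psi>_def)
    qed
    then have "(\<lambda>n. \<psi> n x) \<longlonglongrightarrow> 0"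
      by (intro tendsto_sandwich[OF _ _ tendsto_const exp_lim]) (simp_all add: psi_range)
    with False show ?thesis by auto
  qed
  have meas [measurable]: "\<psi> n \<in> borel_measurable borel" for n
    by (rule bounded_borelD[OF exp_trig_bounded_borel[OF psi]])
  have hm [measurable]: "h \<in> borel_measurable borel" using borel_measurable_integrable[OF h] by simp
  have uset: "{x. \<forall>u\<in>F. u x < 0} \<in> sets borel"
  proof -
    have "u \<in> borel_measurable borel" if "u \<in> F" for u
      using that F by (auto intro: bounded_borelD exp_trig_bounded_borel)
    then have "{x \<in> space borel. \<forall>u\<in>F. u x < 0} \<in> sets borel"
      using F by (intro sets.sets_Collect_finite_All borel_measurable_less) auto
    then show ?thesis by simp
  qed
  have "(\<lambda>n. \<integral>x. h x * \<psi> n x \<partial>torus_measure)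
      \<longlonglongrightarrow> (\<integral>x. h x * indicator {x. \<forall>u\<in>F. u x < 0} x \<partial>torus_measure)"
  proof (rule integral_dominated_convergence)
    show "integrable torus_measure (\<lambda>x. \<bar>h x\<bar>)" using h by simp
    show "AE x in torus_measure. (\<lambda>n. h x * \<psi> n x) \<longlonglongrightarrow> h x * indicator {x. \<forall>u\<in>F. u x < 0} x"
      by (intro AE_I2 tendsto_mult tendsto_const lim)
    show "AE x in torus_measure. norm (h x * \<psi> n x) \<le> \<bar>h x\<bar>" for n
      using psi_range by (intro AE_I2) (auto simp: abs_mult intro!: mult_left_le)
    show "(\<lambda>x. h x * indicator {x. \<forall>u\<in>F. u x < 0} x) \<in> borel_measurable torus_measure"
      using uset by simp
  qed simp
  moreover have "(\<lambda>n. \<integral>x. h x * \<psi> n x \<partial>torus_measure) = (\<lambda>_. 0)" by (simp add: orth psi)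
  ultimately show ?thesis by (simp add: LIMSEQ_const_iff mult.commute)
qed

text \<open>Smooth functions separate integrable functions: orthogonality passes to the indicators of a
generator and from there to all Borel sets by Dynkin's argument.\<close>

lemma AE_zero_of_smooth_orthogonal:
  fixes h :: "'n::finite torus \<Rightarrow> real"
  assumes h: "integrable torus_measure h"
    and orth: "\<And>\<psi>. torus_smooth \<psi> \<Longrightarrow> (\<integral>x. h x * \<psi> x \<partial>torus_measure) = 0"
  shows "AE x in torus_measure. h x = 0"
proof (rule torus_measure.density_zero[OF h])
  have neg: "set_lebesgue_integral torus_measure {x. \<forall>u\<in>F. u x < 0} h = 0" if "finite F" "F \<subseteq> exp_trig" for F
    using integral_negative_set_zero[OF h orth[OF exp_trig_smooth] that] by (simp add: set_lebesgue_integral_def)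
  have total: "(\<integral>x. h x \<partial>torus_measure) = 0"
    using neg[of "{}"] by (simp add: set_lebesgue_integral_def)
  have borel: "sigma_sets UNIV exp_trig_negative_sets \<subseteq> sets (borel :: 'n torus measure)"
  proof -
    have "exp_trig_negative_sets \<subseteq> sets (borel :: 'n torus measure)"
    proof
      fix A :: "'n torus set" assume "A \<in> exp_trig_negative_sets"
      then obtain F where F: "finite F" "F \<subseteq> exp_trig" "A = {x. \<forall>u\<in>F. u x < 0}"
        by (auto simp: exp_trig_negative_sets_def)
      have "u \<in> borel_measurable borel" if "u \<in> F" for u
        using that F by (auto intro: bounded_borelD exp_trig_bounded_borel)
      then have "{x \<in> space borel. \<forall>u\<in>F. u x < 0} \<in> sets borel"
        using F by (intro sets.sets_Collect_finite_All borel_measurable_less) auto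
      then show "A \<in> sets borel" by (simp add: F)
    qed
    then show ?thesis using sets.sigma_sets_subset[of exp_trig_negative_sets "borel :: 'n torus measure"] by simp
  qed
  fix A :: "'n torus set" assume "A \<in> sets torus_measure"
  then have A: "A \<in> sigma_sets UNIV exp_trig_negative_sets" using sets_borel_torus_exp_trig by auto
  have stable: "Int_stable (exp_trig_negative_sets :: 'n torus set set)"
  proof (rule Int_stableI)
    fix A B :: "'n torus set" assume "A \<in> exp_trig_negative_sets" "B \<in> exp_trig_negative_sets"
    then obtain F G where "finite F" "F \<subseteq> exp_trig" "A = {x. \<forall>u\<in>F. u x < 0}"
      "finite G" "G \<subseteq> exp_trig" "B = {x. \<forall>u\<in>G. u x < 0}"
      by (auto simp: exp_trig_negative_sets_def)
    then show "A \<inter> B \<in> exp_trig_negative_sets"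
      unfolding exp_trig_negative_sets_def by (intro CollectI exI[of _ "F \<union> G"]) auto
  qed
  have "exp_trig_negative_sets \<subseteq> Pow (UNIV :: 'n torus set)" by simp
  from stable this A show "set_lebesgue_integral torus_measure A h = 0"
  proof (induction rule: sigma_sets_induct_disjoint)
    case (basic A)
    then show ?case using neg by (auto simp: exp_trig_negative_sets_def)
  next
    case empty then show ?case by (simp add: set_lebesgue_integral_def)
  next
    case (compl A)
    then have [measurable]: "A \<in> sets borel" using borel by auto
    have "set_lebesgue_integral torus_measure (UNIV - A) h = (\<integral>x. h x - indicator A x *\<^sub>R h x \<partial>torus_measure)"
      unfolding set_lebesgue_integral_def by (intro Bochner_Integration.integral_cong refl) (auto simp: indicator_def)
    also have "\<dots> = (\<integral>x. h x \<partial>torus_measure) - set_lebesgue_integral torus_measure A h"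
      unfolding set_lebesgue_integral_def using h by (intro Bochner_Integration.integral_diff integrable_mult_indicator) auto
    finally show ?case using compl total by simp
  next
    case (union A)
    then have A: "A i \<in> sets borel" for i using borel by auto
    have "set_lebesgue_integral torus_measure (\<Union>i. A i) h = (\<Sum>i. set_lebesgue_integral torus_measure (A i) h)"
    proof (rule lebesgue_integral_countable_add)
      show "set_integrable torus_measure (\<Union>i. A i) h"
        unfolding set_integrable_def using A h by (intro integrable_mult_indicator) auto
    qed (use A union in \<open>auto simp: disjoint_family_on_def\<close>)
    with union show ?case by simp
  qed
qed

section \<open>Gaussian averages in the Sobolev space\<close>

text \<open>Symmetry of the average moves it to the test function, integration by parts turns the derivative
of the test function into the odd weight \<open>v $ i\<close>, and the antisymmetry of that
weighted average moves it back.\<close>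

lemma gauss_avg_weak_partial:
  fixes f :: "'n::finite torus \<Rightarrow> real"
  assumes f: "f \<in> bounded_borel" and e: "0 < \<epsilon>"
  shows "is_weak_partial i (gauss_avg \<epsilon> f) (\<lambda>x. gauss_moment (\<lambda>v. v $ i) \<epsilon> f x / \<epsilon>)"
  unfolding is_weak_partial_def
proof (intro allI impI)
  fix \<psi> :: "'n torus \<Rightarrow> real" assume psi: "torus_smooth \<psi>"
  note bb = torus_smooth_bounded_borel[OF psi]
  have w: "integrable gauss (\<lambda>v :: real ^ 'n. v $ i)"
    by (rule integrable_gauss_of_square[OF _ integrable_gauss_square]) measurable
  have "(\<integral>x. gauss_avg \<epsilon> f x * torus_partial i \<psi> x \<partial>torus_measure)
      = (\<integral>x. f x * gauss_avg \<epsilon> (torus_partial i \<psi>) x \<partial>torus_measure)"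
    by (rule gauss_avg_symmetric[OF f bb(2)])
  also have "\<dots> = (\<integral>x. gauss_moment (\<lambda>v. v $ i) \<epsilon> \<psi> x * f x / \<epsilon> \<partial>torus_measure)"
    using e by (simp add: gauss_moment_smooth[OF psi] mult.commute)
  also have "\<dots> = (\<integral>x. \<psi> x * gauss_moment (\<lambda>v. - (v $ i)) \<epsilon> f x \<partial>torus_measure) / \<epsilon>"
    using gauss_moment_adjoint[OF w bb(1) f, of \<epsilon>] by simp
  also have "\<dots> = - (\<integral>x. gauss_moment (\<lambda>v. v $ i) \<epsilon> f x / \<epsilon> * \<psi> x \<partial>torus_measure)"
    by (simp add: gauss_moment_def mult.commute)
  finally show "(\<integral>x. gauss_avg \<epsilon> f x * torus_partial i \<psi> x \<partial>torus_measure)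
    = - (\<integral>x. gauss_moment (\<lambda>v. v $ i) \<epsilon> f x / \<epsilon> * \<psi> x \<partial>torus_measure)" .
qed

lemma bounded_borel_torus_L2: "f \<in> bounded_borel \<Longrightarrow> f \<in> torus_L2"
  using bounded_borelD[of f] by (simp add: torus_L2_def measurable_cong_sets[OF sets_torus_measure refl] integrable_torus_bounded_borel bounded_borel_power2)

lemma torus_L2_integrable:
  assumes "f \<in> torus_L2" shows "integrable torus_measure f"
  by (rule torus_measure.square_integrable_imp_integrable) (use assms in \<open>simp_all add: torus_L2_def\<close>)

lemma integrable_mult_bounded_borel:
  fixes f g :: "'n::finite torus \<Rightarrow> real"
  assumes f: "integrable torus_measure f" and g: "g \<in> bounded_borel"
  shows "integrable torus_measure (\<lambda>x. f x * g x)"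
proof -
  obtain B where "\<And>x. \<bar>g x\<bar> \<le> B" "0 \<le> B" using g by (auto elim!: bounded_borelE)
  moreover have [measurable]: "g \<in> borel_measurable borel" "f \<in> borel_measurable borel"
    using bounded_borelD[OF g] borel_measurable_integrable[OF f] by simp_all
  ultimately show ?thesis
    by (intro Bochner_Integration.integrable_bound[OF integrable_mult_left[OF f, of B]])
       (auto simp: abs_mult intro!: mult_left_mono)
qed

lemma weak_partial_unique:
  fixes f :: "'n::finite torus \<Rightarrow> real"
  assumes g: "g \<in> torus_L2" "is_weak_partial i f g" and h: "h \<in> torus_L2" "is_weak_partial i f h"
  shows "AE x in torus_measure. g x = h x"
proof -
  note int = torus_L2_integrable[OF g(1)] torus_L2_integrable[OF h(1)]
  have "AE x in torus_measure. g x - h x = 0"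
  proof (rule AE_zero_of_smooth_orthogonal)
    show "integrable torus_measure (\<lambda>x. g x - h x)" using int by simp
    fix \<psi> :: "'n torus \<Rightarrow> real" assume psi: "torus_smooth \<psi>"
    then have "(\<integral>x. g x * \<psi> x \<partial>torus_measure) = (\<integral>x. h x * \<psi> x \<partial>torus_measure)"
      using g h by (simp add: is_weak_partial_def)
    then show "(\<integral>x. (g x - h x) * \<psi> x \<partial>torus_measure) = 0"
      using int[THEN integrable_mult_bounded_borel[OF _ torus_smooth_bounded_borel(1)[OF psi]]]
      by (simp add: left_diff_distrib)
  qed
  then show ?thesis by simp
qed

text \<open>The derivative selected by \<open>weak_partial\<close> is an arbitrary choice; uniqueness makes
its energy that of any known weak derivative.\<close>

lemma integral_weak_partial_square:
  fixes f :: "'n::finite torus \<Rightarrow> real"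
  assumes g: "g \<in> torus_L2" "is_weak_partial i f g"
  shows "(\<integral>x. (weak_partial i f x)\<^sup>2 \<partial>torus_measure) = energy g"
proof -
  have wp: "weak_partial i f \<in> torus_L2 \<and> is_weak_partial i f (weak_partial i f)"
    unfolding weak_partial_def by (rule someI[of "\<lambda>g. g \<in> torus_L2 \<and> is_weak_partial i f g" g]) (use g in blast)
  then have "AE x in torus_measure. weak_partial i f x = g x"
    using weak_partial_unique[OF _ _ g] by blast
  then show ?thesis unfolding energy_def
    using wp g by (intro integral_cong_AE) (auto simp: torus_L2_def)
qed

text \<open>Averaging gains one derivative at the price of a factor \<open>1 / \<epsilon>\<close>.\<close>

lemma gauss_avg_H1:
  fixes f :: "'n::finite torus \<Rightarrow> real"
  assumes f: "f \<in> bounded_borel" and e: "0 < \<epsilon>"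
  shows "gauss_avg \<epsilon> f \<in> torus_H1"
    and "(H1_norm (gauss_avg \<epsilon> f))\<^sup>2
      \<le> (1 + (\<Sum>i\<in>UNIV. (\<integral>v. ((v :: real ^ 'n) $ i)\<^sup>2 \<partial>gauss) + 1) / \<epsilon>\<^sup>2) * energy f"
proof -
  let ?g = "\<lambda>i x. gauss_moment (\<lambda>v. v $ i) \<epsilon> f x / \<epsilon>"
  have m: "gauss_moment (\<lambda>v. v $ i) \<epsilon> f \<in> bounded_borel" for i
    by (intro gauss_moment_bounded_borel integrable_gauss_square f) measurable
  have "(\<lambda>_. 1 / \<epsilon>) \<in> bounded_borel" by (intro bounded_borelI[of _ "\<bar>1 / \<epsilon>\<bar>"]) auto
  from bounded_borel_mult[OF m this] have L2: "?g i \<in> torus_L2" for i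
    by (intro bounded_borel_torus_L2) simp
  note wp = gauss_avg_weak_partial[OF f e]
  show "gauss_avg \<epsilon> f \<in> torus_H1"
    using L2 wp bounded_borel_torus_L2[OF gauss_avg_bounded_borel[OF f]] by (auto simp: torus_H1_def)
  have part: "(\<integral>x. (weak_partial i (gauss_avg \<epsilon> f) x)\<^sup>2 \<partial>torus_measure) \<le> ((\<integral>v. ((v :: real ^ 'n) $ i)\<^sup>2 \<partial>gauss) + 1) / \<epsilon>\<^sup>2 * energy f" for i
  proof -
    have "(\<integral>x. (weak_partial i (gauss_avg \<epsilon> f) x)\<^sup>2 \<partial>torus_measure) = energy (?g i)"
      by (rule integral_weak_partial_square[OF L2 wp])
    also have "\<dots> = energy (gauss_moment (\<lambda>v. v $ i) \<epsilon> f) / \<epsilon>\<^sup>2"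
      by (simp add: energy_def power_divide)
    also have "\<dots> \<le> (((\<integral>v. ((v :: real ^ 'n) $ i)\<^sup>2 \<partial>gauss) + 1) * energy f) / \<epsilon>\<^sup>2"
      by (intro divide_right_mono energy_gauss_moment_le integrable_gauss_square f) simp_all
    finally show ?thesis by simp
  qed
  have "(H1_norm (gauss_avg \<epsilon> f))\<^sup>2 = energy (gauss_avg \<epsilon> f) + (\<Sum>i\<in>UNIV. \<integral>x. (weak_partial i (gauss_avg \<epsilon> f) x)\<^sup>2 \<partial>torus_measure)"
    unfolding H1_norm_def energy_def by (intro real_sqrt_pow2 add_nonneg_nonneg sum_nonneg) auto
  also have "\<dots> \<le> energy f + (\<Sum>i\<in>UNIV. ((\<integral>v. ((v :: real ^ 'n) $ i)\<^sup>2 \<partial>gauss) + 1) / \<epsilon>\<^sup>2 * energy f)"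
    by (intro add_mono energy_gauss_avg_le f sum_mono part)
  also have "\<dots> = (1 + (\<Sum>i\<in>UNIV. (\<integral>v. ((v :: real ^ 'n) $ i)\<^sup>2 \<partial>gauss) + 1) / \<epsilon>\<^sup>2) * energy f"
    by (simp add: distrib_right sum_distrib_right sum_divide_distrib)
  finally show "(H1_norm (gauss_avg \<epsilon> f))\<^sup>2
      \<le> (1 + (\<Sum>i\<in>UNIV. (\<integral>v. ((v :: real ^ 'n) $ i)\<^sup>2 \<partial>gauss) + 1) / \<epsilon>\<^sup>2) * energy f" .
qed

section \<open>Dissipation by the Markov operator\<close>

definition markov_op :: "('n::finite torus \<Rightarrow> 'n torus) \<Rightarrow> real \<Rightarrow> ('n torus \<Rightarrow> real) \<Rightarrow> 'n torus \<Rightarrow> real"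
  where "markov_op \<phi> \<epsilon> f x = gauss_avg \<epsilon> f (\<phi> x)"

lemma torus_measure_preserving_measurable:
  assumes "torus_measure_preserving \<phi>"
  shows "(\<phi> :: 'n::finite torus \<Rightarrow> 'n torus) \<in> borel_measurable borel"
proof -
  have "\<phi> \<in> measurable torus_measure torus_measure"
    using assms by (simp add: torus_measure_preserving_def)
  then show ?thesis by (simp cong: measurable_cong_sets)
qed

lemma integral_measure_preserving:
  fixes f :: "'n::finite torus \<Rightarrow> real"
  assumes "torus_measure_preserving \<phi>" and f: "f \<in> borel_measurable borel"
  shows "(\<integral>x. f (\<phi> x) \<partial>torus_measure) = (\<integral>x. f x \<partial>torus_measure)"
proof -
  have "distr torus_measure torus_measure \<phi> = torus_measure" "\<phi> \<in> measurable torus_measure torus_measure"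
    using assms by (auto simp: torus_measure_preserving_def)
  then show ?thesis using f integral_distr[of \<phi> torus_measure torus_measure f]
    by (simp cong: measurable_cong_sets)
qed

lemma funpow_measurable:
  fixes \<phi> :: "'a::topological_space \<Rightarrow> 'a"
  assumes "\<phi> \<in> borel_measurable borel"
  shows "(\<phi> ^^ n) \<in> borel_measurable borel"
proof (induction n)
  case (Suc n)
  from measurable_compose[OF this assms] show ?case by (simp add: comp_def)
qed (simp add: id_def)

lemma integral_measure_preserving_funpow:
  fixes f :: "'n::finite torus \<Rightarrow> real"
  assumes mp: "torus_measure_preserving \<phi>" and f: "f \<in> borel_measurable borel"
  shows "(\<integral>x. f ((\<phi> ^^ n) x) \<partial>torus_measure) = (\<integral>x. f x \<partial>torus_measure)"
proof (induction n)
  case (Suc n)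
  have "(\<lambda>x. f ((\<phi> ^^ n) x)) \<in> borel_measurable borel"
    using measurable_compose[OF funpow_measurable[OF torus_measure_preserving_measurable[OF mp]] f] .
  from integral_measure_preserving[OF mp this] show ?case
    using Suc by (simp add: funpow_swap1)
qed simp

context
  fixes \<phi> :: "'n::finite torus \<Rightarrow> 'n torus"
  assumes mp: "torus_measure_preserving \<phi>"
begin

lemma markov_op_bounded_borel: "f \<in> bounded_borel \<Longrightarrow> markov_op \<phi> \<epsilon> f \<in> bounded_borel"
  unfolding markov_op_def[abs_def]
  by (rule bounded_borel_compose[OF gauss_avg_bounded_borel torus_measure_preserving_measurable[OF mp]])

lemma markov_op_funpow_bounded_borel: "f \<in> bounded_borel \<Longrightarrow> (markov_op \<phi> \<epsilon> ^^ n) f \<in> bounded_borel"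
  by (induction n) (auto intro: markov_op_bounded_borel)

lemma integral_markov_op:
  assumes "f \<in> bounded_borel"
  shows "(\<integral>x. markov_op \<phi> \<epsilon> f x \<partial>torus_measure) = (\<integral>x. f x \<partial>torus_measure)"
  unfolding markov_op_def
  using integral_measure_preserving[OF mp bounded_borelD[OF gauss_avg_bounded_borel[OF assms]], of \<epsilon>]
  by (simp add: integral_gauss_avg[OF assms])

lemma integral_markov_op_funpow:
  assumes "f \<in> bounded_borel"
  shows "(\<integral>x. (markov_op \<phi> \<epsilon> ^^ n) f x \<partial>torus_measure) = (\<integral>x. f x \<partial>torus_measure)"
  by (induction n) (auto simp: integral_markov_op markov_op_funpow_bounded_borel assms)

lemma energy_markov_op:
  assumes "f \<in> bounded_borel"
  shows "energy (markov_op \<phi> \<epsilon> f) = energy (gauss_avg \<epsilon> f)"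
  unfolding markov_op_def energy_def
  by (rule integral_measure_preserving[OF mp bounded_borelD[OF bounded_borel_power2[OF gauss_avg_bounded_borel[OF assms]]]])

lemma energy_markov_op_le:
  assumes "f \<in> bounded_borel"
  shows "energy (markov_op \<phi> \<epsilon> f) \<le> energy f"
  using energy_gauss_avg_le[OF assms] energy_markov_op[OF assms] by simp

lemma energy_markov_op_funpow_le:
  assumes "f \<in> bounded_borel"
  shows "energy ((markov_op \<phi> \<epsilon> ^^ n) f) \<le> energy f"
proof (induction n)
  case (Suc n)
  then show ?case using energy_markov_op_le[OF markov_op_funpow_bounded_borel[OF assms, of n \<epsilon>], of \<epsilon>] by simp
qed simp

text \<open>The noisy and the deterministic evolution of \<open>K f\<close> differ by the defects \<open>K
T\<^sup>j f - T\<^sup>j f\<close> of the intermediate states, each transported by the dynamics.\<close>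

lemma gauss_avg_markov_telescope:
  "gauss_avg \<epsilon> ((markov_op \<phi> \<epsilon> ^^ N) f) x - gauss_avg \<epsilon> f ((\<phi> ^^ N) x)
    = (\<Sum>j = 1..N. gauss_avg \<epsilon> ((markov_op \<phi> \<epsilon> ^^ j) f) ((\<phi> ^^ (N - j)) x)
        - (markov_op \<phi> \<epsilon> ^^ j) f ((\<phi> ^^ (N - j)) x))"
proof (induction N arbitrary: x)
  case (Suc N)
  let ?t = "\<lambda>j. (markov_op \<phi> \<epsilon> ^^ j) f"
  have phi: "(\<phi> ^^ Suc k) x = (\<phi> ^^ k) (\<phi> x)" for k by (simp add: funpow_swap1)
  have "?t (Suc N) x = gauss_avg \<epsilon> (?t N) (\<phi> x)" by (simp add: markov_op_def)
  then have "gauss_avg \<epsilon> (?t (Suc N)) x - gauss_avg \<epsilon> f ((\<phi> ^^ Suc N) x)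
      = (gauss_avg \<epsilon> (?t (Suc N)) x - ?t (Suc N) x)
        + (gauss_avg \<epsilon> (?t N) (\<phi> x) - gauss_avg \<epsilon> f ((\<phi> ^^ N) (\<phi> x)))"
    unfolding phi by linarith
  also have "gauss_avg \<epsilon> (?t N) (\<phi> x) - gauss_avg \<epsilon> f ((\<phi> ^^ N) (\<phi> x))
      = (\<Sum>j = 1..N. gauss_avg \<epsilon> (?t j) ((\<phi> ^^ (Suc N - j)) x) - ?t j ((\<phi> ^^ (Suc N - j)) x))"
    unfolding Suc.IH
  proof (rule sum.cong[OF refl])
    fix j assume "j \<in> {1..N}"
    then have "(\<phi> ^^ (Suc N - j)) x = (\<phi> ^^ (N - j)) (\<phi> x)"
      using phi[of "N - j"] by (simp only: Suc_diff_le atLeastAtMost_iff)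
    then show "gauss_avg \<epsilon> (?t j) ((\<phi> ^^ (N - j)) (\<phi> x)) - ?t j ((\<phi> ^^ (N - j)) (\<phi> x))
        = gauss_avg \<epsilon> (?t j) ((\<phi> ^^ (Suc N - j)) x) - ?t j ((\<phi> ^^ (Suc N - j)) x)"
      by (simp only:)
  qed
  finally show ?case by simp
qed simp

text \<open>Put \<open>w = K T\<^sup>N h\<close> and \<open>u = K h \<circ> \<phi>\<^sup>N\<close>. By
telescoping and the energy inequality for each defect, \<open>\<parallel>w -
u\<parallel>\<^sup>2\<close> is at most \<open>N\<close> times the energy lost in \<open>N +
1\<close> steps. If \<open>w\<close> and \<open>u\<close> are decorrelated, \<open>\<parallel>w
- u\<parallel>\<^sup>2\<close> is at least twice the remaining energy minus the initial one.
Both can hold only if a fraction of order \<open>1 / N\<close> of the energy is lost.\<close>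

lemma energy_decay_of_decorrelation:
  assumes h: "h \<in> bounded_borel"
    and corr: "(\<integral>x. gauss_avg \<epsilon> h ((\<phi> ^^ N) x) * gauss_avg \<epsilon> ((markov_op \<phi> \<epsilon> ^^ N) h) x \<partial>torus_measure) \<le> energy h / 2"
  shows "energy ((markov_op \<phi> \<epsilon> ^^ Suc N) h) \<le> (1 - 1 / (real N + 2)) * energy h"
proof -
  let ?t = "\<lambda>j. (markov_op \<phi> \<epsilon> ^^ j) h"
  let ?K = "gauss_avg \<epsilon>"
  let ?D = "\<lambda>j x. ?K (?t j) x - ?t j x"
  let ?w = "?K (?t N)" and ?u = "\<lambda>x. ?K h ((\<phi> ^^ N) x)"
  note pow = funpow_measurable[OF torus_measure_preserving_measurable[OF mp]]
  have t: "?t j \<in> bounded_borel" for j by (rule markov_op_funpow_bounded_borel[OF h])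
  have D: "?D j \<in> bounded_borel" for j by (intro bounded_borel_diff gauss_avg_bounded_borel t)
  have w: "?w \<in> bounded_borel" by (intro gauss_avg_bounded_borel t)
  have u: "?u \<in> bounded_borel" by (intro bounded_borel_compose[OF _ pow] gauss_avg_bounded_borel h)
  have w_energy: "energy ?w = energy (?t (Suc N))" using energy_markov_op[OF t] by simp
  have u_energy: "energy ?u = energy (?t 1)"
    using integral_measure_preserving_funpow[OF mp bounded_borelD[OF bounded_borel_power2[OF gauss_avg_bounded_borel[OF h]]]]
      energy_markov_op[OF h] by (simp add: energy_def)
  have dec: "energy (?t (Suc j)) \<le> energy (?t j)" for j
    using energy_markov_op_le[OF t] by simp
  have mono: "energy (?t (Suc j)) \<le> energy (?t 1)" for j
  proof (induction j)
    case (Suc j) then show ?case using dec[of "Suc j"] by linarith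
  qed simp
  have Dj: "(\<integral>x. (?D j ((\<phi> ^^ (N - j)) x))\<^sup>2 \<partial>torus_measure) \<le> energy (?t j) - energy (?t (Suc j))" for j
    using integral_measure_preserving_funpow[OF mp bounded_borelD[OF bounded_borel_power2[OF D[of j]]], of "N - j"]
      energy_gauss_avg_defect[OF t[of j], of \<epsilon>] energy_markov_op[OF t[of j], of \<epsilon>]
    by (simp add: energy_def)
  have Dint: "integrable torus_measure (\<lambda>x. (?D j ((\<phi> ^^ (N - j)) x))\<^sup>2)" for j
    by (intro integrable_torus_bounded_borel bounded_borel_power2 bounded_borel_compose[OF D pow])
  have "energy (\<lambda>x. ?w x - ?u x) = (\<integral>x. (\<Sum>j = 1..N. ?D j ((\<phi> ^^ (N - j)) x))\<^sup>2 \<partial>torus_measure)"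
    by (simp only: energy_def gauss_avg_markov_telescope)
  also have "\<dots> \<le> (\<integral>x. real N * (\<Sum>j = 1..N. (?D j ((\<phi> ^^ (N - j)) x))\<^sup>2) \<partial>torus_measure)"
  proof (rule integral_mono)
    have "integrable torus_measure (\<lambda>x. (?w x - ?u x)\<^sup>2)"
      by (intro integrable_torus_bounded_borel bounded_borel_power2 bounded_borel_diff w u)
    then show "integrable torus_measure (\<lambda>x. (\<Sum>j = 1..N. ?D j ((\<phi> ^^ (N - j)) x))\<^sup>2)"
      by (simp only: gauss_avg_markov_telescope)
    show "integrable torus_measure (\<lambda>x. real N * (\<Sum>j = 1..N. (?D j ((\<phi> ^^ (N - j)) x))\<^sup>2))"
      using Dint by (intro integrable_mult_right Bochner_Integration.integrable_sum)
    show "(\<Sum>j = 1..N. ?D j ((\<phi> ^^ (N - j)) x))\<^sup>2 \<le> real N * (\<Sum>j = 1..N. (?D j ((\<phi> ^^ (N - j)) x))\<^sup>2)" for x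
      using sum_squared_le_sum_of_squares[of "\<lambda>j. ?D j ((\<phi> ^^ (N - j)) x)" "{1..N}"] by (simp add: mult.commute)
  qed
  also have "\<dots> = real N * (\<Sum>j = 1..N. (\<integral>x. (?D j ((\<phi> ^^ (N - j)) x))\<^sup>2 \<partial>torus_measure))"
    using Dint by (simp only: integral_mult_right_zero Bochner_Integration.integral_sum)
  also have "\<dots> \<le> real N * (\<Sum>j = 1..N. energy (?t j) - energy (?t (Suc j)))"
    by (intro mult_left_mono sum_mono Dj) simp
  also have "(\<Sum>j = 1..N. energy (?t j) - energy (?t (Suc j))) = energy (?t 1) - energy (?t (Suc N))"
  proof (induction N)
    case (Suc N) then show ?case by simp
  qed simp
  also have "real N * (energy (?t 1) - energy (?t (Suc N))) \<le> real N * (energy h - energy (?t (Suc N)))"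
    using dec[of 0] by (intro mult_left_mono) auto
  finally have 1: "energy (\<lambda>x. ?w x - ?u x) \<le> real N * (energy h - energy (?t (Suc N)))" .
  have "energy (\<lambda>x. ?w x - ?u x) = (\<integral>x. (?w x)\<^sup>2 + (?u x)\<^sup>2 - 2 * (?u x * ?w x) \<partial>torus_measure)"
    unfolding energy_def by (intro Bochner_Integration.integral_cong refl) (simp add: power2_diff mult.commute)
  also have "\<dots> = energy ?w + energy ?u - 2 * (\<integral>x. ?u x * ?w x \<partial>torus_measure)"
    using integrable_torus_bounded_borel[OF bounded_borel_power2[OF w]]
      integrable_torus_bounded_borel[OF bounded_borel_power2[OF u]]
      integrable_torus_bounded_borel[OF bounded_borel_mult[OF u w]]
    by (simp add: energy_def)
  finally have 2: "energy (\<lambda>x. ?w x - ?u x) \<ge> 2 * energy (?t (Suc N)) - energy h"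
    using corr mono[of N] w_energy u_energy by linarith
  from 1 2 have "(real N + 2) * energy (?t (Suc N)) \<le> (real N + 1) * energy h"
    by (simp add: algebra_simps)
  then have "energy (?t (Suc N)) \<le> (real N + 1) * energy h / (real N + 2)"
    by (simp add: pos_le_divide_eq mult.commute)
  also have "\<dots> = (1 - 1 / (real N + 2)) * energy h" by (simp add: field_simps)
  finally show ?thesis .
qed

lemma energy_decay_iterate:
  assumes step: "\<And>h. h \<in> bounded_borel \<Longrightarrow> (\<integral>x. h x \<partial>torus_measure) = 0 \<Longrightarrow>
      energy ((markov_op \<phi> \<epsilon> ^^ n) h) \<le> r * energy h"
    and "0 \<le> r" and h: "h \<in> bounded_borel" "(\<integral>x. h x \<partial>torus_measure) = 0"
  shows "energy ((markov_op \<phi> \<epsilon> ^^ (k * n)) h) \<le> r ^ k * energy h"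
proof (induction k)
  case (Suc k)
  have "energy ((markov_op \<phi> \<epsilon> ^^ (Suc k * n)) h) = energy ((markov_op \<phi> \<epsilon> ^^ n) ((markov_op \<phi> \<epsilon> ^^ (k * n)) h))"
    by (simp add: funpow_add)
  also have "\<dots> \<le> r * energy ((markov_op \<phi> \<epsilon> ^^ (k * n)) h)"
    by (rule step) (simp_all add: markov_op_funpow_bounded_borel integral_markov_op_funpow h)
  also have "\<dots> \<le> r * (r ^ k * energy h)" by (intro mult_left_mono Suc \<open>0 \<le> r\<close>)
  finally show ?case by (simp add: mult_ac)
qed simp

end

section \<open>Law of the process\<close>

lemma gaussian_noise_prob_space:
  assumes "0 < \<epsilon>" "\<epsilon> \<le> 1" shows "prob_space (gaussian_noise \<epsilon> :: 'n::finite torus measure)"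
  unfolding gaussian_noise_eq_distr[OF assms] by (rule gauss.prob_space_distr) measurable

lemma sets_gaussian_noise [simp]: "sets (gaussian_noise \<epsilon>) = sets borel"
  by (simp add: gaussian_noise_def)

lemma space_gaussian_noise [simp]: "space (gaussian_noise \<epsilon>) = UNIV"
  by (simp add: gaussian_noise_def)

lemma integral_gaussian_noise:
  fixes f :: "'n::finite torus \<Rightarrow> real"
  assumes "0 < \<epsilon>" "\<epsilon> \<le> 1" and [measurable]: "f \<in> borel_measurable borel"
  shows "(\<integral>y. f (x + y) \<partial>gaussian_noise \<epsilon>) = gauss_avg \<epsilon> f x"
  unfolding gaussian_noise_eq_distr[OF assms(1,2)] gauss_avg_def by (subst integral_distr) auto

lemma process_measurable:
  assumes [measurable]: "\<phi> \<in> borel_measurable borel" and "sets M = sets borel" and K: "sets \<kappa> = sets borel"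
  shows "(\<lambda>(x, \<xi>). process \<phi> x \<xi> n) \<in> borel_measurable (M \<Otimes>\<^sub>M (\<Pi>\<^sub>M k\<in>(UNIV :: nat set). (\<kappa> :: 'n::finite torus measure)))"
proof -
  have M: "measurable M borel = measurable borel borel" by (rule measurable_cong_sets) (simp_all add: assms)
  have fst: "fst \<in> borel_measurable (M \<Otimes>\<^sub>M (\<Pi>\<^sub>M k\<in>(UNIV :: nat set). \<kappa>))"
    using measurable_fst[of M "\<Pi>\<^sub>M k\<in>(UNIV :: nat set). \<kappa>"] by (simp add: measurable_cong_sets[OF refl assms(2)])
  have comp: "(\<lambda>p. snd p k) \<in> borel_measurable (M \<Otimes>\<^sub>M (\<Pi>\<^sub>M k\<in>(UNIV :: nat set). \<kappa>))" for k
  proof -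
    have "(\<lambda>p. snd p k) \<in> measurable (M \<Otimes>\<^sub>M (\<Pi>\<^sub>M k\<in>(UNIV :: nat set). \<kappa>)) \<kappa>"
      by (rule measurable_compose[OF measurable_snd measurable_component_singleton]) simp
    then show ?thesis by (simp add: measurable_cong_sets[OF refl K])
  qed
  show ?thesis
  proof (induction n)
    case 0 then show ?case using fst by (simp add: split_beta')
  next
    case (Suc n)
    then have [measurable]: "(\<lambda>p. process \<phi> (fst p) (snd p) n) \<in> borel_measurable (M \<Otimes>\<^sub>M (\<Pi>\<^sub>M k\<in>(UNIV :: nat set). \<kappa>))"
      by (simp add: split_beta')
    note [measurable] = comp
    show ?case by (simp add: split_beta')
  qed
qed

lemma process_measurable_noise:
  assumes [measurable]: "\<phi> \<in> borel_measurable borel" and K: "sets \<kappa> = sets borel"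
  shows "(\<lambda>\<xi>. process \<phi> x \<xi> n) \<in> borel_measurable (\<Pi>\<^sub>M k\<in>(UNIV :: nat set). (\<kappa> :: 'n::finite torus measure))"
proof -
  let ?S = "\<Pi>\<^sub>M k\<in>(UNIV :: nat set). \<kappa>"
  have "(\<lambda>\<xi>. (x, \<xi>)) \<in> measurable ?S (borel \<Otimes>\<^sub>M ?S)" by (rule measurable_Pair1') simp
  from measurable_compose[OF this process_measurable[OF assms(1) refl K]] show ?thesis by simp
qed

lemma process_case_nat: "process \<phi> x (case_nat s \<omega>) (Suc n) = process \<phi> (\<phi> x + s) \<omega> n"
  by (induction n) auto

text \<open>Splitting off the first increment restarts the process at \<open>\<phi> x + s\<close> with a
fresh noise sequence, which is the Markov property.\<close>

lemma integral_process:
  fixes f :: "'n::finite torus \<Rightarrow> real"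
  assumes mp: "torus_measure_preserving \<phi>" and e: "0 < \<epsilon>" "\<epsilon> \<le> 1" and f: "f \<in> bounded_borel"
  shows "(\<integral>\<xi>. f (process \<phi> x \<xi> n) \<partial>(\<Pi>\<^sub>M k\<in>(UNIV :: nat set). gaussian_noise \<epsilon>)) = (markov_op \<phi> \<epsilon> ^^ n) f x"
proof -
  interpret K: prob_space "gaussian_noise \<epsilon> :: 'n torus measure" by (rule gaussian_noise_prob_space[OF e])
  interpret sequence_space "gaussian_noise \<epsilon> :: 'n torus measure" by standard
  interpret KS: pair_prob_space "gaussian_noise \<epsilon> :: 'n torus measure" S by standard
  note phi = torus_measure_preserving_measurable[OF mp]
  have f_meas: "f \<in> borel_measurable borel" by (rule bounded_borelD[OF f])
  show ?thesis
  proof (induction n arbitrary: x)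
    case 0
    then show ?case using P.prob_space by simp
  next
    case (Suc n)
    let ?g = "\<lambda>(s, \<omega>). f (process \<phi> (\<phi> x + s) \<omega> n)"
    have shift: "(\<lambda>(s, \<omega>). process \<phi> (\<phi> x + s) \<omega> n) \<in> borel_measurable (gaussian_noise \<epsilon> \<Otimes>\<^sub>M S)"
    proof -
      have [measurable]: "(\<lambda>p. \<phi> x + fst p) \<in> borel_measurable (gaussian_noise \<epsilon> \<Otimes>\<^sub>M S)"
        by (intro torus_add_measurable measurable_const measurable_compose[OF measurable_fst]) (auto simp: measurable_cong_sets[OF sets_gaussian_noise refl])
      have "(\<lambda>p. (\<phi> x + fst p, snd p)) \<in> measurable (gaussian_noise \<epsilon> \<Otimes>\<^sub>M S) (borel \<Otimes>\<^sub>M S)"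
        by measurable
      from measurable_compose[OF this process_measurable[OF phi refl, of "gaussian_noise \<epsilon>" n]]
      show ?thesis by (simp add: split_beta')
    qed
    have g: "integrable (gaussian_noise \<epsilon> \<Otimes>\<^sub>M S) ?g"
      using KS.integrable_bounded_borel[OF f shift] by (simp add: split_beta')
    have "(\<integral>\<xi>. f (process \<phi> x \<xi> (Suc n)) \<partial>S)
        = (\<integral>\<xi>. f (process \<phi> x \<xi> (Suc n)) \<partial>distr (gaussian_noise \<epsilon> \<Otimes>\<^sub>M S) S (\<lambda>(s, \<omega>). case_nat s \<omega>))"
      by (simp only: PiM_iter)
    also have "\<dots> = (\<integral>p. ?g p \<partial>(gaussian_noise \<epsilon> \<Otimes>\<^sub>M S))"
    proof (subst integral_distr)
      show "(\<lambda>(s, \<omega>). case_nat s \<omega>) \<in> measurable (gaussian_noise \<epsilon> \<Otimes>\<^sub>M S) S" by measurable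
      show "(\<lambda>\<xi>. f (process \<phi> x \<xi> (Suc n))) \<in> borel_measurable S"
        by (rule measurable_compose[OF process_measurable_noise[OF phi] f_meas]) simp
    qed (simp add: split_beta' process_case_nat del: process.simps)
    also have "\<dots> = (\<integral>s. \<integral>\<omega>. f (process \<phi> (\<phi> x + s) \<omega> n) \<partial>S \<partial>gaussian_noise \<epsilon>)"
      using KS.integral_fst'[OF g] by simp
    also have "\<dots> = (\<integral>s. (markov_op \<phi> \<epsilon> ^^ n) f (\<phi> x + s) \<partial>gaussian_noise \<epsilon>)"
      by (simp only: Suc.IH)
    also have "\<dots> = (markov_op \<phi> \<epsilon> ^^ Suc n) f x"
      by (subst integral_gaussian_noise[OF e])
        (simp_all add: markov_op_def bounded_borelD markov_op_funpow_bounded_borel[OF mp f])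
    finally show ?case .
  qed
qed

lemma process_law_integral:
  fixes f :: "'n::finite torus \<Rightarrow> real"
  assumes mp: "torus_measure_preserving \<phi>" and e: "0 < \<epsilon>" "\<epsilon> \<le> 1" and f: "f \<in> bounded_borel"
    and mu: "prob_space \<mu>" "sets \<mu> = sets borel"
  shows "(\<integral>x. f x \<partial>process_law \<phi> (gaussian_noise \<epsilon>) \<mu> n) = (\<integral>x. (markov_op \<phi> \<epsilon> ^^ n) f x \<partial>\<mu>)"
proof -
  interpret K: prob_space "gaussian_noise \<epsilon> :: 'n torus measure" by (rule gaussian_noise_prob_space[OF e])
  interpret sequence_space "gaussian_noise \<epsilon> :: 'n torus measure" by standard
  interpret mu: prob_space \<mu> by (rule mu)
  interpret MS: pair_prob_space \<mu> S by standard
  note phi = torus_measure_preserving_measurable[OF mp]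
  have pm: "(\<lambda>(x, \<xi>). process \<phi> x \<xi> n) \<in> borel_measurable (\<mu> \<Otimes>\<^sub>M S)"
    by (rule process_measurable[OF phi mu(2)]) simp
  have g: "integrable (\<mu> \<Otimes>\<^sub>M S) (\<lambda>(x, \<xi>). f (process \<phi> x \<xi> n))"
    using MS.integrable_bounded_borel[OF f pm] by (simp add: split_beta')
  have "(\<integral>x. f x \<partial>process_law \<phi> (gaussian_noise \<epsilon>) \<mu> n) = (\<integral>p. (case p of (x, \<xi>) \<Rightarrow> f (process \<phi> x \<xi> n)) \<partial>(\<mu> \<Otimes>\<^sub>M S))"
    unfolding process_law_def by (subst integral_distr[OF pm bounded_borelD[OF f]]) (simp add: split_beta')
  also have "\<dots> = (\<integral>x. \<integral>\<xi>. f (process \<phi> x \<xi> n) \<partial>S \<partial>\<mu>)"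
    using MS.integral_fst'[OF g] by simp
  finally show ?thesis by (simp only: integral_process[OF mp e f])
qed

lemma tv_dist_process_law_le:
  fixes \<phi> :: "'n::finite torus \<Rightarrow> 'n torus"
  assumes mp: "torus_measure_preserving \<phi>" and e: "0 < \<epsilon>" "\<epsilon> \<le> 1"
    and mu: "prob_space \<mu>" "sets \<mu> = sets borel"
    and bound: "\<And>f x. f \<in> bounded_borel \<Longrightarrow> (\<integral>x. f x \<partial>torus_measure) = 0 \<Longrightarrow> (\<And>x. \<bar>f x\<bar> \<le> 1) \<Longrightarrow>
      \<bar>(markov_op \<phi> \<epsilon> ^^ n) f x\<bar> \<le> \<delta>"
  shows "tv_dist (process_law \<phi> (gaussian_noise \<epsilon>) \<mu> n) torus_measure \<le> \<delta>"
  unfolding tv_dist_def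
proof (rule cSUP_least)
  show "sets (process_law \<phi> (gaussian_noise \<epsilon>) \<mu> n) \<noteq> {}" by (auto simp: process_law_def)
  interpret mu: prob_space \<mu> by (rule mu)
  interpret K: prob_space "gaussian_noise \<epsilon> :: 'n torus measure" by (rule gaussian_noise_prob_space[OF e])
  interpret sequence_space "gaussian_noise \<epsilon> :: 'n torus measure" by standard
  interpret MS: pair_prob_space \<mu> S by standard
  let ?L = "process_law \<phi> (gaussian_noise \<epsilon>) \<mu> n"
  interpret L: prob_space ?L
    unfolding process_law_def
    by (rule MS.prob_space_distr[OF process_measurable[OF torus_measure_preserving_measurable[OF mp] mu(2)]]) simp
  have L: "sets ?L = sets borel" "space ?L = UNIV" by (simp_all add: process_law_def)
  fix A assume "A \<in> sets ?L"
  then have A [measurable]: "A \<in> sets borel" by (simp add: L)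
  define c where "c = measure torus_measure A"
  define f where "f x = indicator A x - c" for x :: "'n torus"
  have c: "0 \<le> c" "c \<le> 1" by (simp_all add: c_def)
  have fb: "\<bar>f x\<bar> \<le> 1" for x using c by (auto simp: f_def indicator_def)
  have fm: "f \<in> borel_measurable borel" unfolding f_def[abs_def] by measurable
  have f: "f \<in> bounded_borel" using fm fb by (rule bounded_borelI)
  have ind: "(indicator A :: 'n torus \<Rightarrow> real) \<in> bounded_borel" by (intro bounded_borelI[of _ 1]) auto
  have "(\<integral>x. f x \<partial>torus_measure) = 0"
    using torus_measure.prob_space[where 'n='n] integrable_torus_bounded_borel[OF ind] by (simp add: f_def c_def)
  note bnd = bound[OF f this fb]
  have "measure ?L A - measure torus_measure A = (\<integral>x. f x \<partial>?L)"
    using L.prob_space A L L.integrable_bounded_borel[OF ind, of "\<lambda>x. x", simplified] by (simp add: f_def c_def)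
  also have "\<dots> = (\<integral>x. (markov_op \<phi> \<epsilon> ^^ n) f x \<partial>\<mu>)"
    by (rule process_law_integral[OF mp e f mu])
  also have "\<bar>\<dots>\<bar> \<le> (\<integral>x. \<bar>(markov_op \<phi> \<epsilon> ^^ n) f x\<bar> \<partial>\<mu>)" by (rule integral_abs_bound)
  also have "\<dots> \<le> \<delta>"
  proof (rule mu.integral_le_const)
    have "integrable \<mu> (\<lambda>x. (markov_op \<phi> \<epsilon> ^^ n) f x)"
      by (rule mu.integrable_bounded_borel[OF markov_op_funpow_bounded_borel[OF mp f], of "\<lambda>x. x", simplified])
         (simp add: measurable_cong_sets[OF mu(2) refl])
    then show "integrable \<mu> (\<lambda>x. \<bar>(markov_op \<phi> \<epsilon> ^^ n) f x\<bar>)" by simp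
  qed (simp add: bnd)
  finally show "\<bar>measure ?L A - measure torus_measure A\<bar> \<le> \<delta>" .
qed

section \<open>The mixing time\<close>

lemma H1_norm_nonneg: "0 \<le> H1_norm f"
proof -
  have "0 \<le> (\<integral>x. (f x)\<^sup>2 \<partial>torus_measure)" by simp
  moreover have "0 \<le> (\<Sum>i\<in>UNIV. \<integral>x. (weak_partial i f x)\<^sup>2 \<partial>torus_measure)"
    by (rule sum_nonneg) simp
  ultimately show ?thesis unfolding H1_norm_def by (intro real_sqrt_ge_zero add_nonneg_nonneg)
qed

text \<open>The mixing hypothesis applied to smoothed observables, with the product of the two Sobolev norms
bounded by the mean of their squares and these by the energies.\<close>

lemma correlation_of_smoothed_le:
  fixes \<phi> :: "'n::finite torus \<Rightarrow> 'n torus"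
  assumes mp: "torus_measure_preserving \<phi>" and mix: "exponentially_mixing \<phi>"
  obtains M \<gamma> :: real where "0 < M" "0 < \<gamma>"
    "\<And>\<epsilon> f g N. 0 < \<epsilon> \<Longrightarrow> \<epsilon> \<le> 1 \<Longrightarrow> f \<in> bounded_borel \<Longrightarrow> g \<in> bounded_borel \<Longrightarrow>
      (\<integral>x. f x \<partial>torus_measure) = 0 \<Longrightarrow> (\<integral>x. g x \<partial>torus_measure) = 0 \<Longrightarrow>
      (\<integral>x. gauss_avg \<epsilon> f ((\<phi> ^^ N) x) * gauss_avg \<epsilon> g x \<partial>torus_measure)
        \<le> M * exp (- \<gamma> * real N) / \<epsilon>\<^sup>2 * ((energy f + energy g) / 2)"
proof -
  obtain D \<gamma> :: real where \<gamma>: "\<gamma> > 0" and mixing: "\<forall>f\<in>torus_H1. \<forall>g\<in>torus_H1.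
      (\<integral>x. f x \<partial>torus_measure) = 0 \<longrightarrow> (\<integral>x. g x \<partial>torus_measure) = 0 \<longrightarrow>
      (\<forall>n::nat. \<bar>\<integral>x. f ((\<phi> ^^ n) x) * g x \<partial>torus_measure\<bar> \<le> D * exp (- \<gamma> * real n) * H1_norm f * H1_norm g)"
    using mix unfolding exponentially_mixing_def by (elim exE conjE)
  define A where "A = (\<Sum>i\<in>UNIV. (\<integral>v. ((v :: real ^ 'n) $ i)\<^sup>2 \<partial>gauss) + 1)"
  have A: "0 \<le> A" unfolding A_def by (intro sum_nonneg add_nonneg_nonneg) auto
  define M where "M = (\<bar>D\<bar> + 1) * (1 + A)"
  have "0 < M" using A by (simp add: M_def add_pos_nonneg)
  then show thesis
  proof (rule that[OF _ \<gamma>])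
    fix \<epsilon> :: real and f g :: "'n torus \<Rightarrow> real" and N
    assume e: "0 < \<epsilon>" "\<epsilon> \<le> 1" and f: "f \<in> bounded_borel" and g: "g \<in> bounded_borel"
      and f0: "(\<integral>x. f x \<partial>torus_measure) = 0" and g0: "(\<integral>x. g x \<partial>torus_measure) = 0"
    have H: "(H1_norm (gauss_avg \<epsilon> h))\<^sup>2 \<le> (1 + A) / \<epsilon>\<^sup>2 * energy h" if "h \<in> bounded_borel" for h :: "'n torus \<Rightarrow> real"
    proof -
      have "\<epsilon>\<^sup>2 \<le> 1" using e by (simp add: power_le_one)
      then have "1 + A / \<epsilon>\<^sup>2 \<le> (1 + A) / \<epsilon>\<^sup>2" using e by (simp add: add_divide_distrib)
      then have "(1 + A / \<epsilon>\<^sup>2) * energy h \<le> (1 + A) / \<epsilon>\<^sup>2 * energy h"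
        by (intro mult_right_mono energy_nonneg)
      with gauss_avg_H1(2)[OF that e(1)] show ?thesis by (simp add: A_def)
    qed
    let ?Hf = "H1_norm (gauss_avg \<epsilon> f)" and ?Hg = "H1_norm (gauss_avg \<epsilon> g)"
    have "(\<integral>x. gauss_avg \<epsilon> f ((\<phi> ^^ N) x) * gauss_avg \<epsilon> g x \<partial>torus_measure)
        \<le> D * exp (- \<gamma> * real N) * ?Hf * ?Hg"
    proof -
      have "\<bar>\<integral>x. gauss_avg \<epsilon> f ((\<phi> ^^ N) x) * gauss_avg \<epsilon> g x \<partial>torus_measure\<bar>
          \<le> D * exp (- \<gamma> * real N) * ?Hf * ?Hg"
        by (rule mixing[rule_format])
           (simp_all add: gauss_avg_H1(1) integral_gauss_avg f g f0 g0 e)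
      then show ?thesis by linarith
    qed
    also have "\<dots> = (D * exp (- \<gamma> * real N)) * (?Hf * ?Hg)" by (simp add: mult_ac)
    also have "\<dots> \<le> ((\<bar>D\<bar> + 1) * exp (- \<gamma> * real N)) * (?Hf * ?Hg)"
      by (intro mult_right_mono mult_nonneg_nonneg H1_norm_nonneg) auto
    also have "\<dots> \<le> ((\<bar>D\<bar> + 1) * exp (- \<gamma> * real N)) * ((?Hf\<^sup>2 + ?Hg\<^sup>2) / 2)"
      using sum_squares_bound[of ?Hf ?Hg] by (intro mult_left_mono) auto
    also have "\<dots> \<le> ((\<bar>D\<bar> + 1) * exp (- \<gamma> * real N)) * (((1 + A) / \<epsilon>\<^sup>2 * energy f + (1 + A) / \<epsilon>\<^sup>2 * energy g) / 2)"
      by (intro mult_left_mono divide_right_mono add_mono H f g) auto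
    also have "\<dots> = M * exp (- \<gamma> * real N) / \<epsilon>\<^sup>2 * ((energy f + energy g) / 2)"
    proof -
      have "((1 + A) / \<epsilon>\<^sup>2 * energy f + (1 + A) / \<epsilon>\<^sup>2 * energy g) / 2 = (1 + A) / \<epsilon>\<^sup>2 * ((energy f + energy g) / 2)"
        by (simp only: distrib_left times_divide_eq_right)
      then show ?thesis by (simp only: M_def) (simp add: mult_ac)
    qed
    finally show "(\<integral>x. gauss_avg \<epsilon> f ((\<phi> ^^ N) x) * gauss_avg \<epsilon> g x \<partial>torus_measure)
        \<le> M * exp (- \<gamma> * real N) / \<epsilon>\<^sup>2 * ((energy f + energy g) / 2)" .
  qed
qed

lemma mixing_time_le:
  fixes \<phi> :: "'n::finite torus \<Rightarrow> 'n torus"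
  assumes mp: "torus_measure_preserving \<phi>" and e: "0 < \<epsilon>" "\<epsilon> \<le> 1"
    and bound: "\<And>f x. f \<in> bounded_borel \<Longrightarrow> (\<integral>x. f x \<partial>torus_measure) = 0 \<Longrightarrow> (\<And>x. \<bar>f x\<bar> \<le> 1) \<Longrightarrow>
      \<bar>(markov_op \<phi> \<epsilon> ^^ n) f x\<bar> \<le> \<delta>"
  shows "mixing_time \<phi> (gaussian_noise \<epsilon>) \<delta> \<le> enat n"
proof -
  have "tv_dist (process_law \<phi> (gaussian_noise \<epsilon>) \<mu> n) torus_measure \<le> \<delta>"
    if "prob_space \<mu> \<and> sets \<mu> = sets borel" for \<mu>
    using that by (intro tv_dist_process_law_le[OF mp e] bound) auto
  then show ?thesis unfolding mixing_time_def by (intro Inf_lower imageI CollectI allI impI)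
qed

lemma energy_le_1:
  fixes f :: "'n::finite torus \<Rightarrow> real"
  assumes f: "f \<in> bounded_borel" and "\<And>x. \<bar>f x\<bar> \<le> 1"
  shows "energy f \<le> 1"
  unfolding energy_def
proof (rule torus_measure.integral_le_const)
  show "integrable torus_measure (\<lambda>x. (f x)\<^sup>2)"
    by (intro integrable_torus_bounded_borel bounded_borel_power2 f)
  show "AE x in torus_measure. (f x)\<^sup>2 \<le> 1"
    using assms(2) by (simp add: abs_square_le_1)
qed

theorem corollary1p4:
  fixes \<phi> :: "'n::finite torus \<Rightarrow> 'n torus"
  assumes "torus_C1 \<phi>"
    and "torus_measure_preserving \<phi>"
    and "exponentially_mixing \<phi>"
  shows "\<exists>C::real. \<forall>\<^sub>F \<epsilon> in at_right 0.
    ereal_of_enat (mixing_time \<phi> (gaussian_noise \<epsilon>) (1 / 2)) \<le> ereal (C * \<bar>ln \<epsilon>\<bar> ^ 3)"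
proof -
  note mp = assms(2)
  obtain M \<gamma> where M: "0 < M" "0 < \<gamma>" and corr:
    "\<And>\<epsilon> f g N. 0 < \<epsilon> \<Longrightarrow> \<epsilon> \<le> 1 \<Longrightarrow> f \<in> bounded_borel \<Longrightarrow> g \<in> bounded_borel \<Longrightarrow>
      (\<integral>x. f x \<partial>torus_measure) = 0 \<Longrightarrow> (\<integral>x. g x \<partial>torus_measure) = 0 \<Longrightarrow>
      (\<integral>x. gauss_avg \<epsilon> f ((\<phi> ^^ N) x) * gauss_avg \<epsilon> g x \<partial>torus_measure)
        \<le> M * exp (- \<gamma> * real N) / \<epsilon>\<^sup>2 * ((energy f + energy g) / 2)"
    by (rule correlation_of_smoothed_le[OF mp assms(3)]) (rule that; assumption)
  obtain B where B: "0 < B" and sup: "\<And>\<epsilon> (f :: 'n torus \<Rightarrow> real) x. 0 < \<epsilon> \<Longrightarrow> \<epsilon> \<le> 1 \<Longrightarrow> f \<in> bounded_borel \<Longrightarrow>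
      (gauss_avg \<epsilon> f x)\<^sup>2 \<le> B / \<epsilon> ^ CARD('n) * energy f"
    by (rule gauss_avg_sup_bound[where 'n='n]) (rule that; assumption)
  define d where "d = real CARD('n)"
  define a where "a = 3 / \<gamma> + 3"
  define b where "b = a * (d + 1) + 1"
  \<comment> \<open>Beyond this threshold for \<open>\<bar>ln \<epsilon>\<bar>\<close> one extra multiple of \<open>\<bar>ln \<epsilon>\<bar>\<close> absorbs each multiplicative constant.\<close>
  define L0 where "L0 = max 1 (max (ln (2 * M)) (ln (4 * B)))"
  have "ereal_of_enat (mixing_time \<phi> (gaussian_noise \<epsilon>) (1 / 2)) \<le> ereal ((b * a + 1) * \<bar>ln \<epsilon>\<bar> ^ 3)"
    if eps: "\<epsilon> \<in> {0<..<exp (- L0)}" for \<epsilon>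
  proof -
    define L where "L = - ln \<epsilon>"
    have "0 < \<epsilon>" "\<epsilon> < exp (- L0)" using eps by auto
    then have "ln \<epsilon> < - L0" by (metis exp_gt_zero ln_exp ln_less_cancel_iff)
    then have L: "1 \<le> L" "ln (2 * M) \<le> L" "ln (4 * B) \<le> L" by (auto simp: L_def L0_def)
    have exp_L: "\<epsilon> = exp (- L)" using \<open>0 < \<epsilon>\<close> by (simp add: L_def)
    have e: "0 < \<epsilon>" "\<epsilon> \<le> 1" using L by (auto simp: exp_L)
    have abs_ln: "\<bar>ln \<epsilon>\<bar> = L" using L by (simp add: exp_L)
    \<comment> \<open>Of the three multiples of \<open>L\<close>, two cancel the factor \<open>1 / \<epsilon>\<^sup>2\<close> of the Sobolev norms and the third absorbs \<open>M\<close>.\<close>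
    define N where "N = nat \<lceil>3 * L / \<gamma>\<rceil>"
    \<comment> \<open>Of the \<open>d + 1\<close> multiples of \<open>L\<close>, \<open>d\<close> cancel the factor \<open>1 / \<epsilon>\<^sup>d\<close> of the uniform bound and the last absorbs \<open>B\<close>.\<close>
    define k where "k = nat \<lceil>(real N + 2) * (d + 1) * L\<rceil>"
    have d: "0 \<le> d" by (simp add: d_def)
    have N: "3 * L / \<gamma> \<le> real N" "real N \<le> 3 * L / \<gamma> + 1"
      using L M(2) by (auto simp: N_def ceiling_correct intro: real_nat_ceiling_ge)
    have k: "(real N + 2) * (d + 1) * L \<le> real k" "real k \<le> (real N + 2) * (d + 1) * L + 1"
      using L d by (auto simp: k_def intro: real_nat_ceiling_ge)
    let ?T = "markov_op \<phi> \<epsilon>"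
    have small: "M * exp (- \<gamma> * real N) / \<epsilon>\<^sup>2 \<le> 1 / 2"
    proof -
      have "2 * M = exp (ln (2 * M))" using M by simp
      also have "\<dots> \<le> exp L" using L by simp
      finally have "2 * M * exp (- \<gamma> * real N) / \<epsilon>\<^sup>2 \<le> exp L * exp (- \<gamma> * real N) / \<epsilon>\<^sup>2"
        by (intro divide_right_mono mult_right_mono) auto
      also have "\<dots> = exp (3 * L - \<gamma> * real N)"
        by (simp add: exp_L power2_eq_square exp_add[symmetric] exp_diff[symmetric])
      also have "\<dots> \<le> 1" using N(1) M(2) by (simp add: field_simps)
      finally show ?thesis by (simp add: mult_ac)
    qed
    have decay: "energy ((?T ^^ Suc N) h) \<le> (1 - 1 / (real N + 2)) * energy h"
      if h: "h \<in> bounded_borel" "(\<integral>x. h x \<partial>torus_measure) = 0" for h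
    proof (rule energy_decay_of_decorrelation[OF mp h(1)])
      have "(\<integral>x. gauss_avg \<epsilon> h ((\<phi> ^^ N) x) * gauss_avg \<epsilon> ((?T ^^ N) h) x \<partial>torus_measure)
          \<le> M * exp (- \<gamma> * real N) / \<epsilon>\<^sup>2 * ((energy h + energy ((?T ^^ N) h)) / 2)"
        by (rule corr[OF e h(1) markov_op_funpow_bounded_borel[OF mp h(1)] h(2)])
           (simp add: integral_markov_op_funpow[OF mp h(1)] h(2))
      also have "\<dots> \<le> 1 / 2 * energy h"
        using small energy_markov_op_funpow_le[OF mp h(1), of N \<epsilon>] energy_nonneg[of h] energy_nonneg[of "(?T ^^ N) h"]
        by (intro mult_mono) auto
      finally show "(\<integral>x. gauss_avg \<epsilon> h ((\<phi> ^^ N) x) * gauss_avg \<epsilon> ((?T ^^ N) h) x \<partial>torus_measure) \<le> energy h / 2"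
        by simp
    qed
    \<comment> \<open>The successor is the final regularizing step.\<close>
    have "mixing_time \<phi> (gaussian_noise \<epsilon>) (1 / 2) \<le> enat (Suc (k * Suc N))"
    proof (rule mixing_time_le[OF mp e])
      fix f :: "'n torus \<Rightarrow> real" and x
      assume f: "f \<in> bounded_borel" "(\<integral>x. f x \<partial>torus_measure) = 0" "\<And>x. \<bar>f x\<bar> \<le> 1"
      let ?g = "(?T ^^ (k * Suc N)) f"
      have "energy ?g \<le> (1 - 1 / (real N + 2)) ^ k * energy f"
        by (rule energy_decay_iterate[OF mp decay _ f(1,2)]) simp_all
      also have "\<dots> \<le> (1 - 1 / (real N + 2)) ^ k * 1"
        by (intro mult_left_mono energy_le_1 f zero_le_power) simp
      also have "\<dots> \<le> exp (- 1 / (real N + 2)) ^ k"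
        using exp_ge_add_one_self[of "- 1 / (real N + 2)"] by (simp add: power_mono)
      also have "\<dots> = exp (- (real k / (real N + 2)))" by (simp add: exp_of_nat_mult[symmetric])
      also have "\<dots> \<le> exp (- ((d + 1) * L))"
        using k(1) by (simp add: pos_le_divide_eq mult_ac)
      finally have g: "energy ?g \<le> exp (- ((d + 1) * L))" .
      have "((?T ^^ Suc (k * Suc N)) f x)\<^sup>2 = (gauss_avg \<epsilon> ?g (\<phi> x))\<^sup>2"
        by (simp add: markov_op_def del: mult_Suc_right)
      also have "\<dots> \<le> B / \<epsilon> ^ CARD('n) * energy ?g"
        by (intro sup e markov_op_funpow_bounded_borel[OF mp] f)
      also have "\<dots> \<le> B / \<epsilon> ^ CARD('n) * exp (- ((d + 1) * L))"
        using B e by (intro mult_left_mono g) auto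
      also have "\<dots> = B * exp (- L)"
      proof -
        have "\<epsilon> ^ CARD('n) = exp (- (d * L))" by (simp add: exp_L d_def exp_of_nat_mult[symmetric])
        then have "B / \<epsilon> ^ CARD('n) * exp (- ((d + 1) * L)) = B * exp (- ((d + 1) * L) - - (d * L))"
          by (simp only: exp_diff times_divide_eq_left times_divide_eq_right)
        also have "- ((d + 1) * L) - - (d * L) = - L" by (simp add: algebra_simps)
        finally show ?thesis .
      qed
      also have "\<dots> \<le> 1 / 4"
      proof -
        have "4 * B = exp (ln (4 * B))" using B by simp
        also have "\<dots> \<le> exp L" using L by simp
        finally show ?thesis by (simp add: exp_minus field_simps)
      qed
      finally have "((?T ^^ Suc (k * Suc N)) f x)\<^sup>2 \<le> (1 / 2)\<^sup>2" by (simp add: power2_eq_square)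
      then show "\<bar>(?T ^^ Suc (k * Suc N)) f x\<bar> \<le> 1 / 2"
        unfolding abs_le_square_iff[symmetric] by simp
    qed
    then have "ereal_of_enat (mixing_time \<phi> (gaussian_noise \<epsilon>) (1 / 2)) \<le> ereal_of_enat (enat (Suc (k * Suc N)))"
      by (simp only: ereal_of_enat_le_iff)
    also have "\<dots> = ereal (real k * (real N + 1) + 1)" by (simp add: algebra_simps)
    also have "\<dots> \<le> ereal ((b * a + 1) * \<bar>ln \<epsilon>\<bar> ^ 3)"
    proof -
      have a: "0 \<le> a" using M by (simp add: a_def)
      have b: "0 \<le> b" using a d by (simp add: b_def)
      have Na: "real N + 2 \<le> a * L" using N(2) L(1) by (simp add: a_def distrib_right)
      have "(real N + 2) * (d + 1) * L \<le> (a * L) * (d + 1) * L"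
        using L(1) d by (intro mult_right_mono Na) auto
      with k(2) have "real k \<le> (a * L) * (d + 1) * L + 1" by linarith
      also have "\<dots> \<le> (a * L) * (d + 1) * L + L\<^sup>2" using L(1) by (simp add: one_le_power)
      also have "\<dots> = b * L\<^sup>2" by (simp add: b_def power2_eq_square algebra_simps)
      finally have "real k * (real N + 1) \<le> (b * L\<^sup>2) * (a * L)"
        using Na a L(1) by (intro mult_mono) auto
      moreover have "1 \<le> L ^ 3" using L(1) by (rule one_le_power)
      ultimately have "real k * (real N + 1) + 1 \<le> (b * L\<^sup>2) * (a * L) + L ^ 3" by linarith
      also have "\<dots> = (b * a + 1) * L ^ 3" by (simp add: power2_eq_square power3_eq_cube algebra_simps)
      finally show ?thesis by (simp add: abs_ln)
    qed
    finally show ?thesis .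
  qed
  moreover have "\<forall>\<^sub>F \<epsilon> in at_right 0. \<epsilon> \<in> {0<..<exp (- L0)}"
    by (rule eventually_at_right_real) simp
  ultimately show ?thesis by (intro exI[of _ "b * a + 1"]) (auto elim: eventually_mono)
qed

end
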